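(* Let $d\ge 5$ be a prime, $d=2k+1$, and let $2\le a\le d-1$. Then: (1) $\mu(I_a)=k+3$. Moreover, there exist integers $1\le i_1<i_2<\cdots<i_k\le d-1$ such that $I_a=(x^d,y^d,z^d,f_{i_1},f_{i_2},\ldots,f_{i_k})$, where $f_{i_j}=x^{d-i_j-n_{i_j}}y^{i_j}z^{n_{i_j}}$ for $1\le j\le k$. (2) $I_2$, $I_{d-1}$ and $I_{k+1}$ coincide up to permutation of the variables. (3) If $a\ne 2,\ d-1,\ \frac{d+1}{2}$ and $\frac1a\not\equiv d-a+1 \pmod d$, then $I_a$, $I_b$, $I_c$, $I_{d-a+1}$, $I_{d-b+1}$ and $I_{d-c+1}$, where $b=\frac1a \pmod d$ and $c=\frac{1}{d-a+1}\pmod d$, coincide up to permutation of the variables. (4) If $\frac1a\equiv d-a+1\pmod d$, then $I_a$ and $I_{d-a+1}$ coincide up to permutation of the variables. (5) $I_a$ is a smooth monomial minimal GT-system.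
   Context: $K$ is an algebraically closed field of characteristic zero, $R=K[x,y,z]$, $e\in K$ is a primitive $d$-th root of $1$. For $2\le a\le d-1$, $I_a\subset R$ is the artinian ideal generated by all monomials of degree $d$ invariant under $M_a=\mathrm{diag}(1,e,e^a)$, acting by $x\mapsto x$, $y\mapsto ey$, $z\mapsto e^az$. $\mu(I)$ is the minimal number of generators of $I$. Inverses such as $\frac1a \pmod d$ are taken in $\mathbb{Z}/d\mathbb{Z}$ and represented by integers in $\{1,\dots,d-1\}$. Given $d$ and $a$, $n_1$ is the unique integer with $0<n_1<d$ for which there is an integer $k'>0$ with $dk'-an_1=1$; for any integer $m$, $n_m$ is the remainder of the division of $n_1m$ by $d$. A homogeneous artinian ideal $I\subset R$ generated by $r\le d+1$ forms of degree $d$ is a Togliatti system if for every linear form $L$ the map $\times L:(R/I)_{d-1}\to(R/I)_d$ does not have maximal rank. It is a monomial Togliatti system if generated by monomials; a monomial Togliatti system with minimal monomial generators $m_1,\dots,m_r$ is minimal if no proper subset of these generates a monomial Togliatti system. A monomial Togliatti system $I$ is smooth if the variety $X$, the closure of the image of the rational map from $\mathbb{P}^2$ to projective space given by all monomials of degree $d$ not in $I$ (the degree $d$ part of the Macaulay inverse system of $I$), is smooth. A GT-system is a Togliatti system generated by all forms of degree $d$ invariant under a diagonal representation of $\mathbb{Z}/d\mathbb{Z}$, whose associated morphism from $\mathbb{P}^2$ (given by a minimal set of generators) is a Galois covering of its image with cyclic Galois group $\mathbb{Z}/d\mathbb{Z}$. *)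

theory Defs
  imports
    "HOL-Library.Poly_Mapping"
    "HOL-Library.Function_Algebras"
    "HOL-Computational_Algebra.Polynomial"
    "HOL-Number_Theory.Modular_Inverse"
    "HOL-Algebra.Bij"
    "HOL-Algebra.Elementary_Groups"
begin

section \<open>Polynomials and ideals\<close>

text \<open>The polynomial ring over \<open>'k\<close> in variables indexed by \<open>'i\<close>; an exponent vector is an
  element of \<^typ>\<open>'i \<Rightarrow>\<^sub>0 nat\<close>. The ring \<open>K[x,y,z]\<close> is the case \<open>'i = var\<close>.\<close>

type_synonym ('i, 'k) mpoly = "('i \<Rightarrow>\<^sub>0 nat) \<Rightarrow>\<^sub>0 'k"

datatype var = VX | VY | VZ

definition Const :: "'k::comm_ring_1 \<Rightarrow> ('i, 'k) mpoly" where
  "Const c = Poly_Mapping.single 0 c"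

definition Var :: "'i \<Rightarrow> ('i, 'k::comm_ring_1) mpoly" where
  "Var i = Poly_Mapping.single (Poly_Mapping.single i 1) 1"

definition mon :: "('i \<Rightarrow>\<^sub>0 nat) \<Rightarrow> ('i, 'k::comm_ring_1) mpoly" where
  "mon m = Poly_Mapping.single m 1"

definition expvec :: "nat \<Rightarrow> nat \<Rightarrow> nat \<Rightarrow> var \<Rightarrow>\<^sub>0 nat" where
  "expvec i j l =
     Poly_Mapping.single VX i + Poly_Mapping.single VY j + Poly_Mapping.single VZ l"

definition mdeg :: "('i \<Rightarrow>\<^sub>0 nat) \<Rightarrow> nat" where
  "mdeg m = (\<Sum>i\<in>Poly_Mapping.keys m. Poly_Mapping.lookup m i)"

text \<open>Forms of degree \<open>n\<close> (including 0) involving only the variables in \<open>T\<close>.\<close>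

definition forms :: "'i set \<Rightarrow> nat \<Rightarrow> ('i, 'k::comm_ring_1) mpoly set" where
  "forms T n = {F. \<forall>m\<in>Poly_Mapping.keys F. Poly_Mapping.keys m \<subseteq> T \<and> mdeg m = n}"

text \<open>The ring homomorphism that is \<open>h\<close> on coefficients and sends the \<open>i\<close>-th variable to \<open>s i\<close>.\<close>

definition poly_hom ::
  "('k::comm_ring_1 \<Rightarrow> 'b::comm_ring_1) \<Rightarrow> ('i \<Rightarrow> 'b) \<Rightarrow> ('i, 'k) mpoly \<Rightarrow> 'b" where
  "poly_hom h s F = (\<Sum>m\<in>Poly_Mapping.keys F.
     h (Poly_Mapping.lookup F m) * (\<Prod>i\<in>Poly_Mapping.keys m. s i ^ Poly_Mapping.lookup m i))"

definition ev :: "('i \<Rightarrow> 'k) \<Rightarrow> ('i, 'k::comm_ring_1) mpoly \<Rightarrow> 'k" where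
  "ev v F = poly_hom (\<lambda>c. c) v F"

definition subst ::
  "('i \<Rightarrow> ('j, 'k) mpoly) \<Rightarrow> ('i, 'k::comm_ring_1) mpoly \<Rightarrow> ('j, 'k) mpoly" where
  "subst s F = poly_hom Const s F"

definition partial :: "'i \<Rightarrow> ('i, 'k::comm_ring_1) mpoly \<Rightarrow> ('i, 'k) mpoly" where
  "partial i F = (\<Sum>m\<in>Poly_Mapping.keys F.
     Poly_Mapping.single (m - Poly_Mapping.single i 1)
       (of_nat (Poly_Mapping.lookup m i) * Poly_Mapping.lookup F m))"

text \<open>Ideals are the submodules of the ring regarded as a module over itself.\<close>

definition is_ideal :: "'r::comm_ring_1 set \<Rightarrow> bool" where
  "is_ideal I \<longleftrightarrow> module.subspace (*) I"

definition ideal_gen :: "'r::comm_ring_1 set \<Rightarrow> 'r set" where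
  "ideal_gen G = module.span (*) G"

definition min_num_gens :: "'r::comm_ring_1 set \<Rightarrow> nat" where
  "min_num_gens I = (LEAST n. \<exists>G. finite G \<and> card G = n \<and> ideal_gen G = I)"

text \<open>Descending chain condition for the ideals of the quotient by \<open>I\<close>, which correspond to
  the ideals containing \<open>I\<close>.\<close>

definition artinian_ideal :: "'r::comm_ring_1 set \<Rightarrow> bool" where
  "artinian_ideal I \<longleftrightarrow>
     is_ideal I \<and> wf {(J, J'). is_ideal J \<and> is_ideal J' \<and> I \<subseteq> J \<and> J \<subset> J'}"

definition monomial_ideal :: "('i, 'k::comm_ring_1) mpoly set \<Rightarrow> bool" where
  "monomial_ideal I \<longleftrightarrow> (\<exists>M. I = ideal_gen (mon ` M))"

text \<open>All members of a family of ideals coincide up to permutation of the variables.\<close>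

definition coincide_up_to_perm :: "('i, 'k::comm_ring_1) mpoly set set \<Rightarrow> bool" where
  "coincide_up_to_perm \<I> \<longleftrightarrow>
     (\<forall>I\<in>\<I>. \<forall>J\<in>\<I>. \<exists>\<pi>. bij \<pi> \<and> subst (\<lambda>i. Var (\<pi> i)) ` I = J)"

section \<open>Togliatti systems\<close>

text \<open>The map \<open>(R/I)\<^sub>d\<^sub>-\<^sub>1 \<rightarrow> (R/I)\<^sub>d\<close>, \<open>[F] \<mapsto> [L F]\<close>, is injective or surjective. For homogeneous
  \<open>I\<close> the degree \<open>j\<close> part of \<open>R/I\<close> is the space of forms of degree \<open>j\<close> modulo those in \<open>I\<close>.\<close>

definition mult_max_rank ::
  "('i, 'k::comm_ring_1) mpoly set \<Rightarrow> nat \<Rightarrow> ('i, 'k) mpoly \<Rightarrow> bool" where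
  "mult_max_rank I d L \<longleftrightarrow>
     (\<forall>F\<in>forms UNIV (d - 1). L * F \<in> I \<longrightarrow> F \<in> I) \<or>
     (\<forall>G\<in>forms UNIV d. \<exists>F\<in>forms UNIV (d - 1). G - L * F \<in> I)"

definition togliatti :: "nat \<Rightarrow> (var, 'k::field) mpoly set \<Rightarrow> bool" where
  "togliatti d I \<longleftrightarrow>
     (\<exists>G. finite G \<and> card G \<le> d + 1 \<and> G \<subseteq> forms UNIV d \<and> I = ideal_gen G) \<and>
     artinian_ideal I \<and>
     (\<forall>L\<in>forms UNIV 1. \<not> mult_max_rank I d L)"

definition monomial_togliatti :: "nat \<Rightarrow> (var, 'k::field) mpoly set \<Rightarrow> bool" where
  "monomial_togliatti d I \<longleftrightarrow> togliatti d I \<and> monomial_ideal I"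

text \<open>The minimal monomial generating set \<open>M\<close> of a monomial ideal is unique, so it makes no
  difference that it is quantified existentially.\<close>

definition minimal_monomial_togliatti :: "nat \<Rightarrow> (var, 'k::field) mpoly set \<Rightarrow> bool" where
  "minimal_monomial_togliatti d I \<longleftrightarrow> monomial_togliatti d I \<and>
     (\<exists>M. I = ideal_gen (mon ` M) \<and>
          (\<forall>M'. M' \<subset> M \<longrightarrow> ideal_gen (mon ` M') \<noteq> I) \<and>
          (\<forall>M'. M' \<subset> M \<longrightarrow> \<not> monomial_togliatti d (ideal_gen (mon ` M') :: (var, 'k) mpoly set)))"

section \<open>Projective varieties\<close>

text \<open>A point of projective space is the set of all its vectors of homogeneous coordinates. For a
  finite index set \<open>T\<close>, \<open>pspace T\<close> is the projective space of dimension \<open>card T - 1\<close> with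
  homogeneous coordinates indexed by \<open>T\<close> (coordinates outside \<open>T\<close> are 0); \<open>pspace UNIV\<close> over
  \<^typ>\<open>var\<close> is the projective plane.\<close>

type_synonym ('i, 'k) point = "('i \<Rightarrow> 'k) set"

definition pt :: "('i \<Rightarrow> 'k::field) \<Rightarrow> ('i, 'k) point" where
  "pt v = {\<lambda>i. c * v i | c. c \<noteq> 0}"

definition pspace :: "'i set \<Rightarrow> ('i, 'k::field) point set" where
  "pspace T = {pt v | v. v \<noteq> (\<lambda>_. 0) \<and> (\<forall>i. i \<notin> T \<longrightarrow> v i = 0)}"

text \<open>The homogeneous elements of the homogeneous vanishing ideal of \<open>V\<close>.\<close>

definition vanishing :: "'i set \<Rightarrow> ('i, 'k::field) point set \<Rightarrow> ('i, 'k) mpoly set" where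
  "vanishing T V = {F. (\<exists>n. F \<in> forms T n) \<and> (\<forall>p\<in>V. \<forall>v\<in>p. ev v F = 0)}"

definition zariski_closure ::
  "'i set \<Rightarrow> ('i, 'k::field) point set \<Rightarrow> ('i, 'k) point set" where
  "zariski_closure T V = {p\<in>pspace T. \<forall>F\<in>vanishing T V. \<forall>v\<in>p. ev v F = 0}"

text \<open>There are \<open>n\<close> algebraically independent elements \<open>F\<^sub>i/G\<^sub>i\<close> in the function field of the
  irreducible variety \<open>X\<close>; a rational function is 0 if it vanishes wherever the denominators
  do not.\<close>

definition alg_independent_functions ::
  "'i set \<Rightarrow> ('i, 'k::field) point set \<Rightarrow> nat \<Rightarrow> bool" where
  "alg_independent_functions T X n \<longleftrightarrow> (\<exists>F G r.
     (\<forall>i<n. F i \<in> forms T (r i) \<and> G i \<in> forms T (r i) \<and> G i \<notin> vanishing T X) \<and>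
     (\<forall>P :: (nat, 'k) mpoly. (\<forall>m\<in>Poly_Mapping.keys P. Poly_Mapping.keys m \<subseteq> {..<n}) \<longrightarrow>
        (\<forall>p\<in>X. \<forall>v\<in>p. (\<forall>i<n. ev v (G i) \<noteq> 0) \<longrightarrow>
           ev (\<lambda>i. ev v (F i) / ev v (G i)) P = 0) \<longrightarrow> P = 0))"

text \<open>Dimension of an irreducible variety: transcendence degree of the function field.\<close>

definition proj_dim :: "'i set \<Rightarrow> ('i, 'k::field) point set \<Rightarrow> nat" where
  "proj_dim T X = (GREATEST n. alg_independent_functions T X n)"

text \<open>The tangent space, at a point \<open>v\<close>, of the affine cone over \<open>X\<close>. It is the vector space whose
  projectivization is the embedded projective tangent space of \<open>X\<close>, so its vector space
  dimension exceeds that of the Zariski tangent space of \<open>X\<close> by 1.\<close>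

definition cone_tangent_space ::
  "'i set \<Rightarrow> ('i, 'k::field) point set \<Rightarrow> ('i \<Rightarrow> 'k) \<Rightarrow> ('i \<Rightarrow> 'k) set" where
  "cone_tangent_space T X v = {w. (\<forall>i. i \<notin> T \<longrightarrow> w i = 0) \<and>
     (\<forall>F\<in>vanishing T X. (\<Sum>i\<in>T. ev v (partial i F) * w i) = 0)}"

definition smooth_variety :: "'i set \<Rightarrow> ('i, 'k::field) point set \<Rightarrow> bool" where
  "smooth_variety T X \<longleftrightarrow> (\<forall>p\<in>X. \<forall>v\<in>p.
     vector_space.dim (\<lambda>c w i. c * w i) (cone_tangent_space T X v) = proj_dim T X + 1)"

text \<open>The rational map \<open>p \<mapsto> [F(p)]\<close> given by a set \<open>B\<close> of forms of the same degree; the homogeneous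
  coordinates of the target are indexed by \<open>B\<close> itself. It is defined at the points where the
  forms do not all vanish, and does not depend on the representative of \<open>p\<close>.\<close>

definition proj_map ::
  "('i, 'k::field) mpoly set \<Rightarrow> ('i, 'k) point \<Rightarrow> (('i, 'k) mpoly, 'k) point" where
  "proj_map B p = pt (\<lambda>F. if F \<in> B then ev (SOME v. v \<in> p) F else 0)"

definition proj_map_dom :: "('i, 'k::field) mpoly set \<Rightarrow> ('i, 'k) point set" where
  "proj_map_dom B = {p\<in>pspace UNIV. \<exists>v\<in>p. \<exists>F\<in>B. ev v F \<noteq> 0}"

text \<open>Being the closure of the image of an irreducible variety, the variety considered here is
  irreducible, as is needed for \<^const>\<open>proj_dim\<close>.\<close>

definition smooth_system :: "nat \<Rightarrow> (var, 'k::field) mpoly set \<Rightarrow> bool" where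
  "smooth_system d I \<longleftrightarrow>
     (let S = {mon m :: (var, 'k) mpoly | m. mdeg m = d \<and> mon m \<notin> I}
      in smooth_variety S (zariski_closure S (proj_map S ` proj_map_dom S)))"

section \<open>Galois coverings\<close>

text \<open>Regular maps between projective spaces: locally given by forms of the same degree.\<close>

definition regular_map ::
  "'i set \<Rightarrow> 'j set \<Rightarrow> (('i, 'k::field) point \<Rightarrow> ('j, 'k) point) \<Rightarrow> bool" where
  "regular_map S T f \<longleftrightarrow> (\<forall>p\<in>pspace S. f p \<in> pspace T \<and> (\<exists>n A.
     (\<forall>j\<in>T. A j \<in> forms S n) \<and> (\<exists>v\<in>p. \<exists>j\<in>T. ev v (A j) \<noteq> 0) \<and>
     (\<forall>q\<in>pspace S. \<forall>w\<in>q. (\<exists>j\<in>T. ev w (A j) \<noteq> 0) \<longrightarrow>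
        f q = pt (\<lambda>j. if j \<in> T then ev w (A j) else 0))))"

text \<open>For a closed \<open>X\<close> and a form \<open>H\<close> of positive degree \<open>e\<close>, the open subset \<open>H \<noteq> 0\<close> of \<open>X\<close> is
  affine, with coordinate ring the functions \<open>A/H\<^sup>m\<close>, \<open>A\<close> a form of degree \<open>m e\<close>.\<close>

definition basic_open ::
  "('i, 'k::field) point set \<Rightarrow> ('i, 'k) mpoly \<Rightarrow> ('i, 'k) point set" where
  "basic_open X H = {p\<in>X. \<forall>v\<in>p. ev v H \<noteq> 0}"

definition coord_ring ::
  "'i set \<Rightarrow> ('i, 'k::field) point set \<Rightarrow> nat \<Rightarrow> ('i, 'k) mpoly \<Rightarrow>
     (('i, 'k) point \<Rightarrow> 'k) set" where
  "coord_ring T X e H = {r \<in> extensional (basic_open X H).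
     \<exists>m. \<exists>A\<in>forms T (m * e). \<forall>p\<in>basic_open X H. \<forall>v\<in>p. r p = ev v A / ev v H ^ m}"

text \<open>Finiteness of \<open>f\<close> onto a closed subset \<open>X\<close>: \<open>X\<close> is covered by affine open sets with affine
  preimage such that the coordinate ring of the preimage is a finite module over that of the
  open set. As the source is a projective space, every affine open subset of it has the form
  \<open>H' \<noteq> 0\<close>, so that it suffices to admit such preimages.\<close>

definition finite_map ::
  "'i set \<Rightarrow> 'j set \<Rightarrow> ('j, 'k) point set \<Rightarrow>
     (('i, 'k::field) point \<Rightarrow> ('j, 'k) point) \<Rightarrow> bool" where
  "finite_map S T X f \<longleftrightarrow> (\<forall>q\<in>X. \<exists>e H e' H'.
     e > 0 \<and> H \<in> forms T e \<and> e' > 0 \<and> H' \<in> forms S e' \<and>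
     q \<in> basic_open X H \<and>
     {p\<in>pspace S. f p \<in> basic_open X H} = basic_open (pspace S) H' \<and>
     (\<exists>B. finite B \<and> B \<subseteq> coord_ring S (pspace S) e' H' \<and>
        (\<forall>r\<in>coord_ring S (pspace S) e' H'. \<exists>c.
           (\<forall>b\<in>B. c b \<in> coord_ring T X e H) \<and>
           (\<forall>p\<in>basic_open (pspace S) H'. r p = (\<Sum>b\<in>B. c b (f p) * b p)))))"

text \<open>Deck transformations: automorphisms of the source (as a variety) commuting with \<open>f\<close>, as a
  group under composition.\<close>

definition deck_trans ::
  "'i set \<Rightarrow> (('i, 'k::field) point \<Rightarrow> ('j, 'k) point) \<Rightarrow>
     (('i, 'k) point \<Rightarrow> ('i, 'k) point) set" where
  "deck_trans S f = {\<sigma>\<in>Bij (pspace S). regular_map S S \<sigma> \<and>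
     regular_map S S (inv_into (pspace S) \<sigma>) \<and> (\<forall>p\<in>pspace S. f (\<sigma> p) = f p)}"

definition deck_group ::
  "'i set \<Rightarrow> (('i, 'k::field) point \<Rightarrow> ('j, 'k) point) \<Rightarrow>
     (('i, 'k) point \<Rightarrow> ('i, 'k) point) monoid" where
  "deck_group S f = (BijGroup (pspace S))\<lparr>carrier := deck_trans S f\<rparr>"

text \<open>A regular map that is finite onto its image and whose deck transformations act transitively
  on each fibre.\<close>

definition galois_covering ::
  "'i set \<Rightarrow> 'j set \<Rightarrow> (('i, 'k::field) point \<Rightarrow> ('j, 'k) point) \<Rightarrow> bool" where
  "galois_covering S T f \<longleftrightarrow> regular_map S T f \<and> finite_map S T (f ` pspace S) f \<and>
     (\<forall>p\<in>pspace S. \<forall>q\<in>pspace S. f p = f q \<longrightarrow> (\<exists>\<sigma>\<in>deck_trans S f. \<sigma> p = q))"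

section \<open>GT-systems and the ideals \<open>I\<^sub>a\<close>\<close>

definition diag_act :: "(var \<Rightarrow> 'k::comm_ring_1) \<Rightarrow> (var, 'k) mpoly \<Rightarrow> (var, 'k) mpoly" where
  "diag_act \<rho> F = subst (\<lambda>i. Const (\<rho> i) * Var i) F"

text \<open>A diagonal representation of \<open>\<int>/d\<int>\<close> is given by the image of the generator, a diagonal matrix
  with entries \<open>\<rho> i\<close> satisfying \<open>\<rho> i ^ d = 1\<close>. Different minimal sets \<open>B\<close> of generating forms differ
  by a linear change of coordinates in the target, so the choice of \<open>B\<close> is immaterial.\<close>

definition GT_system :: "nat \<Rightarrow> (var, 'k::field) mpoly set \<Rightarrow> bool" where
  "GT_system d I \<longleftrightarrow> togliatti d I \<and>
     (\<exists>\<rho>. (\<forall>i. \<rho> i ^ d = 1) \<and> I = ideal_gen {F\<in>forms UNIV d. diag_act \<rho> F = F}) \<and>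
     (\<exists>B. finite B \<and> B \<subseteq> forms UNIV d \<and> ideal_gen B = I \<and>
        (\<forall>B'. B' \<subset> B \<longrightarrow> ideal_gen B' \<noteq> I) \<and>
        galois_covering UNIV B (proj_map B) \<and>
        deck_group UNIV (proj_map B :: (var, 'k) point \<Rightarrow> _) \<cong> integer_mod_group d)"

definition primitive_root_of_unity :: "nat \<Rightarrow> 'k::field \<Rightarrow> bool" where
  "primitive_root_of_unity d e \<longleftrightarrow> e ^ d = 1 \<and> (\<forall>j. 0 < j \<and> j < d \<longrightarrow> e ^ j \<noteq> 1)"

definition I_ideal :: "'k::field \<Rightarrow> nat \<Rightarrow> nat \<Rightarrow> (var, 'k) mpoly set" where
  "I_ideal e d a = ideal_gen {mon m | m. mdeg m = d \<and>
     diag_act (case_var 1 e (e ^ a)) (mon m) = mon m}"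

definition n1 :: "nat \<Rightarrow> nat \<Rightarrow> nat" where
  "n1 d a = (THE n. 0 < n \<and> n < d \<and> (\<exists>k'>0. int d * k' - int a * int n = 1))"

definition nrem :: "nat \<Rightarrow> nat \<Rightarrow> nat \<Rightarrow> nat" where
  "nrem d a m = (n1 d a * m) mod d"

text \<open>The inverse \<open>1/a (mod d)\<close>, represented in \<open>{1..d-1}\<close> if it exists.\<close>

definition inv_mod :: "nat \<Rightarrow> nat \<Rightarrow> nat" where
  "inv_mod d a = nat (modular_inverse (int d) (int a))"

end

theory Submission
  imports Defs
begin

text \<open>Write \<open>M\<close> for the set of exponent vectors of the invariant monomials of degree \<open>d\<close>. Counting them
  is a matter of the involution \<open>j \<mapsto> d - j\<close>, which swaps the two sides of \<open>j + n\<^sub>j \<le> d\<close>, and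
  the symmetries between the \<open>I\<^sub>a\<close> come from normalizing a permutation of the weights \<open>0, 1, a\<close>.

  Multiplication by a linear form \<open>L\<close> is not injective because the norm of \<open>L\<close>, the product of its
  orbit, is invariant; it is not surjective by a dimension count. An invariant multiple of
  \<open>L = x + y + z\<close> is a multiple of the norm of \<open>L\<close>. Minimality therefore amounts to the fact that every
  invariant monomial occurs in this norm. By Newton's identities the coefficient of
  \<open>x\<^sup>i y\<^sup>s z\<^sup>t\<close> with \<open>0 < r = s + t < d\<close> is congruent to \<open>\<plusminus>d/r \<cdot> (r choose s)\<close> modulo \<open>d\<^sup>2\<close>, hence
  nonzero.

  The variety of the inverse system is the toric surface of a hexagon with vertices
  \<open>x\<^sup>d\<^sup>-\<^sup>1y, \<dots>\<close>; at every vertex the semigroup is free on two generators. The fibres of the map given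
  by \<open>M\<close> are the orbits of the group of order \<open>d\<close>, and a deck transformation agrees with one element of
  this group on a dense open set because the plane is irreducible.\<close>

section \<open>Polynomials\<close>

text \<open>A Togliatti system asks all linear forms to fail, while refuting the property for a
  smaller set takes only one; x + y + z serves because its norm can be controlled. The factors of
  this norm involve \<open>e\<close>, yet its coefficients are rational with denominators prime to
  \<open>d\<close>: in Newton's identities \<open>e\<close> enters through power sums only, and
  these sum over all roots of unity. Each power sum is \<open>d\<close> times an integral
  polynomial, hence so is every elementary symmetric polynomial of index 0 < r < d, and the products
  in Newton's identity vanish modulo d^2. What survives is one binomial coefficient with r < d,
  which the prime \<open>d\<close> does not divide.

  Smoothness is asked for on the closure, also at points outside the image of the map, so the
  surface has to be handled by equations. Binomials coming from linear relations between exponents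
  do this twice: they show that the charts cover the surface and they bound the tangent spaces from
  above; curves inside the charts bound them from below.

  Algebraic closedness enters through the fibres: a d-th root turns proportional values of the
  invariants into equal ones.\<close>

abbreviation lookup :: "('i \<Rightarrow>\<^sub>0 'b::zero) \<Rightarrow> 'i \<Rightarrow> 'b" where
  "lookup \<equiv> Poly_Mapping.lookup"

abbreviation keys :: "('i \<Rightarrow>\<^sub>0 'b::zero) \<Rightarrow> 'i set" where
  "keys \<equiv> Poly_Mapping.keys"

abbreviation single :: "'i \<Rightarrow> 'b \<Rightarrow> 'i \<Rightarrow>\<^sub>0 'b::zero" where
  "single \<equiv> Poly_Mapping.single"

lemma poly_mapping_sum_single:
  "F = (\<Sum>m\<in>keys F. single m (lookup F m))" for F :: "'a \<Rightarrow>\<^sub>0 'b::comm_monoid_add"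
  by (rule poly_mapping_eqI)
     (auto simp: lookup_sum lookup_single when_def in_keys_iff)

text \<open>Identities that are additive in each polynomial reduce to single terms. The zero
  polynomial is the term with coefficient 0, hence there is no separate base case.\<close>

lemma mpoly_induct [case_names single add]:
  fixes F :: "'a \<Rightarrow>\<^sub>0 'b::comm_monoid_add"
  assumes s: "\<And>m c. P (single m c)" and a: "\<And>F G. P F \<Longrightarrow> P G \<Longrightarrow> P (F + G)"
  shows "P F"
proof -
  have 0: "P 0" using s[of undefined 0] by simp
  have "P (\<Sum>m\<in>A. single m (lookup F m))" if "finite A" for A
    using that by induction (auto intro: 0 s a)
  from this[of "keys F"] show ?thesis using poly_mapping_sum_single[of F] by simp
qed

lemma keys_single_subset: "keys (single m c) \<subseteq> {m}"
  by auto

lemma keys_add_nat: "keys (m + n) = keys m \<union> keys n" for m n :: "'i \<Rightarrow>\<^sub>0 nat"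
  by (auto simp: in_keys_iff lookup_add)

subsection \<open>Evaluation homomorphisms\<close>

text \<open>The monomial factor of \<open>poly_hom\<close>, with values in any commutative ring: the
  same lemmas then serve for points, for polynomials substituted for the variables and for
  curves.\<close>

definition mval :: "('i \<Rightarrow> 'b::comm_ring_1) \<Rightarrow> ('i \<Rightarrow>\<^sub>0 nat) \<Rightarrow> 'b" where
  "mval s m = (\<Prod>i\<in>keys m. s i ^ lookup m i)"

lemma mval_superset:
  assumes "finite A" "keys m \<subseteq> A"
  shows "mval s m = (\<Prod>i\<in>A. s i ^ lookup m i)"
  unfolding mval_def using assms
  by (intro prod.mono_neutral_left) (auto simp: in_keys_iff)

lemma mval_0 [simp]: "mval s 0 = 1"
  by (simp add: mval_def)

lemma mval_add: "mval s (m + n) = mval s m * mval s n"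
proof -
  let ?A = "keys m \<union> keys n"
  have "mval s (m + n) = (\<Prod>i\<in>?A. s i ^ lookup (m + n) i)"
    by (intro mval_superset) (auto simp: keys_add_nat)
  also have "\<dots> = (\<Prod>i\<in>?A. s i ^ lookup m i) * (\<Prod>i\<in>?A. s i ^ lookup n i)"
    by (simp add: lookup_add power_add prod.distrib)
  also have "\<dots> = mval s m * mval s n"
    by (simp add: mval_superset[of ?A])
  finally show ?thesis .
qed

lemma mval_single [simp]: "mval s (single i k) = s i ^ k"
  by (cases "k = 0") (auto simp: mval_def)

lemma mval_cong: "(\<And>i. i \<in> keys m \<Longrightarrow> s i = t i) \<Longrightarrow> mval s m = mval t m"
  unfolding mval_def by (intro prod.cong) auto

lemma mdeg_superset:
  assumes "finite A" "keys m \<subseteq> A"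
  shows "mdeg m = (\<Sum>i\<in>A. lookup m i)"
  unfolding mdeg_def using assms
  by (intro sum.mono_neutral_left) (auto simp: in_keys_iff)

lemma mdeg_0 [simp]: "mdeg 0 = 0"
  by (simp add: mdeg_def)

lemma mdeg_add [simp]: "mdeg (m + n) = mdeg m + mdeg n"
proof -
  let ?A = "keys m \<union> keys n"
  have "mdeg (m + n) = (\<Sum>i\<in>?A. lookup (m + n) i)"
    by (intro mdeg_superset) (auto simp: keys_add_nat)
  also have "\<dots> = (\<Sum>i\<in>?A. lookup m i) + (\<Sum>i\<in>?A. lookup n i)"
    by (simp add: lookup_add sum.distrib)
  also have "\<dots> = mdeg m + mdeg n"
    by (simp add: mdeg_superset[of ?A])
  finally show ?thesis .
qed

lemma mdeg_single [simp]: "mdeg (single i k) = k"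
  by (cases "k = 0") (auto simp: mdeg_def)

lemma mdeg_eq_0_iff [simp]: "mdeg m = 0 \<longleftrightarrow> m = 0"
proof
  assume "mdeg m = 0"
  hence "\<forall>i\<in>keys m. lookup m i = 0"
    by (simp add: mdeg_def)
  thus "m = 0" by (intro poly_mapping_eqI) (auto simp: in_keys_iff)
qed simp

lemma mval_scale: "mval (\<lambda>i. c * s i) m = c ^ mdeg m * mval s m"
  by (simp add: mval_def mdeg_def power_mult_distrib prod.distrib power_sum)

lemma mval_mult: "mval (\<lambda>i. r i * s i) m = mval r m * mval s m"
  by (simp add: mval_def power_mult_distrib prod.distrib)

lemma poly_hom_alt: "poly_hom h s F = (\<Sum>m\<in>keys F. h (lookup F m) * mval s m)"
  by (simp add: poly_hom_def mval_def)

text \<open>Three coefficient maps are used: the identity for evaluation, \<open>Const\<close> for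
  substitution, and constant univariate polynomials for restriction to curves.\<close>

locale coeff_hom =
  fixes h :: "'k::comm_ring_1 \<Rightarrow> 'b::comm_ring_1"
  assumes h_0: "h 0 = 0" and h_1: "h 1 = 1"
    and h_add: "h (a + b) = h a + h b" and h_mult: "h (a * b) = h a * h b"
begin

lemma poly_hom_superset:
  assumes "finite A" "keys F \<subseteq> A"
  shows "poly_hom h s F = (\<Sum>m\<in>A. h (lookup F m) * mval s m)"
  unfolding poly_hom_alt using assms
  by (intro sum.mono_neutral_left) (auto simp: in_keys_iff h_0)

lemma poly_hom_single: "poly_hom h s (single m c) = h c * mval s m"
  by (subst poly_hom_superset[of "{m}"]) auto

lemma poly_hom_add: "poly_hom h s (F + G) = poly_hom h s F + poly_hom h s G"
proof -
  let ?A = "keys F \<union> keys G"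
  have "poly_hom h s (F + G) = (\<Sum>m\<in>?A. h (lookup (F + G) m) * mval s m)"
    by (intro poly_hom_superset) (auto simp: in_keys_iff lookup_add)
  also have "\<dots> = (\<Sum>m\<in>?A. h (lookup F m) * mval s m) + (\<Sum>m\<in>?A. h (lookup G m) * mval s m)"
    by (simp add: lookup_add h_add algebra_simps sum.distrib)
  also have "\<dots> = poly_hom h s F + poly_hom h s G"
    by (simp add: poly_hom_superset[of ?A])
  finally show ?thesis .
qed

lemma poly_hom_mult: "poly_hom h s (F * G) = poly_hom h s F * poly_hom h s G"
proof (induction F rule: mpoly_induct)
  case (single m c)
  show ?case
  proof (induction G rule: mpoly_induct)
    case (single n d)
    show ?case
      by (simp add: mult_single poly_hom_single mval_add h_mult algebra_simps)
  qed (simp add: distrib_left poly_hom_add)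
qed (simp add: distrib_right poly_hom_add)

lemma poly_hom_0: "poly_hom h s 0 = 0"
  by (simp add: poly_hom_alt)

lemma poly_hom_1: "poly_hom h s 1 = 1"
  using poly_hom_single[of s 0 1] by (simp add: h_1)

end

lemma coeff_hom_id: "coeff_hom (\<lambda>c. c)"
  by unfold_locales auto

lemma coeff_hom_Const: "coeff_hom Const"
  by unfold_locales (auto simp: Const_def single_add mult_single)

lemma coeff_hom_pCons: "coeff_hom (\<lambda>c. [:c:])"
  by unfold_locales (auto simp: one_pCons)

lemma Const_0 [simp]: "Const 0 = 0"
  and Const_1 [simp]: "Const 1 = 1"
  and Const_add: "Const (a + b) = Const a + Const b"
  and Const_mult: "Const (a * b) = Const a * Const b"
  by (auto simp: Const_def single_add mult_single)

lemma Const_uminus: "Const (- a) = - Const a"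
  by (simp add: Const_def single_uminus)

lemma Const_times_single: "Const c * single m b = single m (c * b)"
  by (simp add: Const_def mult_single)

lemma lookup_Const_times [simp]: "lookup (Const c * F) m = c * lookup F m"
  by (induction F rule: mpoly_induct)
     (auto simp: Const_times_single lookup_single when_def lookup_add distrib_left)

lemma keys_Const_times: "keys (Const c * F) \<subseteq> keys F"
  by (auto simp: in_keys_iff)

lemma mpoly_sum_mon: "F = (\<Sum>m\<in>keys F. Const (lookup F m) * mon m)"
  for F :: "('i, 'k::comm_ring_1) mpoly"
  using poly_mapping_sum_single[of F] by (simp add: mon_def Const_times_single)

lemma mpoly_sum_mon_superset:
  fixes F :: "('i, 'k::comm_ring_1) mpoly"
  assumes "finite A" "keys F \<subseteq> A"
  shows "F = (\<Sum>m\<in>A. Const (lookup F m) * mon m)"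
proof -
  have "(\<Sum>m\<in>keys F. Const (lookup F m) * mon m) =
        (\<Sum>m\<in>A. Const (lookup F m) * (mon m :: ('i, 'k) mpoly))"
    using assms by (intro sum.mono_neutral_left) (auto simp: in_keys_iff)
  thus ?thesis using mpoly_sum_mon[of F] by simp
qed

lemma mon_0 [simp]: "mon 0 = 1"
  by (simp add: mon_def)

lemma mon_add: "mon (m + n) = mon m * mon n"
  by (simp add: mon_def mult_single)

lemma mon_single: "mon (single i k) = Var i ^ k"
proof (induction k)
  case (Suc k)
  have "single i (Suc k) = single i 1 + single i k"
    by (simp flip: single_add)
  thus ?case using Suc by (simp add: mon_add) (simp add: Var_def mon_def)
qed simp

lemma lookup_mon: "lookup (mon m) n = (if m = n then 1 else 0)"
  by (simp add: mon_def lookup_single when_def)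

lemma keys_mon [simp]: "keys (mon m :: ('i, 'k::comm_ring_1) mpoly) = {m}"
  by (simp add: mon_def)

lemma mon_eq_iff [simp]: "(mon m :: ('i, 'k::comm_ring_1) mpoly) = mon n \<longleftrightarrow> m = n"
  by (metis keys_mon singleton_inject)

lemma inj_mon: "inj_on (mon :: _ \<Rightarrow> ('i, 'k::comm_ring_1) mpoly) A"
  by (simp add: inj_on_def)

lemma ev_add [simp]: "ev v (F + G) = ev v F + ev v G"
  unfolding ev_def by (rule coeff_hom.poly_hom_add[OF coeff_hom_id])

lemma ev_mult [simp]: "ev v (F * G) = ev v F * ev v G"
  unfolding ev_def by (rule coeff_hom.poly_hom_mult[OF coeff_hom_id])

lemma ev_0 [simp]: "ev v 0 = 0"
  unfolding ev_def by (rule coeff_hom.poly_hom_0[OF coeff_hom_id])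

lemma ev_1 [simp]: "ev v 1 = 1"
  unfolding ev_def by (rule coeff_hom.poly_hom_1[OF coeff_hom_id])

lemma ev_single: "ev v (single m c) = c * mval v m"
  unfolding ev_def by (rule coeff_hom.poly_hom_single[OF coeff_hom_id])

lemma ev_mon: "ev v (mon m) = mval v m"
  by (simp add: mon_def ev_single)

lemma ev_Const [simp]: "ev v (Const c) = c"
  by (simp add: Const_def ev_single)

lemma ev_Var [simp]: "ev v (Var i) = v i"
  by (simp add: Var_def ev_single)

lemma ev_uminus [simp]: "ev v (- F) = - ev v F"
  using ev_add[of v F "- F"] by (simp add: add_eq_0_iff del: ev_add)

lemma ev_diff [simp]: "ev v (F - G) = ev v F - ev v G"
  using ev_add[of v F "- G"] by simp

lemma ev_sum: "ev v (\<Sum>x\<in>A. f x) = (\<Sum>x\<in>A. ev v (f x))"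
  by (induction A rule: infinite_finite_induct) auto

lemma ev_prod: "ev v (\<Prod>x\<in>A. f x) = (\<Prod>x\<in>A. ev v (f x))"
  by (induction A rule: infinite_finite_induct) auto

lemma ev_power [simp]: "ev v (F ^ n) = ev v F ^ n"
  by (induction n) auto

lemma subst_add [simp]: "subst s (F + G) = subst s F + subst s G"
  unfolding subst_def by (rule coeff_hom.poly_hom_add[OF coeff_hom_Const])

lemma subst_mult [simp]: "subst s (F * G) = subst s F * subst s G"
  unfolding subst_def by (rule coeff_hom.poly_hom_mult[OF coeff_hom_Const])

lemma subst_0 [simp]: "subst s 0 = 0"
  unfolding subst_def by (rule coeff_hom.poly_hom_0[OF coeff_hom_Const])

lemma subst_1 [simp]: "subst s 1 = 1"
  unfolding subst_def by (rule coeff_hom.poly_hom_1[OF coeff_hom_Const])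

lemma subst_single: "subst s (single m c) = Const c * mval s m"
  unfolding subst_def by (rule coeff_hom.poly_hom_single[OF coeff_hom_Const])

lemma subst_mon: "subst s (mon m) = mval s m"
  by (simp add: mon_def subst_single)

lemma subst_Const [simp]: "subst s (Const c) = Const c"
  by (simp add: Const_def subst_single)

lemma subst_Var [simp]: "subst s (Var i) = s i"
  by (simp add: Var_def subst_single)

lemma subst_sum: "subst s (\<Sum>x\<in>A. f x) = (\<Sum>x\<in>A. subst s (f x))"
  by (induction A rule: infinite_finite_induct) auto

lemma subst_prod: "subst s (\<Prod>x\<in>A. f x) = (\<Prod>x\<in>A. subst s (f x))"
  by (induction A rule: infinite_finite_induct) auto

lemma subst_power [simp]: "subst s (F ^ n) = subst s F ^ n"
  by (induction n) auto

lemma ev_mval: "ev v (mval s m) = mval (\<lambda>i. ev v (s i)) m"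
  by (simp add: mval_def ev_prod)

lemma ev_subst: "ev v (subst s F) = ev (\<lambda>i. ev v (s i)) F"
  by (induction F rule: mpoly_induct) (simp_all add: subst_single ev_single ev_mval)

lemma subst_mval: "subst t (mval s m) = mval (\<lambda>i. subst t (s i)) m"
  by (simp add: mval_def subst_prod)

lemma subst_subst: "subst t (subst s F) = subst (\<lambda>i. subst t (s i)) F"
  by (induction F rule: mpoly_induct) (simp_all add: subst_single subst_mval)

lemma mval_Var: "(mval Var m :: ('i, 'k::comm_ring_1) mpoly) = mon m"
proof -
  have "(mon (\<Sum>i\<in>A. single i (lookup m i)) :: ('i, 'k) mpoly) = (\<Prod>i\<in>A. Var i ^ lookup m i)"
    if "finite A" for A
    using that by induction (auto simp: mon_add mon_single)
  from this[of "keys m"] show ?thesis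
    by (simp add: mval_def poly_mapping_sum_single[symmetric])
qed

lemma subst_Var_id [simp]: "subst Var F = F"
  by (induction F rule: mpoly_induct)
     (simp_all add: subst_single mval_Var mon_def Const_times_single)

lemma diag_act_mon:
  fixes \<rho> :: "var \<Rightarrow> 'b::comm_ring_1"
  shows "diag_act \<rho> (mon m) = Const (mval \<rho> m) * mon m"
proof -
  have *: "(Const (c ^ n) :: (var, 'b) mpoly) = Const c ^ n" for c :: 'b and n
    by (induction n) (auto simp: Const_mult)
  have "Const (\<Prod>i\<in>A. f i) = (\<Prod>i\<in>A. Const (f i) :: (var, 'b) mpoly)"
    for A :: "var set" and f :: "var \<Rightarrow> 'b"
    by (induction A rule: infinite_finite_induct) (auto simp: Const_mult)
  hence "mval (\<lambda>i. Const (\<rho> i) :: (var, 'b) mpoly) m = Const (mval \<rho> m)"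
    by (simp add: mval_def *)
  thus ?thesis
    by (simp add: diag_act_def subst_mon mval_mult mval_Var)
qed

subsection \<open>Forms\<close>

lemma UNIV_var: "UNIV = {VX, VY, VZ}"
  using var.exhaust by auto

lemma finite_var [simp]: "finite (A :: var set)"
  by (rule finite_subset[OF subset_UNIV]) (simp add: UNIV_var)

lemma forms_0 [simp]: "0 \<in> forms T n"
  by (simp add: forms_def)

lemma forms_add: "F \<in> forms T n \<Longrightarrow> G \<in> forms T n \<Longrightarrow> F + G \<in> forms T n"
  using keys_add[of F G] by (fastforce simp: forms_def)

lemma forms_sum: "(\<And>x. x \<in> A \<Longrightarrow> f x \<in> forms T n) \<Longrightarrow> (\<Sum>x\<in>A. f x) \<in> forms T n"
  by (induction A rule: infinite_finite_induct) (auto intro: forms_add)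

lemma forms_single: "keys m \<subseteq> T \<Longrightarrow> mdeg m = n \<Longrightarrow> single m c \<in> forms T n"
  by (auto simp: forms_def)

lemma forms_mon: "keys m \<subseteq> T \<Longrightarrow> mdeg m = n \<Longrightarrow> mon m \<in> forms T n"
  by (simp add: mon_def forms_single)

lemma forms_Var: "i \<in> T \<Longrightarrow> Var i \<in> forms T 1"
  by (auto simp: Var_def intro: forms_single)

lemma forms_1 [simp]: "1 \<in> forms T 0"
  by (auto simp: forms_def)

lemma forms_Const_times: "F \<in> forms T n \<Longrightarrow> Const c * F \<in> forms T n"
  using keys_Const_times[of c F] by (auto simp: forms_def)

lemma forms_uminus: "F \<in> forms T n \<Longrightarrow> - F \<in> forms T n"
  using forms_Const_times[of F T n "-1"] by (simp add: Const_uminus)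

lemma forms_diff: "F \<in> forms T n \<Longrightarrow> G \<in> forms T n \<Longrightarrow> F - G \<in> forms T n"
  using forms_add[of F T n "- G"] forms_uminus[of G] by simp

lemma forms_mult: "F \<in> forms T a \<Longrightarrow> G \<in> forms T b \<Longrightarrow> F * G \<in> forms T (a + b)"
  using keys_mult[of F G] by (fastforce simp: forms_def keys_add_nat)

lemma forms_power: "F \<in> forms T a \<Longrightarrow> F ^ n \<in> forms T (a * n)"
proof (induction n)
  case (Suc n)
  thus ?case using forms_mult[of F T a "F ^ n" "a * n"] by simp
qed simp

lemma forms_prod:
  "(\<And>x. x \<in> A \<Longrightarrow> f x \<in> forms T (n x)) \<Longrightarrow> (\<Prod>x\<in>A. f x) \<in> forms T (\<Sum>x\<in>A. n x)"
  by (induction A rule: infinite_finite_induct) (auto intro: forms_mult)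

lemma ev_forms_scale:
  assumes "F \<in> forms T n"
  shows "ev (\<lambda>i. c * v i) F = c ^ n * ev v F"
proof -
  have "ev w F = (\<Sum>m\<in>keys F. lookup F m * mval w m)" for w
    by (simp add: ev_def poly_hom_alt)
  thus ?thesis
    using assms by (auto simp: forms_def mval_scale sum_distrib_left intro!: sum.cong)
qed

lemma ev_forms_cong:
  assumes "F \<in> forms T n" "\<And>i. i \<in> T \<Longrightarrow> v i = w i"
  shows "ev v F = ev w F"
proof -
  have "ev w F = (\<Sum>m\<in>keys F. lookup F m * mval w m)" for w
    by (simp add: ev_def poly_hom_alt)
  moreover have "mval v m = mval w m" if "m \<in> keys F" for m
    using assms that by (intro mval_cong) (auto simp: forms_def)
  ultimately show ?thesis by simp
qed

lemma forms_mval: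
  assumes "\<And>i. i \<in> keys m \<Longrightarrow> s i \<in> forms T k"
  shows "mval s m \<in> forms T (mdeg m * k)"
proof -
  have "mval s m \<in> forms T (\<Sum>i\<in>keys m. k * lookup m i)"
    unfolding mval_def by (intro forms_prod forms_power assms)
  thus ?thesis by (simp add: mdeg_def sum_distrib_left mult.commute)
qed

lemma forms_subst:
  assumes "F \<in> forms S n" "\<And>i. i \<in> S \<Longrightarrow> s i \<in> forms T k"
  shows "subst s F \<in> forms T (n * k)"
proof -
  have "subst s F = (\<Sum>m\<in>keys F. Const (lookup F m) * mval s m)"
    by (simp add: subst_def poly_hom_alt)
  also have "\<dots> \<in> forms T (n * k)"
  proof (intro forms_sum forms_Const_times)
    fix m assume "m \<in> keys F"
    hence m: "keys m \<subseteq> S" "mdeg m = n" using assms(1) by (auto simp: forms_def)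
    show "mval s m \<in> forms T (n * k)"
      using forms_mval[of m s T k] assms(2) m by auto
  qed
  finally show ?thesis .
qed

lemma lookup_expvec [simp]:
  "lookup (expvec i j l) VX = i" "lookup (expvec i j l) VY = j" "lookup (expvec i j l) VZ = l"
  by (auto simp: expvec_def lookup_add lookup_single)

lemma var_poly_mapping_eqI:
  "lookup m VX = lookup n VX \<Longrightarrow> lookup m VY = lookup n VY \<Longrightarrow> lookup m VZ = lookup n VZ \<Longrightarrow> m = n"
  by (rule poly_mapping_eqI) (metis var.exhaust)

lemma expvec_lookup: "expvec (lookup m VX) (lookup m VY) (lookup m VZ) = m"
  by (rule var_poly_mapping_eqI) auto

lemma expvec_eq_iff [simp]: "expvec i j l = expvec i' j' l' \<longleftrightarrow> i = i' \<and> j = j' \<and> l = l'"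
  by (metis lookup_expvec)

lemma expvec_cases: obtains i j l where "m = expvec i j l"
  using expvec_lookup by metis

lemma mdeg_expvec [simp]: "mdeg (expvec i j l) = i + j + l"
  by (simp add: expvec_def)

lemma mdeg_var: "mdeg m = lookup m VX + lookup m VY + lookup m VZ"
  by (subst expvec_lookup[of m, symmetric]) (simp only: mdeg_expvec)

lemma mval_expvec: "mval v (expvec i j l) = v VX ^ i * v VY ^ j * v VZ ^ l"
  by (simp add: expvec_def mval_add)

lemma mval_var: "mval v m = v VX ^ lookup m VX * v VY ^ lookup m VY * v VZ ^ lookup m VZ"
  by (subst expvec_lookup[of m, symmetric]) (simp only: mval_expvec)

lemma expvec_mon: "mon (expvec i s t) = Var VX ^ i * Var VY ^ s * Var VZ ^ t"
  by (simp add: expvec_def mon_add mon_single)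

lemma Const_power: "Const (c ^ n) = Const c ^ n"
  by (induction n) (simp_all add: Const_mult)

lemma Const_sum: "Const (\<Sum>x\<in>A. f x) = (\<Sum>x\<in>A. Const (f x))"
  by (induction A rule: infinite_finite_induct) (simp_all add: Const_add)

lemma Const_of_nat: "Const (of_nat n) = of_nat n"
  by (induction n) (simp_all add: Const_add)

lemma finite_mdeg_var: "finite {m :: var \<Rightarrow>\<^sub>0 nat. mdeg m = n}"
proof -
  have "{m :: var \<Rightarrow>\<^sub>0 nat. mdeg m = n} \<subseteq> (\<lambda>(i, j, l). expvec i j l) ` ({..n} \<times> {..n} \<times> {..n})"
  proof
    fix m :: "var \<Rightarrow>\<^sub>0 nat"
    assume "m \<in> {m. mdeg m = n}"
    thus "m \<in> (\<lambda>(i, j, l). expvec i j l) ` ({..n} \<times> {..n} \<times> {..n})"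
      by (intro image_eqI[of _ _ "(lookup m VX, lookup m VY, lookup m VZ)"])
         (auto simp: expvec_lookup mdeg_var)
  qed
  thus ?thesis by (rule finite_subset) auto
qed

subsection \<open>Linear algebra of polynomials\<close>

interpretation mp: vector_space "\<lambda>(c::'k::field) (F::('i, 'k) mpoly). Const c * F"
  by unfold_locales (auto simp: distrib_left distrib_right Const_add Const_mult mult.assoc)

declare mp.scale_scale [simp del]

lemma mon_independent: "mp.independent (mon ` M :: ('i, 'k::field) mpoly set)"
proof -
  have "u m = 0" if "finite t" "t \<subseteq> M" "(\<Sum>m\<in>t. Const (u m) * (mon m :: ('i, 'k) mpoly)) = 0" "m \<in> t"
    for t u m
  proof -
    have "0 = lookup (\<Sum>m\<in>t. Const (u m) * (mon m :: ('i, 'k) mpoly)) m"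
      using that by simp
    also have "\<dots> = (\<Sum>n\<in>t. if n = m then u m else 0)"
      by (auto simp: lookup_sum lookup_mon intro!: sum.cong)
    also have "\<dots> = u m" using that by simp
    finally show ?thesis by simp
  qed
  note * = this
  show ?thesis
    unfolding mp.dependent_explicit
  proof safe
    fix S u v
    assume S: "finite S" "S \<subseteq> (mon ` M :: ('i, 'k) mpoly set)" "v \<in> S" "u v \<noteq> 0"
      and z: "(\<Sum>v\<in>S. Const (u v) * v) = 0"
    obtain t where t: "t \<subseteq> M" "S = mon ` t" using S(2) by (auto simp: subset_image_iff)
    have ft: "finite t" using S(1) t(2) by (auto intro: finite_imageD inj_mon)
    have "(\<Sum>m\<in>t. Const (u (mon m)) * (mon m :: ('i, 'k) mpoly)) = 0"
      using z unfolding t(2) by (subst (asm) sum.reindex) (auto simp: inj_mon)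
    from *[OF ft t(1) this] S(3,4) t(2) show False by auto
  qed
qed

text \<open>Stated for a family instead of a set because distinct indices may yield the same vector;
  such a repetition is itself a relation.\<close>

lemma linear_relation_exists:
  fixes w :: "'a \<Rightarrow> ('i, 'k::field) mpoly"
  assumes "finite A" "finite t" "card t < card A" "w ` A \<subseteq> mp.span t"
  obtains c where "\<exists>a\<in>A. c a \<noteq> 0" "(\<Sum>a\<in>A. Const (c a) * w a) = 0"
proof (cases "inj_on w A")
  case False
  then obtain a b where ab: "a \<in> A" "b \<in> A" "a \<noteq> b" "w a = w b"
    by (auto simp: inj_on_def)
  define c :: "'a \<Rightarrow> 'k" where "c = (\<lambda>x. if x = a then 1 else if x = b then -1 else 0)"
  have "(\<Sum>x\<in>A. Const (c x) * w x) = (\<Sum>x\<in>{a, b}. Const (c x) * w x)"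
    using ab assms(1) by (intro sum.mono_neutral_right) (auto simp: c_def)
  also have "\<dots> = 0" using ab by (simp add: c_def Const_uminus)
  finally show ?thesis using ab(1) by (intro that[of c]) (auto simp: c_def)
next
  case True
  have "mp.dependent (w ` A)"
  proof (rule ccontr)
    assume "mp.independent (w ` A)"
    from mp.independent_span_bound[OF assms(2) this assms(4)]
    show False using card_image[OF True] assms(3) by simp
  qed
  then obtain u where u: "\<exists>v\<in>w ` A. u v \<noteq> 0" "(\<Sum>v\<in>w ` A. Const (u v) * v) = 0"
    using assms(1) by (auto simp: mp.dependent_finite)
  from u(2) have "(\<Sum>a\<in>A. Const (u (w a)) * w a) = 0"
    by (subst (asm) sum.reindex[OF True]) simp
  thus ?thesis using u(1) by (intro that[of "u \<circ> w"]) auto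
qed

lemma forms_span_mon: "F \<in> forms T n \<Longrightarrow> F \<in> mp.span (mon ` {m. keys m \<subseteq> T \<and> mdeg m = n})"
  for F :: "('i, 'k::field) mpoly"
  by (subst mpoly_sum_mon, intro mp.span_sum mp.span_scale mp.span_base) (auto simp: forms_def)

subsection \<open>Ideals\<close>

lemma module_ring: "module ((*) :: 'r::comm_ring_1 \<Rightarrow> 'r \<Rightarrow> 'r)"
  by unfold_locales (auto simp: algebra_simps)

lemma is_ideal_ideal_gen [simp]: "is_ideal (ideal_gen G)"
  by (simp add: is_ideal_def ideal_gen_def module.subspace_span[OF module_ring])

lemma ideal_gen_superset: "g \<in> G \<Longrightarrow> g \<in> ideal_gen G"
  by (simp add: ideal_gen_def module.span_base[OF module_ring])

lemma ideal_gen_minimal: "G \<subseteq> I \<Longrightarrow> is_ideal I \<Longrightarrow> ideal_gen G \<subseteq> I"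
  by (simp add: ideal_gen_def is_ideal_def module.span_minimal[OF module_ring])

lemma ideal_gen_eqI:
  "G \<subseteq> ideal_gen H \<Longrightarrow> H \<subseteq> ideal_gen G \<Longrightarrow> ideal_gen G = ideal_gen H"
  by (intro antisym ideal_gen_minimal) auto

lemma is_ideal_0: "is_ideal I \<Longrightarrow> 0 \<in> I"
  and is_ideal_add: "is_ideal I \<Longrightarrow> F \<in> I \<Longrightarrow> G \<in> I \<Longrightarrow> F + G \<in> I"
  and is_ideal_mult: "is_ideal I \<Longrightarrow> F \<in> I \<Longrightarrow> H * F \<in> I"
  and is_ideal_sum: "is_ideal I \<Longrightarrow> (\<And>x. x \<in> A \<Longrightarrow> f x \<in> I) \<Longrightarrow> (\<Sum>x\<in>A. f x) \<in> I"
  by (auto simp: is_ideal_def module.subspace_0[OF module_ring] module.subspace_add[OF module_ring] module.subspace_scale[OF module_ring] module.subspace_sum[OF module_ring])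

lemma is_ideal_diff: "is_ideal I \<Longrightarrow> F \<in> I \<Longrightarrow> G \<in> I \<Longrightarrow> F - G \<in> I"
  by (auto simp: is_ideal_def module.subspace_diff[OF module_ring])

lemma is_idealI:
  "0 \<in> I \<Longrightarrow> (\<And>F G. F \<in> I \<Longrightarrow> G \<in> I \<Longrightarrow> F + G \<in> I) \<Longrightarrow> (\<And>H F. F \<in> I \<Longrightarrow> H * F \<in> I) \<Longrightarrow> is_ideal I"
  by (auto simp: is_ideal_def module.subspace_def[OF module_ring])

lemma lookup_single_times:
  fixes G :: "('i, 'k::comm_ring_1) mpoly"
  shows "lookup (single n c * G) (n + m) = c * lookup G m"
proof (induction G rule: mpoly_induct)
  case (single m' b)
  show ?case by (auto simp: mult_single lookup_single when_def)
qed (auto simp: distrib_left lookup_add)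

lemma lookup_single_times_0:
  fixes G :: "('i, 'k::comm_ring_1) mpoly"
  assumes "\<And>m'. m \<noteq> n + m'"
  shows "lookup (single n c * G) m = 0"
proof (rule ccontr)
  assume "lookup (single n c * G) m \<noteq> 0"
  hence "m \<in> keys (single n c * G)" by (simp add: in_keys_iff)
  then obtain a b where "m = a + b" "a \<in> keys (single n c)"
    using keys_mult[of "single n c" G] by auto
  thus False using assms keys_single_subset[of n c] by auto
qed

lemma is_ideal_keys:
  fixes M :: "('i \<Rightarrow>\<^sub>0 nat) set"
  assumes "\<And>m n. m \<in> M \<Longrightarrow> n + m \<in> M"
  shows "is_ideal {F :: ('i, 'k::comm_ring_1) mpoly. keys F \<subseteq> M}"
proof (rule is_idealI)
  fix H F :: "('i, 'k) mpoly" assume "F \<in> {F. keys F \<subseteq> M}"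
  thus "H * F \<in> {F. keys F \<subseteq> M}"
    using keys_mult[of H F] assms by blast
next
  fix F G :: "('i, 'k) mpoly" assume "F \<in> {F. keys F \<subseteq> M}" "G \<in> {F. keys F \<subseteq> M}"
  thus "F + G \<in> {F. keys F \<subseteq> M}"
    using keys_add[of F G] by blast
qed auto

lemma mem_ideal_gen_mon_iff:
  fixes F :: "('i, 'k::comm_ring_1) mpoly"
  shows "F \<in> ideal_gen (mon ` M) \<longleftrightarrow> (\<forall>m\<in>keys F. \<exists>u\<in>M. \<exists>n. m = n + u)"
proof
  let ?U = "{n + u | n u. u \<in> M}"
  have "is_ideal {F :: ('i, 'k) mpoly. keys F \<subseteq> ?U}"
  proof (rule is_ideal_keys)
    fix m n assume "m \<in> ?U"
    then obtain n' u where "u \<in> M" "m = n' + u" by blast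
    thus "n + m \<in> ?U" by (intro CollectI exI[of _ "n + n'"] exI[of _ u]) (simp add: add.assoc)
  qed
  moreover have "mon ` M \<subseteq> {F :: ('i, 'k) mpoly. keys F \<subseteq> ?U}"
  proof (intro image_subsetI)
    fix u assume "u \<in> M"
    hence "u \<in> ?U" by (intro CollectI exI[of _ 0] exI[of _ u]) simp
    thus "mon u \<in> {F :: ('i, 'k) mpoly. keys F \<subseteq> ?U}" by simp
  qed
  ultimately have "ideal_gen (mon ` M) \<subseteq> {F :: ('i, 'k) mpoly. keys F \<subseteq> ?U}"
    by (intro ideal_gen_minimal)
  thus "F \<in> ideal_gen (mon ` M) \<Longrightarrow> (\<forall>m\<in>keys F. \<exists>u\<in>M. \<exists>n. m = n + u)"
    by blast
next
  assume *: "\<forall>m\<in>keys F. \<exists>u\<in>M. \<exists>n. m = n + u"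
  have "Const (lookup F m) * mon m \<in> ideal_gen (mon ` M)" if m: "m \<in> keys F" for m
  proof -
    obtain u n where u: "u \<in> M" and m': "m = n + u" using * m by blast
    from u have "(mon u :: ('i, 'k) mpoly) \<in> ideal_gen (mon ` M)" by (intro ideal_gen_superset) auto
    thus ?thesis unfolding m' mon_add by (intro is_ideal_mult is_ideal_ideal_gen)
  qed
  thus "F \<in> ideal_gen (mon ` M)"
    by (subst mpoly_sum_mon) (intro is_ideal_sum is_ideal_ideal_gen)
qed

lemma ideal_gen_mon_degree:
  assumes "F \<in> ideal_gen (mon ` M)" "\<And>u. u \<in> M \<Longrightarrow> mdeg u = d" "m \<in> keys F"
  shows "mdeg m \<ge> d"
proof -
  obtain u n where un: "u \<in> M" "m = n + u" using assms(1,3) unfolding mem_ideal_gen_mon_iff by blast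
  thus ?thesis using assms(2)[OF un(1)] by simp
qed

lemma ideal_gen_mon_degree_eq:
  assumes "F \<in> ideal_gen (mon ` M)" "\<And>u. u \<in> M \<Longrightarrow> mdeg u = d" "m \<in> keys F" "mdeg m = d"
  shows "m \<in> M"
proof -
  obtain u n where un: "u \<in> M" "m = n + u" using assms(1,3) unfolding mem_ideal_gen_mon_iff by blast
  hence "mdeg n = 0" using assms(2)[OF un(1)] assms(4) by simp
  thus ?thesis using un by simp
qed

lemma forms_mem_ideal_gen_mon_iff:
  assumes "\<And>u. u \<in> M \<Longrightarrow> mdeg u = d" "F \<in> forms T d"
  shows "F \<in> ideal_gen (mon ` M) \<longleftrightarrow> keys F \<subseteq> M"
proof
  assume "F \<in> ideal_gen (mon ` M)"
  with assms ideal_gen_mon_degree_eq[OF this, of d] show "keys F \<subseteq> M"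
    by (auto simp: forms_def)
next
  assume *: "keys F \<subseteq> M"
  show "F \<in> ideal_gen (mon ` M)"
    unfolding mem_ideal_gen_mon_iff
  proof
    fix m assume "m \<in> keys F"
    thus "\<exists>u\<in>M. \<exists>n. m = n + u"
      using * by (intro bexI[of _ m] exI[of _ 0]) auto
  qed
qed

lemma mon_mem_ideal_gen_mon_iff:
  assumes "\<And>u. u \<in> M \<Longrightarrow> mdeg u = d" "mdeg m = d"
  shows "(mon m :: ('i, 'k::comm_ring_1) mpoly) \<in> ideal_gen (mon ` M) \<longleftrightarrow> m \<in> M"
  using forms_mem_ideal_gen_mon_iff[OF assms(1), where F = "mon m :: ('i, 'k) mpoly" and T = UNIV] assms(2)
  by (auto intro: forms_mon)

section \<open>Minimal numbers of generators of monomial ideals\<close>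

lemma lookup_mult_lowest_degree:
  fixes R G :: "('i, 'k::comm_ring_1) mpoly"
  assumes "\<And>n. n \<in> keys G \<Longrightarrow> mdeg n \<ge> d" "mdeg m = d"
  shows "lookup (R * G) m = lookup R 0 * lookup G m"
proof (induction R rule: mpoly_induct)
  case (single n c)
  show ?case
  proof (cases "n = 0")
    case True
    thus ?thesis using lookup_single_times[of 0 c G m] by simp
  next
    case False
    have "lookup (single n c * G) m = 0"
    proof (cases "\<exists>m'. m = n + m'")
      case True
      then obtain m' where m': "m = n + m'" by auto
      have "mdeg n \<noteq> 0" using False by simp
      hence "mdeg m' < d" using assms(2) m' by (simp del: mdeg_eq_0_iff)
      hence "lookup G m' = 0" using assms(1)[of m'] by (auto simp: in_keys_iff)
      thus ?thesis using m' by (simp add: lookup_single_times)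
    qed (auto intro: lookup_single_times_0)
    thus ?thesis using False by (simp add: lookup_single)
  qed
qed (simp_all add: lookup_add distrib_right)

text \<open>A Nakayama argument: the ideal starts in degree \<open>d\<close>, so in degree
  \<open>d\<close> only the constant terms of the cofactors count. The elements of \<open>G\<close>
  may be inhomogeneous.\<close>

lemma card_le_generators:
  fixes M :: "('i \<Rightarrow>\<^sub>0 nat) set" and G :: "('i, 'k::field) mpoly set"
  assumes M: "finite M" "\<And>u. u \<in> M \<Longrightarrow> mdeg u = d"
    and G: "finite G" "ideal_gen G = ideal_gen (mon ` M)"
  shows "card M \<le> card G"
proof -
  \<comment> \<open>The part of a polynomial supported on \<open>M\<close>. Ideal combinations of
    \<open>G\<close> become scalar combinations of the images, which therefore span a space of
    dimension \<open>card M\<close>.\<close>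
  define \<phi> :: "('i, 'k) mpoly \<Rightarrow> ('i, 'k) mpoly"
    where "\<phi> = (\<lambda>F. \<Sum>m\<in>M. Const (lookup F m) * mon m)"
  have "mon u \<in> mp.span (\<phi> ` G)" if u: "u \<in> M" for u
  proof -
    have "mon u \<in> ideal_gen G" unfolding G(2) using u by (intro ideal_gen_superset imageI)
    then obtain r where r: "mon u = (\<Sum>g\<in>G. r g * g)"
      unfolding ideal_gen_def module.span_finite[OF module_ring G(1)] by (rule rangeE)
    have "mon u = (\<Sum>m\<in>M. Const (lookup (mon u) m) * mon m)"
      using M(1) u by (intro mpoly_sum_mon_superset) auto
    also have "\<dots> = (\<Sum>m\<in>M. Const (\<Sum>g\<in>G. lookup (r g) 0 * lookup g m) * mon m)"
    proof (intro sum.cong refl, goal_cases)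
      case (1 m)
      have "lookup (r g * g) m = lookup (r g) 0 * lookup g m" if "g \<in> G" for g
      proof (rule lookup_mult_lowest_degree)
        show "mdeg m = d" using 1 M by auto
        fix n assume n: "n \<in> keys g"
        have "g \<in> ideal_gen (mon ` M)" using ideal_gen_superset[OF that] G(2) by simp
        from ideal_gen_mon_degree[OF this M(2) n] show "d \<le> mdeg n" by simp
      qed
      hence "lookup (mon u) m = (\<Sum>g\<in>G. lookup (r g) 0 * lookup g m)"
        unfolding r lookup_sum by (rule sum.cong[OF refl])
      thus ?case by (simp only:)
    qed
    also have "\<dots> = (\<Sum>g\<in>G. Const (lookup (r g) 0) * \<phi> g)"
    proof -
      have *: "Const (\<Sum>g\<in>G. f g) = (\<Sum>g\<in>G. Const (f g) :: ('i, 'k) mpoly)" for f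
        by (induction G rule: infinite_finite_induct) (auto simp: Const_add)
      have "(\<Sum>g\<in>G. Const (lookup (r g) 0) * \<phi> g) =
          (\<Sum>g\<in>G. \<Sum>m\<in>M. Const (lookup (r g) 0 * lookup g m) * mon m)"
        by (simp only: \<phi>_def sum_distrib_left Const_mult mult.assoc)
      also have "\<dots> = (\<Sum>m\<in>M. \<Sum>g\<in>G. Const (lookup (r g) 0 * lookup g m) * mon m)"
        by (rule sum.swap)
      also have "\<dots> = (\<Sum>m\<in>M. Const (\<Sum>g\<in>G. lookup (r g) 0 * lookup g m) * mon m)"
        by (simp only: * sum_distrib_right)
      finally show ?thesis by (rule sym)
    qed
    also have "\<dots> \<in> mp.span (\<phi> ` G)"
      by (intro mp.span_sum mp.span_scale mp.span_base) auto
    finally show ?thesis .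
  qed
  hence sub: "mon ` M \<subseteq> mp.span (\<phi> ` G)" by (intro image_subsetI)
  have fin: "finite (\<phi> ` G)" using G(1) by (rule finite_imageI)
  have "card (mon ` M :: ('i, 'k) mpoly set) \<le> card (\<phi> ` G)"
    using mp.independent_span_bound[OF fin mon_independent sub] by (rule conjunct2)
  also have "\<dots> \<le> card G" by (rule card_image_le[OF G(1)])
  finally show ?thesis by (simp add: card_image[OF inj_mon])
qed

lemma min_num_gens_mon:
  assumes "finite M" "\<And>u. u \<in> M \<Longrightarrow> mdeg u = d"
  shows "min_num_gens (ideal_gen (mon ` M) :: ('i, 'k::field) mpoly set) = card M"
  unfolding min_num_gens_def
proof (rule Least_equality)
  show "\<exists>G. finite G \<and> card G = card M \<and> ideal_gen G = (ideal_gen (mon ` M) :: ('i, 'k) mpoly set)"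
    using assms(1) by (intro exI[of _ "mon ` M"]) (simp add: card_image[OF inj_mon])
qed (use card_le_generators[OF assms] in blast)

lemma ideal_gen_psubset_mon:
  assumes "finite M" "\<And>u. u \<in> M \<Longrightarrow> mdeg u = d" "B \<subset> mon ` M"
  shows "ideal_gen B \<noteq> (ideal_gen (mon ` M) :: ('i, 'k::field) mpoly set)"
proof
  assume *: "ideal_gen B = ideal_gen (mon ` M)"
  have "finite B" using assms(1,3) by (meson finite_imageI finite_subset psubset_imp_subset)
  from card_le_generators[OF assms(1,2) this *] psubset_card_mono[OF _ assms(3)] assms(1)
  show False by (simp add: card_image[OF inj_mon])
qed

subsection \<open>Generic points\<close>

text \<open>Uniqueness of digits is what keeps distinct monomials distinct under the Kronecker
  substitution.\<close>

lemma base_expansion_unique: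
  fixes a b :: "nat \<Rightarrow> nat"
  assumes "(\<Sum>k<n. a k * B ^ k) = (\<Sum>k<n. b k * B ^ k)"
    and "\<And>k. k < n \<Longrightarrow> a k < B" "\<And>k. k < n \<Longrightarrow> b k < B" "k < n"
  shows "a k = b k"
  using assms
proof (induction n arbitrary: a b k)
  case (Suc n)
  have split: "(\<Sum>k<Suc n. c k * B ^ k) = c 0 + B * (\<Sum>k<n. c (Suc k) * B ^ k)" for c :: "nat \<Rightarrow> nat"
    by (simp add: sum.lessThan_Suc_shift sum_distrib_left mult_ac del: sum.lessThan_Suc)
  have mod: "(\<Sum>k<Suc n. c k * B ^ k) mod B = c 0" "(\<Sum>k<Suc n. c k * B ^ k) div B = (\<Sum>k<n. c (Suc k) * B ^ k)"
    if "c 0 < B" for c :: "nat \<Rightarrow> nat"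
    unfolding split using that by auto
  have 0: "a 0 = b 0" using mod(1)[of a] mod(1)[of b] Suc.prems by auto
  have 1: "(\<Sum>k<n. a (Suc k) * B ^ k) = (\<Sum>k<n. b (Suc k) * B ^ k)"
    using mod(2)[of a] mod(2)[of b] Suc.prems by auto
  show ?case
  proof (cases k)
    case (Suc k')
    thus ?thesis
      using Suc.IH[OF 1, of k'] Suc.prems by auto
  qed (use 0 in simp)
qed simp

text \<open>Kronecker substitution \<open>X\<^sub>i \<mapsto> t\<^bsup>B^i\<^esup>\<close> with a large base \<open>B\<close> reduces the
  statement to univariate polynomials.\<close>

lemma generic_point:
  fixes \<F> :: "('i, 'k::field_char_0) mpoly set"
  assumes "finite \<F>" "0 \<notin> \<F>"
  obtains v where "\<And>i. v i \<noteq> 0" "\<And>F. F \<in> \<F> \<Longrightarrow> ev v F \<noteq> 0"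
proof -
  define V where "V = (\<Union>F\<in>\<F>. \<Union>m\<in>keys F. keys m)"
  have V: "finite V" using assms(1) by (auto simp: V_def)
  define D where "D = (\<Union>F\<in>\<F>. \<Union>m\<in>keys F. lookup m ` V)"
  \<comment> \<open>Exceeds every exponent that occurs, so exponent vectors are digit strings in
    base \<open>B\<close>.\<close>
  define B where "B = Suc (Max (insert 0 D))"
  have D: "finite D" using assms(1) V by (auto simp: D_def)
  have B: "lookup m i < B" if "F \<in> \<F>" "m \<in> keys F" "i \<in> V" for F m i
  proof -
    have "lookup m i \<in> D" using that by (auto simp: D_def)
    thus ?thesis using D by (auto simp: B_def less_Suc_eq_le)
  qed
  obtain f :: "'i \<Rightarrow> nat" and n where f: "f ` V = {i. i < n}" "inj_on f V"
    using finite_imp_inj_to_nat_seg[OF V] by blast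
  define W where "W = (\<lambda>m. \<Sum>i\<in>V. lookup m i * B ^ f i)"
  have inj: "m = m'" if F: "F \<in> \<F>" "m \<in> keys F" "m' \<in> keys F" and W: "W m = W m'" for F m m'
  proof -
    have W': "W m = (\<Sum>k<n. lookup m (inv_into V f k) * B ^ k)" for m
    proof -
      have "{..<n} = f ` V" using f(1) by auto
      hence "(\<Sum>k<n. lookup m (inv_into V f k) * B ^ k) =
            (\<Sum>i\<in>V. lookup m (inv_into V f (f i)) * B ^ f i)"
        using sum.reindex[OF f(2)] by simp
      also have "\<dots> = W m" unfolding W_def using f(2) by (intro sum.cong) auto
      finally show ?thesis by simp
    qed
    have V': "inv_into V f k \<in> V" if "k < n" for k
      using that f(1) by (auto intro!: inv_into_into)
    have *: "lookup m (inv_into V f k) = lookup m' (inv_into V f k)" if "k < n" for k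
      by (rule base_expansion_unique[where n = n and B = B and k = k])
         (use W V' B F that in \<open>auto simp: W'\<close>)
    have "lookup m i = lookup m' i" for i
    proof (cases "i \<in> V")
      case True
      hence "f i < n" using f(1) by auto
      with *[of "f i"] True f(2) show ?thesis by simp
    next
      case False
      thus ?thesis using F by (auto simp: V_def in_keys_iff)
    qed
    thus ?thesis by (rule poly_mapping_eqI)
  qed
  define g where "g = (\<lambda>F :: ('i, 'k) mpoly. \<Sum>m\<in>keys F. monom (lookup F m) (W m))"
  have g_nz: "g F \<noteq> 0" if F: "F \<in> \<F>" for F
  proof -
    obtain m where m: "m \<in> keys F" using F assms(2) by (metis all_not_in_conv keys_eq_empty)
    have "coeff (g F) (W m) = (\<Sum>m'\<in>keys F. if m' = m then lookup F m' else 0)"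
      unfolding g_def coeff_sum using inj[OF F] m by (intro sum.cong) auto
    also have "\<dots> = lookup F m" using m by (simp add: in_keys_iff)
    finally show ?thesis using m by (auto simp: in_keys_iff)
  qed
  have poly_g: "poly (g F) t = ev (\<lambda>i. if i \<in> V then t ^ (B ^ f i) else 1) F" if F: "F \<in> \<F>" for F t
  proof -
    have "mval (\<lambda>i. if i \<in> V then t ^ (B ^ f i) else 1) m = t ^ W m" if "m \<in> keys F" for m
    proof -
      have "keys m \<subseteq> V" using F that by (auto simp: V_def)
      hence "mval (\<lambda>i. if i \<in> V then t ^ (B ^ f i) else 1) m =
          (\<Prod>i\<in>V. (if i \<in> V then t ^ (B ^ f i) else 1) ^ lookup m i)"
        using V by (intro mval_superset)
      also have "\<dots> = (\<Prod>i\<in>V. t ^ (lookup m i * B ^ f i))"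
        by (intro prod.cong) (auto simp: power_mult[symmetric] mult.commute)
      finally show ?thesis by (simp add: W_def power_sum)
    qed
    thus ?thesis by (simp add: g_def ev_def poly_hom_alt poly_sum poly_monom)
  qed
  \<comment> \<open>The factor X forces the parameter, and with it every coordinate of the point, to
    be nonzero; variables that do not occur are set to 1.\<close>
  define h where "h = [:0, 1:] * (\<Prod>F\<in>\<F>. g F)"
  have "h \<noteq> 0" using assms(1) g_nz by (auto simp: h_def)
  hence "finite {t. poly h t = 0}" by (rule poly_roots_finite)
  then obtain t where t: "poly h t \<noteq> 0"
    using infinite_UNIV_char_0[where 'a = 'k] by (metis (mono_tags, lifting) UNIV_I ex_new_if_finite mem_Collect_eq)
  show ?thesis
  proof (rule that)
    show "(if i \<in> V then t ^ (B ^ f i) else 1) \<noteq> 0" for i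
      using t by (auto simp: h_def)
    show "ev (\<lambda>i. if i \<in> V then t ^ (B ^ f i) else 1) F \<noteq> 0" if "F \<in> \<F>" for F
      using t that assms(1) by (auto simp: h_def poly_prod simp flip: poly_g)
  qed
qed

text \<open>The index type of the variables carries no order that would give leading terms; instead,
  a point at which neither factor vanishes decides the matter.\<close>

lemma mpoly_mult_eq_0_iff:
  fixes F G :: "('i, 'k::field_char_0) mpoly"
  shows "F * G = 0 \<longleftrightarrow> F = 0 \<or> G = 0"
proof
  assume 0: "F * G = 0"
  show "F = 0 \<or> G = 0"
  proof (rule ccontr)
    assume "\<not> (F = 0 \<or> G = 0)"
    then obtain v where "ev v F \<noteq> 0" "ev v G \<noteq> 0"
      using generic_point[of "{F, G}"] by (metis finite.emptyI finite_insert insert_iff singletonD)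
    moreover have "ev v F * ev v G = 0" using 0 by (metis ev_0 ev_mult)
    ultimately show False by simp
  qed
qed auto

lemma mpoly_prod_eq_0_iff:
  fixes F :: "'a \<Rightarrow> ('i, 'k::field_char_0) mpoly"
  assumes "finite A"
  shows "(\<Prod>a\<in>A. F a) = 0 \<longleftrightarrow> (\<exists>a\<in>A. F a = 0)"
  using assms by induction (auto simp: mpoly_mult_eq_0_iff)

subsection \<open>Artinian monomial ideals\<close>

lemma subspace_ideal:
  assumes "is_ideal (J :: ('i, 'k::field) mpoly set)"
  shows "mp.subspace J"
  using assms by (intro mp.subspaceI) (auto intro: is_ideal_0 is_ideal_add is_ideal_mult)

text \<open>Modulo \<open>I\<close> every polynomial is congruent to one with all exponents below
  \<open>d\<close>, and these form a finite-dimensional space \<open>S\<close>. On the ideals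
  \<open>J\<close> above \<open>I\<close>, the dimension of \<open>J \<inter> S\<close> is a
  strictly increasing measure.\<close>

lemma artinian_ideal_mon:
  fixes I :: "(var, 'k::field) mpoly set"
  assumes I: "is_ideal I" and pow: "\<And>i. mon (single i d) \<in> I"
  shows "artinian_ideal I"
proof -
  define Q :: "(var \<Rightarrow>\<^sub>0 nat) set" where "Q = {m. \<forall>i. lookup m i < d}"
  have "Q \<subseteq> (\<lambda>(i, j, l). expvec i j l) ` ({..<d} \<times> {..<d} \<times> {..<d})"
  proof
    fix m assume "m \<in> Q"
    thus "m \<in> (\<lambda>(i, j, l). expvec i j l) ` ({..<d} \<times> {..<d} \<times> {..<d})"
      unfolding Q_def
      by (intro image_eqI[of _ _ "(lookup m VX, lookup m VY, lookup m VZ)"]) (auto simp: expvec_lookup)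
  qed
  hence Q: "finite Q" by (rule finite_subset) auto
  define S where "S = mp.span (mon ` Q :: (var, 'k) mpoly set)"
  \<comment> \<open>Truncation: the discarded monomials are divisible by the d-th power of a
    variable and lie in \<open>I\<close>, so an ideal above \<open>I\<close> contains
    \<open>\<pi> F\<close> exactly when it contains \<open>F\<close>.\<close>
  define \<pi> where "\<pi> = (\<lambda>F :: (var, 'k) mpoly. \<Sum>m\<in>keys F \<inter> Q. Const (lookup F m) * mon m)"
  have \<pi>_S: "\<pi> F \<in> S" for F
    unfolding \<pi>_def S_def by (intro mp.span_sum mp.span_scale mp.span_base) auto
  have \<pi>_I: "F - \<pi> F \<in> I" for F
  proof -
    have "(\<Sum>m\<in>keys F. Const (lookup F m) * mon m) =
        (\<Sum>m\<in>keys F - Q. Const (lookup F m) * mon m) + \<pi> F"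
      unfolding \<pi>_def by (subst sum.Int_Diff[OF finite_keys, of _ F Q]) (rule add.commute)
    with mpoly_sum_mon[of F] have "F = (\<Sum>m\<in>keys F - Q. Const (lookup F m) * mon m) + \<pi> F"
      by (rule trans)
    hence "F - \<pi> F = (\<Sum>m\<in>keys F - Q. Const (lookup F m) * mon m)"
      by (rule iffD2[OF diff_eq_eq])
    moreover have "Const (lookup F m) * mon m \<in> I" if m: "m \<notin> Q" for m
    proof -
      obtain i where i: "d \<le> lookup m i" using m unfolding Q_def mem_Collect_eq not_all not_less by (rule exE)
      have "m = (m - single i d) + single i d"
        by (intro poly_mapping_eqI) (use i in \<open>auto simp: lookup_add lookup_minus lookup_single when_def\<close>)
      hence "(mon m :: (var, 'k) mpoly) = mon ((m - single i d) + single i d)"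
        by (rule arg_cong)
      hence "mon m = mon (m - single i d) * (mon (single i d) :: (var, 'k) mpoly)"
        by (simp only: mon_add)
      thus ?thesis using is_ideal_mult[OF I is_ideal_mult[OF I pow]] by simp
    qed
    hence "(\<Sum>m\<in>keys F - Q. Const (lookup F m) * mon m) \<in> I"
      using I by (intro is_ideal_sum) auto
    ultimately show ?thesis by simp
  qed
  have less: "mp.dim (J \<inter> S) < mp.dim (J' \<inter> S)"
    if J: "is_ideal J" "is_ideal J'" "I \<subseteq> J" "J \<subset> J'" for J J'
  proof -
    obtain F where F: "F \<in> J'" "F \<notin> J" using J(4) by auto
    have 1: "\<pi> F \<in> J'"
      using is_ideal_diff[OF J(2) F(1), of "F - \<pi> F"] \<pi>_I[of F] J by auto
    have 2: "\<pi> F \<notin> J"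
    proof
      assume "\<pi> F \<in> J"
      from is_ideal_add[OF J(1) this, of "F - \<pi> F"] \<pi>_I[of F] J F show False by auto
    qed
    obtain b where b: "b \<subseteq> J \<inter> S" "mp.independent b" "J \<inter> S \<subseteq> mp.span b" "card b = mp.dim (J \<inter> S)"
      by (rule mp.basis_exists)
    obtain b' where b': "b' \<subseteq> J' \<inter> S" "mp.independent b'" "J' \<inter> S \<subseteq> mp.span b'" "card b' = mp.dim (J' \<inter> S)"
      by (rule mp.basis_exists)
    have fin: "finite b'"
      using mp.independent_span_bound[of "mon ` Q" b'] b'(1,2) Q by (auto simp: S_def)
    have finb: "finite b"
      using mp.independent_span_bound[of "mon ` Q" b] b(1,2) Q by (auto simp: S_def)
    have "mp.subspace (J \<inter> S)"
      unfolding S_def by (intro mp.subspace_inter subspace_ideal J mp.subspace_span)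
    hence "mp.span b \<subseteq> J \<inter> S" using b(1) by (intro mp.span_minimal)
    hence n: "\<pi> F \<notin> mp.span b" using 2 by auto
    hence "mp.independent (insert (\<pi> F) b)" using b(2) by (intro mp.independent_insertI)
    moreover have "insert (\<pi> F) b \<subseteq> mp.span b'" using 1 \<pi>_S[of F] b(1) b'(3) J(4) by auto
    ultimately have "card (insert (\<pi> F) b) \<le> card b'"
      using mp.independent_span_bound[OF fin] by auto
    moreover have "\<pi> F \<notin> b" using n mp.span_base by blast
    ultimately show ?thesis using b(4) b'(4) finb by simp
  qed
  have "wf {(J, J'). is_ideal J \<and> is_ideal J' \<and> I \<subseteq> J \<and> J \<subset> J'}"
  proof (rule wf_subset[OF wf_measure[of "\<lambda>J. mp.dim (J \<inter> S)"]], rule subrelI)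
    fix J J' assume "(J, J') \<in> {(J, J'). is_ideal J \<and> is_ideal J' \<and> I \<subseteq> J \<and> J \<subset> J'}"
    hence "is_ideal J" "is_ideal J'" "I \<subseteq> J" "J \<subset> J'" by simp_all
    from less[OF this] show "(J, J') \<in> measure (\<lambda>J. mp.dim (J \<inter> S))" by simp
  qed
  thus ?thesis using I by (simp add: artinian_ideal_def)
qed

text \<open>If the d-th power of the variable \<open>i\<close> were absent, no generator would be a
  power of it, and forbidding more and more powers of that variable would give an infinite descent
  of ideals above the given one.\<close>

lemma artinian_ideal_pure_power:
  fixes M :: "(var \<Rightarrow>\<^sub>0 nat) set"
  assumes "artinian_ideal (ideal_gen (mon ` M) :: (var, 'k::field) mpoly set)"
    and "\<And>m. m \<in> M \<Longrightarrow> mdeg m = d"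
  shows "single i d \<in> M"
proof (rule ccontr)
  assume i: "single i d \<notin> M"
  define E where "E = (\<lambda>n. {m :: var \<Rightarrow>\<^sub>0 nat. \<forall>k<n. m \<noteq> single i k})"
  define J where "J = (\<lambda>n. {F :: (var, 'k) mpoly. keys F \<subseteq> E n})"
  have idl: "is_ideal (J n)" for n
    unfolding J_def
  proof (rule is_ideal_keys)
    fix m n' assume m: "m \<in> E n"
    show "n' + m \<in> E n"
      unfolding E_def
    proof (intro CollectI allI impI notI)
      fix k assume k: "k < n" and e: "n' + m = single i k"
      have "lookup m j = 0" if "j \<noteq> i" for j
        using arg_cong[OF e, of "\<lambda>p. lookup p j"] that by (simp add: lookup_add lookup_single)
      hence "m = single i (lookup m i)"
        by (intro poly_mapping_eqI) (auto simp: lookup_single when_def)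
      moreover have "lookup m i < n"
        using arg_cong[OF e, of "\<lambda>p. lookup p i"] k by (simp add: lookup_add)
      ultimately show False using m by (auto simp: E_def)
    qed
  qed
  have sub: "ideal_gen (mon ` M) \<subseteq> J n" for n
  proof (rule ideal_gen_minimal[OF _ idl], intro image_subsetI)
    fix m assume m: "m \<in> M"
    have "m \<noteq> single i k" for k using assms(2)[OF m] m i by auto
    thus "mon m \<in> J n" by (auto simp: J_def E_def)
  qed
  have "J (Suc n) \<subset> J n" for n
  proof -
    have "mon (single i n) \<in> J n" "mon (single i n) \<notin> J (Suc n)"
      by (auto simp: J_def E_def inj_eq)
    moreover have "E (Suc n) \<subseteq> E n" unfolding E_def using less_SucI by blast
    hence "J (Suc n) \<subseteq> J n" by (auto simp: J_def)
    ultimately show ?thesis by blast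
  qed
  hence "\<forall>n. (J (Suc n), J n) \<in> {(J, J'). is_ideal J \<and> is_ideal J' \<and> ideal_gen (mon ` M) \<subseteq> J \<and> J \<subset> J'}"
    using idl sub by auto
  moreover have "wf {(J :: (var, 'k) mpoly set, J'). is_ideal J \<and> is_ideal J' \<and> ideal_gen (mon ` M) \<subseteq> J \<and> J \<subset> J'}"
    using assms(1) by (simp add: artinian_ideal_def)
  ultimately show False unfolding wf_iff_no_infinite_down_chain by blast
qed

subsection \<open>Newton's identities\<close>

text \<open>Its coefficient at \<open>card J - r\<close> is the elementary symmetric polynomial of
  degree r in the \<open>u j\<close>; its roots are the \<open>- u j\<close>, which accounts for the
  signs below.\<close>

definition linear_prod :: "('a \<Rightarrow> 'r::comm_ring_1) \<Rightarrow> 'a set \<Rightarrow> 'r poly" where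
  "linear_prod u J = (\<Prod>j\<in>J. [:u j, 1:])"

lemma linear_prod_insert:
  "finite J \<Longrightarrow> j \<notin> J \<Longrightarrow> linear_prod u (insert j J) = [:u j, 1:] * linear_prod u J"
  by (simp add: linear_prod_def)

lemma coeff_linear_mult:
  fixes u :: "'r::comm_ring_1"
  shows "coeff ([:u, 1:] * p) n = u * coeff p n + (case n of 0 \<Rightarrow> 0 | Suc n' \<Rightarrow> coeff p n')"
  by (auto simp: coeff_pCons split: nat.splits)

lemma coeff_linear_prod_gt:
  "finite J \<Longrightarrow> n > card J \<Longrightarrow> coeff (linear_prod u J) n = 0"
proof (induction J arbitrary: n rule: finite_induct)
  case empty
  thus ?case by (simp add: linear_prod_def coeff_1)
next
  case (insert j J)
  thus ?case
    unfolding linear_prod_insert[OF insert.hyps(1,2)] coeff_linear_mult by (auto split: nat.splits)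
qed

lemma coeff_linear_prod_card: "finite J \<Longrightarrow> coeff (linear_prod u J) (card J) = 1"
proof (induction J rule: finite_induct)
  case empty
  thus ?case by (simp add: linear_prod_def)
next
  case (insert j J)
  thus ?case
    unfolding linear_prod_insert[OF insert.hyps(1,2)] coeff_linear_mult
    by (simp add: coeff_linear_prod_gt)
qed

text \<open>Both sides are coefficients of the derivative of \<open>linear_prod u J\<close>.\<close>

lemma coeff_sum_linear_prod_diff:
  assumes "finite J"
  shows "coeff (\<Sum>j\<in>J. linear_prod u (J - {j})) n = of_nat (n + 1) * coeff (linear_prod u J) (n + 1)"
  using assms
proof (induction J arbitrary: n rule: finite_induct)
  case empty
  thus ?case by (simp add: linear_prod_def coeff_1)
next
  case (insert x J)
  have "(\<Sum>j\<in>insert x J. linear_prod u (insert x J - {j})) =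
      linear_prod u J + (\<Sum>j\<in>J. linear_prod u (insert x (J - {j})))"
  proof (subst sum.insert)
    have "insert x J - {x} = J" using insert.hyps(2) by simp
    moreover have "insert x J - {j} = insert x (J - {j})" if "j \<in> J" for j
      using that insert.hyps(2) by blast
    ultimately show "linear_prod u (insert x J - {x}) + (\<Sum>j\<in>J. linear_prod u (insert x J - {j})) =
        linear_prod u J + (\<Sum>j\<in>J. linear_prod u (insert x (J - {j})))" by simp
  qed (use insert.hyps in auto)
  also have "(\<Sum>j\<in>J. linear_prod u (insert x (J - {j}))) = [:u x, 1:] * (\<Sum>j\<in>J. linear_prod u (J - {j}))"
    unfolding sum_distrib_left using insert by (intro sum.cong linear_prod_insert) auto
  finally have eq: "(\<Sum>j\<in>insert x J. linear_prod u (insert x J - {j})) =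
      linear_prod u J + [:u x, 1:] * (\<Sum>j\<in>J. linear_prod u (J - {j}))" .
  show ?case
    unfolding eq linear_prod_insert[OF insert.hyps(1,2)] coeff_linear_mult coeff_add
    by (cases n) (simp_all add: insert.IH algebra_simps del: coeff_sum)
qed

text \<open>The logarithmic derivative of P is the sum of the 1/(X + u_j). Expanding each summand as
  a geometric series cut off after N terms, with its remainder, and multiplying by X^N P keeps
  everything polynomial; the identity is one coefficient of the result.\<close>

lemma newton_identity:
  fixes u :: "'a \<Rightarrow> 'r::comm_ring_1"
  assumes J: "finite J" and r: "r < card J"
  defines "E \<equiv> \<lambda>r. coeff (linear_prod u J) (card J - r)"
  shows "of_nat r * E r = - (\<Sum>l\<in>{1..r}. (\<Sum>j\<in>J. (- u j) ^ l) * E (r - l))"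
proof -
  define N where "N = card J"
  define P where "P = linear_prod u J"
  define q where "q = (\<lambda>l. \<Sum>j\<in>J. (- u j) ^ l)"
  define x :: "'r poly" where "x = [:0, 1:]"
  have const_pow: "[:c:] ^ n = [:c ^ n:]" for c :: 'r and n
    by (induction n) (auto simp: one_pCons)
  have x_pow: "x ^ n = monom 1 n" for n
    by (simp add: x_def monom_altdef)
  have key: "x ^ N * linear_prod u (J - {j}) =
      [:(- u j) ^ N:] * linear_prod u (J - {j}) + (\<Sum>l<N. [:(- u j) ^ l:] * x ^ (N - Suc l)) * P"
    if j: "j \<in> J" for j
  proof -
    have Pj: "P = [:u j, 1:] * linear_prod u (J - {j})"
      using linear_prod_insert[of "J - {j}" j u] J by (simp only: P_def insert_Diff[OF j]) simp
    have "[:- u j:] ^ N - x ^ N = ([:- u j:] - x) * (\<Sum>l<N. x ^ (N - Suc l) * [:- u j:] ^ l)"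
      by (rule power_diff_sumr2)
    also have "[:- u j:] - x = - [:u j, 1:]" by (simp add: x_def)
    finally have "[:(- u j) ^ N:] - x ^ N = - [:u j, 1:] * (\<Sum>l<N. [:(- u j) ^ l:] * x ^ (N - Suc l))"
      by (simp only: const_pow mult.commute[of "x ^ _"])
    moreover have "X * Z = A * Z + S * (Q * Z)" if "A - X = - Q * S" for A X Q S Z :: "'r poly"
    proof -
      have "X = A + Q * S" using that by (simp add: algebra_simps)
      thus ?thesis by (simp add: algebra_simps)
    qed
    ultimately show ?thesis unfolding Pj by blast
  qed
  have "x ^ N * (\<Sum>j\<in>J. linear_prod u (J - {j})) = (\<Sum>j\<in>J. x ^ N * linear_prod u (J - {j}))"
    by (rule sum_distrib_left)
  also have "\<dots> = (\<Sum>j\<in>J. [:(- u j) ^ N:] * linear_prod u (J - {j}) +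
      (\<Sum>l<N. [:(- u j) ^ l:] * x ^ (N - Suc l)) * P)"
    by (intro sum.cong refl key)
  also have "\<dots> = (\<Sum>j\<in>J. [:(- u j) ^ N:] * linear_prod u (J - {j})) +
      (\<Sum>j\<in>J. (\<Sum>l<N. [:(- u j) ^ l:] * x ^ (N - Suc l)) * P)"
    by (rule sum.distrib)
  also have "(\<Sum>j\<in>J. (\<Sum>l<N. [:(- u j) ^ l:] * x ^ (N - Suc l)) * P) =
      (\<Sum>l<N. \<Sum>j\<in>J. smult ((- u j) ^ l) (monom 1 (N - Suc l) * P))"
    unfolding sum_distrib_right by (subst sum.swap) (simp add: x_pow mult.assoc)
  finally have eq: "monom 1 N * (\<Sum>j\<in>J. linear_prod u (J - {j})) =
      (\<Sum>j\<in>J. smult ((- u j) ^ N) (linear_prod u (J - {j}))) +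
      (\<Sum>l<N. \<Sum>j\<in>J. smult ((- u j) ^ l) (monom 1 (N - Suc l) * P))"
    by (simp add: x_pow)
  \<comment> \<open>At this exponent the left side contributes the coefficient of P' of index
    \<open>N - 1 - r\<close>, while the remainder terms have degree N - 1, below \<open>K\<close>,
    and drop out.\<close>
  define K where "K = N + (N - 1 - r)"
  have rN: "r < N" using r by (simp add: N_def)
  have z: "coeff (linear_prod u (J - {j})) K = 0" if "j \<in> J" for j
    using J that rN by (intro coeff_linear_prod_gt) (auto simp: K_def N_def)
  have "coeff (monom 1 N * (\<Sum>j\<in>J. linear_prod u (J - {j}))) K =
      coeff (\<Sum>j\<in>J. linear_prod u (J - {j})) (N - 1 - r)"
    by (simp only: coeff_monom_mult) (simp add: K_def)
  also have "\<dots> = of_nat (N - r) * E r"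
    using rN by (subst coeff_sum_linear_prod_diff[OF J]) (simp add: E_def N_def Suc_diff_Suc)
  finally have "of_nat (N - r) * E r = coeff (monom 1 N * (\<Sum>j\<in>J. linear_prod u (J - {j}))) K" ..
  also have "\<dots> = (\<Sum>l<N. \<Sum>j\<in>J. (- u j) ^ l * coeff (monom 1 (N - Suc l) * P) K)"
    unfolding eq coeff_add coeff_sum coeff_smult by (simp add: z)
  also have "\<dots> = (\<Sum>l<N. q l * coeff P (N - r + l))"
  proof (intro sum.cong refl, goal_cases)
    case (1 l)
    have "coeff (monom 1 (N - Suc l) * P) K = coeff P (K - (N - Suc l))"
      unfolding coeff_monom_mult using 1 by (auto simp: K_def)
    also have "K - (N - Suc l) = N - r + l" using 1 rN by (auto simp: K_def)
    finally show ?case by (simp add: q_def sum_distrib_right)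
  qed
  also have "\<dots> = (\<Sum>l\<in>{..r}. q l * coeff P (N - r + l))"
  proof (rule sum.mono_neutral_right)
    have "coeff P (N - r + l) = 0" if "r < l" for l
      unfolding P_def using that rN by (intro coeff_linear_prod_gt[OF J]) (simp add: N_def)
    hence "q l * coeff P (N - r + l) = 0" if "r < l" for l
      using that by (simp only: mult_zero_right)
    thus "\<forall>l\<in>{..<N} - {..r}. q l * coeff P (N - r + l) = 0" by (simp only: Diff_iff atMost_iff not_le Ball_def) blast
  qed (use rN in auto)
  also have "\<dots> = (\<Sum>l\<in>{..r}. q l * E (r - l))"
  proof (intro sum.cong refl, goal_cases)
    case (1 l)
    hence "N - r + l = card J - (r - l)" using rN by (auto simp: N_def)
    thus ?case by (simp add: E_def P_def)
  qed
  also have "{..r} = insert 0 {1..r}" by auto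
  also have "(\<Sum>l\<in>insert 0 {1..r}. q l * E (r - l)) = q 0 * E r + (\<Sum>l\<in>{1..r}. q l * E (r - l))"
    by simp
  also have "q 0 = of_nat N" by (simp add: q_def N_def)
  finally have "of_nat (N - r) * E r = of_nat N * E r + (\<Sum>l\<in>{1..r}. q l * E (r - l))" .
  moreover have "(of_nat N :: 'r) = of_nat (N - r) + of_nat r"
    using rN by (metis le_add_diff_inverse2 less_imp_le of_nat_add)
  ultimately have "of_nat r * E r + (\<Sum>l\<in>{1..r}. q l * E (r - l)) = 0"
    by (simp add: distrib_right)
  thus ?thesis unfolding q_def by (simp add: eq_neg_iff_add_eq_0)
qed

subsection \<open>Coefficients that are integral at a prime\<close>

text \<open>The localization of the integers at \<open>d\<close>, inside a field of characteristic
  zero. As \<open>d\<close> divides 0, the multiplier \<open>n\<close> is never 0.\<close>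

definition local_int :: "nat \<Rightarrow> 'k::field_char_0 set" where
  "local_int d = {x. \<exists>n q. \<not> int d dvd n \<and> of_int n * x = of_int q}"

definition local_int_poly :: "nat \<Rightarrow> ('i, 'k::field_char_0) mpoly set" where
  "local_int_poly d = {F. \<forall>m. lookup F m \<in> local_int d}"

context
  fixes d :: nat
  assumes d: "prime d"
begin

lemma prime_int_d: "prime (int d)"
  using d by simp

lemma local_int_of_int [simp]: "of_int q \<in> local_int d"
  unfolding local_int_def using prime_int_d
  by (intro CollectI exI[of _ 1] exI[of _ q]) (auto simp: not_prime_unit)

lemma local_int_0 [simp]: "0 \<in> local_int d"
  using local_int_of_int[of 0] by simp

lemma local_int_mult:
  assumes "x \<in> local_int d" "y \<in> local_int d"
  shows "x * y \<in> local_int d"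
proof -
  obtain n q n' q' where h: "\<not> int d dvd n" "\<not> int d dvd n'"
    "of_int n * x = of_int q" "of_int n' * y = of_int q'"
    using assms by (auto simp: local_int_def)
  have "of_int (n * n') * (x * y) = (of_int n * x) * (of_int n' * y)"
    by simp
  also have "\<dots> = of_int (q * q')" by (simp add: h)
  finally have "of_int (n * n') * (x * y) = of_int (q * q')" .
  moreover have "\<not> int d dvd n * n'" using h(1,2) prime_int_d by (simp add: prime_dvd_mult_iff)
  ultimately show ?thesis unfolding local_int_def by blast
qed

lemma local_int_add:
  assumes "x \<in> local_int d" "y \<in> local_int d"
  shows "x + y \<in> local_int d"
proof -
  obtain n q n' q' where h: "\<not> int d dvd n" "\<not> int d dvd n'"
    "of_int n * x = of_int q" "of_int n' * y = of_int q'"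
    using assms by (auto simp: local_int_def)
  have "of_int (n * n') * (x + y) = of_int n' * (of_int n * x) + of_int n * (of_int n' * y)"
    by (simp add: algebra_simps)
  also have "\<dots> = of_int (n' * q + n * q')" by (simp add: h)
  finally have "of_int (n * n') * (x + y) = of_int (n' * q + n * q')" .
  moreover have "\<not> int d dvd n * n'" using h(1,2) prime_int_d by (simp add: prime_dvd_mult_iff)
  ultimately show ?thesis unfolding local_int_def by blast
qed

lemma local_int_uminus: "x \<in> local_int d \<Longrightarrow> - x \<in> local_int d"
  using local_int_mult[of "of_int (-1)" x] local_int_of_int[of "-1"] by simp

lemma local_int_divide:
  assumes "0 < r" "r < d"
  shows "1 / of_nat r \<in> local_int d"
proof -
  have "\<not> int d dvd int r" using assms by (auto dest: zdvd_imp_le)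
  thus ?thesis unfolding local_int_def using assms
    by (intro CollectI exI[of _ "int r"] exI[of _ 1]) auto
qed

text \<open>Carries the conclusion back to the integers: clearing the denominator leaves
  \<open>d\<close> dividing \<open>n * c\<close> with \<open>n\<close> prime to
  \<open>d\<close>.\<close>

lemma local_int_nat_eq_0:
  assumes "w \<in> local_int d" "of_nat c = of_nat d * (w :: 'k::field_char_0)"
  shows "d dvd c"
proof -
  obtain n q where h: "\<not> int d dvd n" "of_int n * w = of_int q"
    using assms(1) by (auto simp: local_int_def)
  have "(of_int (n * int c) :: 'k) = of_nat d * (of_int n * w)" by (simp add: assms(2))
  also have "\<dots> = of_int (int d * q)" by (simp add: h)
  finally have "n * int c = int d * q" by (simp only: of_int_eq_iff)
  hence "int d dvd n * int c" by simp
  thus ?thesis using h(1) prime_int_d by (simp add: prime_dvd_mult_iff)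
qed

lemma local_int_poly_add:
  "F \<in> local_int_poly d \<Longrightarrow> G \<in> local_int_poly d \<Longrightarrow> F + G \<in> local_int_poly d"
  by (auto simp: local_int_poly_def lookup_add intro: local_int_add)

lemma local_int_poly_0 [simp]: "0 \<in> local_int_poly d"
  by (auto simp: local_int_poly_def)

lemma local_int_poly_sum:
  "(\<And>x. x \<in> A \<Longrightarrow> f x \<in> local_int_poly d) \<Longrightarrow> (\<Sum>x\<in>A. f x) \<in> local_int_poly d"
  by (induction A rule: infinite_finite_induct) (auto intro: local_int_poly_add)

lemma local_int_poly_Const:
  "c \<in> local_int d \<Longrightarrow> F \<in> local_int_poly d \<Longrightarrow> Const c * F \<in> local_int_poly d"
  by (auto simp: local_int_poly_def intro: local_int_mult)

lemma local_int_poly_uminus: "F \<in> local_int_poly d \<Longrightarrow> - F \<in> local_int_poly d"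
  by (auto simp: local_int_poly_def intro: local_int_uminus)

lemma local_int_poly_mon_times:
  assumes "G \<in> local_int_poly d"
  shows "mon n * G \<in> local_int_poly d"
  unfolding local_int_poly_def
proof (intro CollectI allI)
  fix m
  show "lookup (mon n * G) m \<in> local_int d"
  proof (cases "\<exists>m'. m = n + m'")
    case True
    thus ?thesis using assms by (auto simp: mon_def lookup_single_times local_int_poly_def)
  next
    case False
    hence "lookup (mon n * G) m = 0" unfolding mon_def by (intro lookup_single_times_0) auto
    thus ?thesis by simp
  qed
qed

lemma local_int_poly_mult:
  assumes "F \<in> local_int_poly d" "G \<in> local_int_poly d"
  shows "F * G \<in> local_int_poly d"
proof -
  have "F * G = (\<Sum>m\<in>keys F. Const (lookup F m) * (mon m * G))"
    by (subst mpoly_sum_mon[of F]) (simp add: sum_distrib_right mult.assoc)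
  also have "\<dots> \<in> local_int_poly d"
    using assms(1) by (intro local_int_poly_sum local_int_poly_Const local_int_poly_mon_times assms(2))
      (auto simp: local_int_poly_def)
  finally show ?thesis .
qed

lemma local_int_poly_mon [simp]: "mon n \<in> local_int_poly d"
  using local_int_of_int[of 1] by (auto simp: local_int_poly_def lookup_mon)

end

section \<open>Invariant monomials\<close>

subsection \<open>Diagonal actions\<close>

lemma diag_act_add: "diag_act \<rho> (F + G) = diag_act \<rho> F + diag_act \<rho> G"
  by (simp add: diag_act_def)

lemma diag_act_prod: "diag_act \<rho> (\<Prod>x\<in>A. f x) = (\<Prod>x\<in>A. diag_act \<rho> (f x))"
  by (simp add: diag_act_def subst_prod)

lemma lookup_diag_act: "lookup (diag_act \<rho> F) m = mval \<rho> m * lookup F m"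
proof (induction F rule: mpoly_induct)
  case (single n c)
  have "diag_act \<rho> (single n c) = Const c * diag_act \<rho> (mon n)"
    by (simp add: diag_act_def subst_single subst_mon)
  thus ?case by (simp add: diag_act_mon lookup_mon lookup_single when_def)
qed (simp add: diag_act_add lookup_add distrib_left)

lemma diag_act_diag_act: "diag_act \<rho> (diag_act \<rho>' F) = diag_act (\<lambda>i. \<rho> i * \<rho>' i) F"
  by (rule poly_mapping_eqI) (simp add: lookup_diag_act mval_mult)

lemma keys_diag_act: "keys (diag_act \<rho> F) \<subseteq> keys F"
  by (auto simp: in_keys_iff lookup_diag_act)

lemma forms_diag_act: "F \<in> forms T n \<Longrightarrow> diag_act \<rho> F \<in> forms T n"
  using keys_diag_act[of \<rho> F] by (auto simp: forms_def)

lemma diag_act_eq_iff: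
  fixes F :: "(var, 'k::idom) mpoly"
  shows "diag_act \<rho> F = F \<longleftrightarrow> (\<forall>m\<in>keys F. mval \<rho> m = 1)"
  by (auto simp: poly_mapping_eq_iff fun_eq_iff lookup_diag_act in_keys_iff)

subsection \<open>The exponents of the invariant monomials\<close>

text \<open>Free of \<open>e\<close> and meaningful for every weight \<open>a\<close>, so that
  ideals with different weights can be compared.\<close>

definition inv_exps :: "nat \<Rightarrow> nat \<Rightarrow> (var \<Rightarrow>\<^sub>0 nat) set" where
  "inv_exps d a = {m. mdeg m = d \<and> d dvd lookup m VY + a * lookup m VZ}"

lemma finite_inv_exps [simp]: "finite (inv_exps d a)"
  by (rule finite_subset[OF _ finite_mdeg_var[of d]]) (auto simp: inv_exps_def)

lemma inv_exps_mdeg: "m \<in> inv_exps d a \<Longrightarrow> mdeg m = d"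
  by (simp add: inv_exps_def)

lemma primitive_root_power_eq_1_iff:
  fixes e :: "'k::field"
  assumes "primitive_root_of_unity d e" "d > 0"
  shows "e ^ n = 1 \<longleftrightarrow> d dvd n"
proof -
  have "e ^ n = (e ^ d) ^ (n div d) * e ^ (n mod d)"
    by (simp flip: power_mult power_add)
  also have "\<dots> = e ^ (n mod d)"
    using assms by (simp add: primitive_root_of_unity_def)
  finally have "e ^ n = e ^ (n mod d)" .
  moreover have "e ^ (n mod d) = 1 \<longleftrightarrow> n mod d = 0"
    using assms by (metis bot_nat_0.not_eq_extremum mod_less_divisor power_0 primitive_root_of_unity_def)
  ultimately show ?thesis by (simp add: dvd_eq_mod_eq_0)
qed

lemma mval_weights: "mval (case_var 1 e (e ^ a)) m = e ^ (lookup m VY + a * lookup m VZ)"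
  by (simp add: mval_var power_add power_mult)

lemma I_ideal_eq:
  fixes e :: "'k::field"
  assumes "primitive_root_of_unity d e" "d > 0"
  shows "I_ideal e d a = ideal_gen (mon ` inv_exps d a)"
proof -
  have "diag_act (case_var 1 e (e ^ a)) (mon m) = (mon m :: (var, 'k) mpoly) \<longleftrightarrow>
      d dvd lookup m VY + a * lookup m VZ" for m
    by (simp add: diag_act_eq_iff mval_weights primitive_root_power_eq_1_iff[OF assms])
  hence "{mon m :: (var, 'k) mpoly | m. mdeg m = d \<and> diag_act (case_var 1 e (e ^ a)) (mon m) = mon m} =
      mon ` inv_exps d a"
    by (auto simp: inv_exps_def)
  thus ?thesis by (simp add: I_ideal_def)
qed

locale prime_GT =
  fixes d k a :: nat and e :: "'k::{alg_closed_field,field_char_0}"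
  assumes prime_d: "prime d" and d5: "d \<ge> 5" and d_eq: "d = 2 * k + 1"
    and a2: "2 \<le> a" and a_le: "a \<le> d - 1" and prim: "primitive_root_of_unity d e"
begin

definition M where "M = inv_exps d a"

abbreviation wt :: "var \<Rightarrow> 'k" where "wt \<equiv> case_var 1 e (e ^ a)"

lemma d_pos: "d > 0" using d5 by simp

lemma e_nz: "e \<noteq> 0"
  using prim d_pos by (auto simp: primitive_root_of_unity_def zero_power)

lemma e_d: "e ^ d = 1" using prim by (simp add: primitive_root_of_unity_def)

lemma e_pow_iff: "e ^ n = 1 \<longleftrightarrow> d dvd n"
  by (rule primitive_root_power_eq_1_iff[OF prim d_pos])

lemma e_pow_inj:
  assumes "e ^ i = e ^ j" "i < d" "j < d"
  shows "i = j"
  using assms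
proof (induction i j rule: linorder_wlog)
  case (le i j)
  have "e ^ j = e ^ i * e ^ (j - i)" using le(1) by (simp flip: power_add)
  hence "e ^ i * e ^ (j - i) = e ^ i * 1" using le(2) by simp
  hence "e ^ (j - i) = 1" using e_nz by simp
  hence "d dvd j - i" by (simp add: e_pow_iff)
  thus ?case using le by (auto dest: dvd_imp_le)
qed simp

lemma finite_M [simp]: "finite M" by (simp add: M_def)

lemma M_mdeg: "m \<in> M \<Longrightarrow> mdeg m = d" by (simp add: M_def inv_exps_mdeg)

lemma M_iff: "m \<in> M \<longleftrightarrow> mdeg m = d \<and> d dvd lookup m VY + a * lookup m VZ"
  by (simp add: M_def inv_exps_def)

lemma expvec_M_iff: "expvec i s t \<in> M \<longleftrightarrow> i + s + t = d \<and> d dvd s + a * t"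
  by (simp add: M_iff)

lemma pure_M: "single i d \<in> M"
  by (cases i) (auto simp: M_iff lookup_single)

text \<open>Because \<open>0\<close>, \<open>1\<close>, \<open>a\<close> are distinct modulo \<open>d\<close>.\<close>

lemma M_boundary:
  assumes "m \<in> M" "lookup m i = 0"
  shows "\<exists>j. m = single j d"
proof -
  obtain p s t where m: "m = expvec p s t" by (rule expvec_cases)
  have sum: "p + s + t = d" and dv: "d dvd s + a * t" using assms(1) by (auto simp: m expvec_M_iff)
  have ndvd: "t = 0 \<or> t = d" if "d dvd t" using that sum dvd_imp_le[of d t] by (cases "t = 0") auto
  have ndvds: "s = 0 \<or> s = d" if "d dvd s" using that sum dvd_imp_le[of d s] by (cases "s = 0") auto
  have na: "\<not> d dvd a" using a2 a_le d_pos by (auto dest: dvd_imp_le)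
  have na1: "\<not> d dvd a - 1" using a2 a_le d_pos by (auto dest: dvd_imp_le)
  have "(p = d \<and> s = 0 \<and> t = 0) \<or> (p = 0 \<and> s = d \<and> t = 0) \<or> (p = 0 \<and> s = 0 \<and> t = d)"
  proof (cases i)
    case VX
    hence p: "p = 0" using assms(2) m by simp
    \<comment> \<open>Without x the degree fixes s = d - t, so only the difference
      \<open>a - 1\<close> of the weights of z and y remains.\<close>
    have "s + a * t = d + (a - 1) * t"
      using sum p a2 by (cases a) (auto simp: algebra_simps)
    hence "d dvd (a - 1) * t" using dv by (metis dvd_add_right_iff dvd_refl)
    hence "d dvd t" using na1 prime_d by (simp add: prime_dvd_mult_iff)
    thus ?thesis using ndvd sum p by auto
  next
    case VY
    hence s: "s = 0" using assms(2) m by simp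
    hence "d dvd t" using dv na prime_d by (simp add: prime_dvd_mult_iff)
    thus ?thesis using ndvd sum s by auto
  next
    case VZ
    hence t: "t = 0" using assms(2) m by simp
    thus ?thesis using ndvds dv sum by auto
  qed
  thus ?thesis unfolding m
    by (elim disjE) (rule exI[of _ VX] exI[of _ VY] exI[of _ VZ],
      rule var_poly_mapping_eqI; simp add: lookup_single)+
qed

subsection \<open>The norm of \<open>x + y + z\<close>\<close>

text \<open>\<open>Var VX + u j\<close> is the image of x + y + z under the j-th power of the
  diagonal matrix.\<close>

definition u :: "nat \<Rightarrow> (var, 'k) mpoly" where
  "u j = Const (e ^ j) * Var VY + Const (e ^ (a * j)) * Var VZ"

definition E :: "nat \<Rightarrow> (var, 'k) mpoly" where
  "E r = coeff (linear_prod u {..<d}) (d - r)"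

definition N :: "(var, 'k) mpoly" where
  "N = (\<Prod>j<d. Var VX + u j)"

text \<open>The l-th power sum of the \<open>- u j\<close>, divided by \<open>d\<close>. Summation
  over all roots of unity has removed \<open>e\<close>, so the coefficients are integers, and
  \<open>of_int\<close> makes this visible.\<close>

definition q :: "nat \<Rightarrow> (var, 'k) mpoly" where
  "q l = (\<Sum>s\<le>l. Const (of_int ((-1) ^ l * int (l choose s) * (if d dvd s + a * (l - s) then 1 else 0)))
     * mon (expvec 0 s (l - s)))"

lemma sum_root_powers:
  "(\<Sum>j<d. (e ^ n) ^ j) = (if d dvd n then of_nat d else 0)"
proof (cases "d dvd n")
  case True
  hence "e ^ n = 1" by (simp add: e_pow_iff)
  thus ?thesis using True by simp
next
  case False
  hence ne: "e ^ n \<noteq> 1" by (simp add: e_pow_iff)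
  have "(e ^ n) ^ d = 1" using e_d by (metis mult.commute power_mult power_one)
  thus ?thesis using geometric_sum[OF ne, of d] False by simp
qed

text \<open>Binomial expansion followed by orthogonality: the powers of a root of unity sum up to
  \<open>d\<close> or to 0.\<close>

lemma power_sum_u: "(\<Sum>j<d. (- u j) ^ l) = Const (of_nat d) * q l"
proof -
  have "(- u j) ^ l = (\<Sum>s\<le>l. Const ((-1) ^ l * of_nat (l choose s) * (e ^ (s + a * (l - s))) ^ j)
      * mon (expvec 0 s (l - s)))" for j
  proof -
    have "(- u j) ^ l = Const ((-1) ^ l) * u j ^ l"
      by (subst power_minus) (simp add: Const_power Const_uminus)
    also have "u j ^ l = (\<Sum>s\<le>l. of_nat (l choose s) * (Const (e ^ j) * Var VY) ^ s
        * (Const (e ^ (a * j)) * Var VZ) ^ (l - s))"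
      unfolding u_def by (rule binomial_ring)
    also have "Const ((-1) ^ l) * \<dots> =
      (\<Sum>s\<le>l. Const ((-1) ^ l * of_nat (l choose s) * (e ^ (s + a * (l - s))) ^ j)
        * mon (expvec 0 s (l - s)))"
      unfolding sum_distrib_left
    proof (intro sum.cong refl, goal_cases)
      case (1 s)
      have "(e ^ (s + a * (l - s))) ^ j = (e ^ j) ^ s * (e ^ (a * j)) ^ (l - s)"
        by (simp add: algebra_simps flip: power_mult power_add)
      thus ?case
        by (simp add: expvec_mon power_mult_distrib Const_mult Const_of_nat)
          (simp add: Const_power mult_ac)
    qed
    finally show ?thesis .
  qed
  hence "(\<Sum>j<d. (- u j) ^ l) = (\<Sum>s\<le>l. \<Sum>j<d.
      Const ((-1) ^ l * of_nat (l choose s) * (e ^ (s + a * (l - s))) ^ j) * mon (expvec 0 s (l - s)))"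
    by (simp only:) (rule sum.swap)
  also have "\<dots> = (\<Sum>s\<le>l. Const ((-1) ^ l * of_nat (l choose s) * (\<Sum>j<d. (e ^ (s + a * (l - s))) ^ j))
      * mon (expvec 0 s (l - s)))"
    by (simp only: sum_distrib_right[symmetric] Const_sum[symmetric] sum_distrib_left[symmetric])
  also have "\<dots> = Const (of_nat d) * q l"
    unfolding sum_root_powers q_def sum_distrib_left mult.assoc[symmetric] Const_mult[symmetric]
    by (intro sum.cong refl) (auto simp: mult_ac)
  finally show ?thesis .
qed

lemma E_newton:
  assumes "r < d"
  shows "of_nat r * E r = - (\<Sum>l\<in>{1..r}. Const (of_nat d) * q l * E (r - l))"
  using newton_identity[of "{..<d}" r u] assms by (simp add: E_def power_sum_u)

lemma E_0: "E 0 = 1"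
  using coeff_linear_prod_card[of "{..<d}" u] by (simp add: E_def)

lemma q_local: "q l \<in> local_int_poly d"
  unfolding q_def
  by (intro local_int_poly_sum[OF prime_d] local_int_poly_Const[OF prime_d]
      local_int_poly_mon[OF prime_d] local_int_of_int[OF prime_d])

text \<open>By induction every \<open>E s\<close> with 0 < s < r is \<open>d\<close> times an
  integral polynomial, because s is a unit at \<open>d\<close>. So every term of Newton's identity
  carries the factor d^2, except the one with \<open>E 0 = 1\<close>, which is - d q_r.\<close>

lemma E_div:
  assumes "0 < r" "r < d"
  shows "\<exists>W\<in>local_int_poly d. of_nat r * E r = Const (of_nat d) * (- q r - Const (of_nat d) * W)"
  using assms
proof (induction r rule: less_induct)
  case (less r)
  have "\<exists>E'\<in>local_int_poly d. E s = Const (of_nat d) * E'" if s: "0 < s" "s < r" for s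
  proof -
    obtain W where W: "W \<in> local_int_poly d"
      "of_nat s * E s = Const (of_nat d) * (- q s - Const (of_nat d) * W)"
      using less.IH[of s] s less.prems by auto
    define E' where "E' = Const (1 / of_nat s) * (- q s - Const (of_nat d) * W)"
    have "- q s - Const (of_nat d) * W \<in> local_int_poly d"
      using W(1) local_int_of_int[OF prime_d, of "int d"] unfolding diff_conv_add_uminus
      by (intro local_int_poly_add[OF prime_d] local_int_poly_uminus[OF prime_d] q_local
          local_int_poly_Const[OF prime_d]) auto
    hence "E' \<in> local_int_poly d"
      unfolding E'_def using s less.prems
      by (intro local_int_poly_Const[OF prime_d] local_int_divide[OF prime_d]) auto
    moreover have "E s = Const (of_nat d) * E'"
    proof -
      have "E s = Const (1 / of_nat s) * (of_nat s * E s)"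
        using s by (simp add: Const_of_nat[symmetric] Const_mult[symmetric] mult.assoc[symmetric])
      thus ?thesis unfolding W(2) E'_def by (simp add: mult_ac)
    qed
    ultimately show ?thesis by blast
  qed
  then obtain E' where E': "\<And>s. 0 < s \<Longrightarrow> s < r \<Longrightarrow> E' s \<in> local_int_poly d"
      "\<And>s. 0 < s \<Longrightarrow> s < r \<Longrightarrow> E s = Const (of_nat d) * E' s"
    by metis
  define W where "W = (\<Sum>l\<in>{1..<r}. q l * E' (r - l))"
  have "W \<in> local_int_poly d"
    unfolding W_def using E'(1)
    by (intro local_int_poly_sum[OF prime_d] local_int_poly_mult[OF prime_d] q_local) auto
  moreover have "of_nat r * E r = Const (of_nat d) * (- q r - Const (of_nat d) * W)"
  proof -
    have "{1..r} = insert r {1..<r}" using less.prems by auto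
    hence "of_nat r * E r = - (Const (of_nat d) * q r) - (\<Sum>l\<in>{1..<r}. Const (of_nat d) * q l * E (r - l))"
      using E_newton[of r] less.prems by (simp add: E_0)
    also have "(\<Sum>l\<in>{1..<r}. Const (of_nat d) * q l * E (r - l)) =
        (\<Sum>l\<in>{1..<r}. Const (of_nat d) * (Const (of_nat d) * (q l * E' (r - l))))"
      by (intro sum.cong refl) (auto simp: E'(2) mult_ac)
    also have "\<dots> = Const (of_nat d) * (Const (of_nat d) * W)"
      by (simp only: W_def sum_distrib_left)
    finally show ?thesis by (simp add: algebra_simps)
  qed
  ultimately show ?case by blast
qed

text \<open>If the coefficient vanished, \<open>d\<close> would divide the binomial coefficient of
  \<open>s + t\<close> over \<open>s\<close>, and hence the factorial of a number below the prime
  \<open>d\<close>.\<close>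

lemma E_coeff:
  assumes "0 < s + t" "s + t < d" "d dvd s + a * t"
  shows "lookup (E (s + t)) (expvec 0 s t) \<noteq> 0"
proof
  define r where "r = s + t"
  assume "lookup (E (s + t)) (expvec 0 s t) = 0"
  hence z: "lookup (of_nat r * E r) (expvec 0 s t) = 0"
    by (simp add: r_def Const_of_nat[symmetric])
  obtain W where W: "W \<in> local_int_poly d"
      "of_nat r * E r = Const (of_nat d) * (- q r - Const (of_nat d) * W)"
    using E_div[of r] assms by (auto simp: r_def)
  have "lookup (q r) (expvec 0 s t) = (\<Sum>s'\<le>r. if s' = s then (-1) ^ r * of_nat (r choose s) else 0)"
    unfolding q_def lookup_sum
    by (intro sum.cong refl) (use assms in \<open>auto simp: lookup_mon r_def\<close>)
  hence q: "lookup (q r) (expvec 0 s t) = (-1) ^ r * of_nat (r choose s)"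
    by (simp add: r_def)
  define w where "w = lookup W (expvec 0 s t)"
  have w: "w \<in> local_int d" using W(1) by (simp add: w_def local_int_poly_def)
  have "of_nat d * (- ((-1) ^ r * of_nat (r choose s)) - of_nat d * w) = 0"
    using z unfolding W(2) by (simp add: lookup_minus q w_def)
  hence "(-1) ^ r * of_nat (r choose s) = - (of_nat d * w)"
    using d_pos by (simp add: minus_equation_iff[of _ "of_nat d * w"])
  hence "(of_nat (r choose s) :: 'k) = of_nat d * (- ((-1) ^ r * w))"
    by (cases "even r") auto
  moreover have "- ((-1) ^ r * w) \<in> local_int d"
    using local_int_uminus[OF prime_d w] w by (cases "even r") auto
  ultimately have "d dvd (r choose s)" by (intro local_int_nat_eq_0[OF prime_d])
  hence "d dvd fact s * fact (r - s) * (r choose s)" by simp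
  hence "d dvd fact r" using binomial_fact_lemma[of s r] by (simp add: r_def)
  thus False using prime_d assms(2) by (simp add: prime_dvd_fact_iff r_def)
qed

lemma forms_u: "u j \<in> forms {VY, VZ} 1"
  unfolding u_def by (intro forms_add forms_Const_times forms_Var) auto

text \<open>As x does not occur in these coefficients, the coefficient of x^i y^s z^t in
  \<open>N\<close> can be read off from the i-th of them. Above \<open>card J\<close> the truncated
  degree is harmless, the coefficient being 0.\<close>

lemma coeff_linear_prod_forms:
  assumes "finite J"
  shows "coeff (linear_prod u J) i \<in> forms {VY, VZ} (card J - i)"
  using assms
proof (induction J arbitrary: i rule: finite_induct)
  case empty
  thus ?case by (cases i) (auto simp: linear_prod_def coeff_1)
next
  case (insert j J)
  have 1: "u j * coeff (linear_prod u J) i \<in> forms {VY, VZ} (card (insert j J) - i)"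
  proof (cases "i \<le> card J")
    case True
    thus ?thesis using forms_mult[OF forms_u insert.IH, of j i] insert.hyps by (simp add: Suc_diff_le)
  next
    case False
    thus ?thesis using coeff_linear_prod_gt[OF insert.hyps(1), of i u] by simp
  qed
  show ?case
  proof (cases i)
    case 0
    thus ?thesis
      using 1 unfolding linear_prod_insert[OF insert.hyps(1,2)] coeff_linear_mult by simp
  next
    case (Suc i')
    have "coeff (linear_prod u J) i' \<in> forms {VY, VZ} (card (insert j J) - i)"
      using insert.IH[of i'] insert.hyps Suc by simp
    thus ?thesis
      using 1 Suc unfolding linear_prod_insert[OF insert.hyps(1,2)] coeff_linear_mult
      by (auto intro: forms_add)
  qed
qed

lemma lookup_times_VX_power:
  fixes F :: "(var, 'k) mpoly"
  assumes "F \<in> forms {VY, VZ} n"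
  shows "lookup (F * Var VX ^ i') (expvec i s t) = (if i = i' then lookup F (expvec 0 s t) else 0)"
proof (cases "i = i'")
  case True
  have "expvec i s t = single VX i' + expvec 0 s t"
    using True by (intro var_poly_mapping_eqI) (auto simp: lookup_add lookup_single)
  thus ?thesis
    using True lookup_single_times[of "single VX i'" 1 F "expvec 0 s t"]
    by (simp add: mon_single[symmetric] mon_def mult.commute)
next
  case False
  have "expvec i s t \<notin> keys (F * mon (single VX i'))"
  proof
    assume "expvec i s t \<in> keys (F * mon (single VX i'))"
    then obtain m where m: "m \<in> keys F" "expvec i s t = m + single VX i'"
      using keys_mult[of F "mon (single VX i')"] by auto
    have "VX \<notin> keys m" using m(1) assms by (auto simp: forms_def)
    hence "lookup m VX = 0" by (simp add: in_keys_iff)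
    thus False using arg_cong[OF m(2), of "\<lambda>p. lookup p VX"] False by (simp add: lookup_add)
  qed
  thus ?thesis using False by (simp add: in_keys_iff mon_single)
qed

lemma N_coeffs: "N = (\<Sum>i\<le>d. coeff (linear_prod u {..<d}) i * Var VX ^ i)"
proof -
  define P where "P = linear_prod u {..<d}"
  have deg: "degree P \<le> d"
    unfolding P_def by (intro degree_le) (auto intro: coeff_linear_prod_gt)
  have "N = poly P (Var VX)"
    by (simp add: N_def P_def linear_prod_def poly_prod add.commute)
  also have "\<dots> = (\<Sum>i\<le>degree P. coeff P i * Var VX ^ i)" by (rule poly_altdef)
  also have "\<dots> = (\<Sum>i\<le>d. coeff P i * Var VX ^ i)"
    using deg by (intro sum.mono_neutral_left) (auto simp: coeff_eq_0)
  finally show ?thesis by (simp add: P_def)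
qed

lemma N_lookup:
  assumes "i \<le> d"
  shows "lookup N (expvec i s t) = lookup (coeff (linear_prod u {..<d}) i) (expvec 0 s t)"
proof -
  have "coeff (linear_prod u {..<d}) i' \<in> forms {VY, VZ} (d - i')" for i'
    using coeff_linear_prod_forms[of "{..<d}" i'] by simp
  note * = lookup_times_VX_power[OF this]
  show ?thesis unfolding N_coeffs lookup_sum * using assms by simp
qed

lemma N_coeff_nonzero:
  assumes "m \<in> M" "lookup m VX \<noteq> 0" "lookup m VX \<noteq> d"
  shows "lookup N m \<noteq> 0"
proof -
  obtain i s t where m: "m = expvec i s t" by (rule expvec_cases)
  have h: "i + s + t = d" "d dvd s + a * t" "i \<noteq> 0" "i \<noteq> d" using assms by (auto simp: m expvec_M_iff)
  hence "lookup N m = lookup (E (s + t)) (expvec 0 s t)"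
    unfolding m by (subst N_lookup) (auto simp: E_def)
  thus ?thesis using E_coeff[of s t] h by auto
qed

lemma N_coeff_VX: "lookup N (expvec d 0 0) = 1"
proof -
  have "coeff (linear_prod u {..<d}) d = 1"
    using coeff_linear_prod_card[of "{..<d}" u] by simp
  thus ?thesis by (subst N_lookup) (auto simp: lookup_one when_def expvec_def)
qed

lemma forms_N: "N \<in> forms UNIV d"
proof -
  have "Var VX + u j \<in> forms UNIV 1" for j
    unfolding u_def by (intro forms_add forms_Const_times forms_Var) auto
  from forms_prod[of "{..<d}" "\<lambda>j. Var VX + u j" UNIV "\<lambda>_. 1", OF this]
  show ?thesis by (simp add: N_def)
qed

abbreviation I where "I \<equiv> ideal_gen (mon ` M :: (var, 'k) mpoly set)"

lemma keys_subset_M_iff: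
  assumes "F \<in> forms UNIV d"
  shows "keys F \<subseteq> M \<longleftrightarrow> diag_act wt F = F"
  using assms
  by (auto simp: diag_act_eq_iff mval_weights e_pow_iff M_iff forms_def subset_iff)

lemma mem_I_iff: "F \<in> forms UNIV d \<Longrightarrow> F \<in> I \<longleftrightarrow> keys F \<subseteq> M"
  by (rule forms_mem_ideal_gen_mon_iff) (auto intro: M_mdeg)

lemma forms_less_notin_I:
  assumes "F \<in> forms UNIV n" "n < d" "F \<noteq> 0"
  shows "F \<notin> I"
proof
  assume F: "F \<in> I"
  obtain m where m: "m \<in> keys F" using assms(3) by (metis all_not_in_conv keys_eq_empty)
  have "mdeg m \<ge> d" by (rule ideal_gen_mon_degree[OF F _ m]) (use M_mdeg in auto)
  thus False using assms m by (auto simp: forms_def)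
qed

section \<open>The Togliatti property\<close>

subsection \<open>Failure of maximal rank\<close>

text \<open>The orbit product of an arbitrary linear form; for x + y + z it is the product that
  \<open>N\<close> writes out.\<close>

definition norm_form :: "(var, 'k) mpoly \<Rightarrow> (var, 'k) mpoly" where
  "norm_form L = (\<Prod>j<d. diag_act (\<lambda>i. wt i ^ j) L)"

lemma wt_nz: "wt i \<noteq> 0"
  using e_nz by (cases i) auto

lemma wt_d: "wt i ^ d = 1"
  using e_d by (cases i) (auto simp: power_mult[symmetric] mult.commute[of a] power_mult)

lemma diag_act_one: "diag_act (\<lambda>i. 1) L = L"
  by (rule poly_mapping_eqI) (simp add: lookup_diag_act mval_def)

text \<open>Applying the generator shifts the factors cyclically, the d-th one being the 0-th
  again.\<close>

lemma norm_form_invariant: "diag_act wt (norm_form L) = norm_form L"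
proof -
  define f where "f = (\<lambda>j. diag_act (\<lambda>i. wt i ^ j) L)"
  obtain n where n: "d = Suc n" using d_pos by (cases d) auto
  have f: "f (Suc n) = f 0" unfolding f_def n[symmetric] by (simp add: wt_d)
  have nf: "norm_form L = (\<Prod>j<d. f j)" by (simp add: norm_form_def f_def)
  have "diag_act wt (norm_form L) = (\<Prod>j<d. f (Suc j))"
    by (simp add: norm_form_def diag_act_prod diag_act_diag_act f_def)
  also have "\<dots> = f 0 * (\<Prod>j<n. f (Suc j))" by (simp add: n f)
  also have "\<dots> = (\<Prod>j<d. f j)" unfolding n by (rule prod.lessThan_Suc_shift[symmetric])
  finally show ?thesis by (simp only: nf)
qed

lemma not_injective:
  assumes L: "L \<in> forms UNIV 1"
  shows "\<exists>F\<in>forms UNIV (d - 1). L * F \<in> I \<and> F \<notin> I"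
proof (cases "L = 0")
  case True
  \<comment> \<open>\<open>forms\<close> contains 0, so L = 0 has to be treated: it kills every
    form, and a nonzero one of degree d - 1 is outside \<open>I\<close>.\<close>
  have "Var VX ^ (d - 1) \<in> forms UNIV (d - 1)"
    using forms_power[OF forms_Var[of VX UNIV], of "d - 1"] by simp
  moreover have "Var VX ^ (d - 1) \<noteq> (0 :: (var, 'k) mpoly)"
    by (metis keys_mon keys_zero insert_not_empty mon_single)
  ultimately show ?thesis
    using True forms_less_notin_I[of "Var VX ^ (d - 1)" "d - 1"] d_pos
    by (intro bexI[of _ "Var VX ^ (d - 1)"]) (auto simp: is_ideal_0)
next
  case False
  \<comment> \<open>The other conjugates of \<open>L\<close>: multiplied by \<open>L\<close> they
    give the norm, and a nonzero form of degree d - 1 is too small to lie in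
    \<open>I\<close>.\<close>
  define F where "F = (\<Prod>j\<in>{1..<d}. diag_act (\<lambda>i. wt i ^ j) L)"
  have forms: "F \<in> forms UNIV (d - 1)"
    unfolding F_def using forms_prod[of "{1..<d}" "\<lambda>j. diag_act (\<lambda>i. wt i ^ j) L" UNIV "\<lambda>_. 1",
        OF forms_diag_act[OF L]] by simp
  have "diag_act (\<lambda>i. wt i ^ j) L \<noteq> 0" for j
  proof
    assume z: "diag_act (\<lambda>i. wt i ^ j) L = 0"
    obtain m where m: "lookup L m \<noteq> 0" using False by (metis lookup_zero poly_mapping_eqI)
    have "mval (\<lambda>i. wt i ^ j) m * lookup L m = 0"
      using arg_cong[OF z, of "\<lambda>p. lookup p m"] by (simp add: lookup_diag_act)
    moreover have "mval (\<lambda>i. wt i ^ j) m \<noteq> 0" using wt_nz by (auto simp: mval_def)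
    ultimately show False using m by simp
  qed
  hence "F \<noteq> 0" by (simp add: F_def mpoly_prod_eq_0_iff)
  hence "F \<notin> I" using forms forms_less_notin_I[of F "d - 1"] d_pos by simp
  moreover have "L * F \<in> I"
  proof -
    have "{..<d} = insert 0 {1..<d}" using d_pos by auto
    hence "L * F = norm_form L" by (simp add: norm_form_def F_def diag_act_one)
    moreover have "norm_form L \<in> forms UNIV d"
      unfolding norm_form_def using forms_prod[of "{..<d}" "\<lambda>j. diag_act (\<lambda>i. wt i ^ j) L" UNIV "\<lambda>_. 1",
          OF forms_diag_act[OF L]] by simp
    ultimately show ?thesis using norm_form_invariant[of L] by (simp add: mem_I_iff keys_subset_M_iff)
  qed
  ultimately show ?thesis using forms by blast
qed

text \<open>x times the monomials of degree d - 1, together with the d + 1 monomials of degree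
  \<open>d\<close> in y and z.\<close>

lemma card_mdeg_ge: "card {m :: var \<Rightarrow>\<^sub>0 nat. mdeg m = d} \<ge> card {m :: var \<Rightarrow>\<^sub>0 nat. mdeg m = d - 1} + (d + 1)"
proof -
  let ?A = "(\<lambda>m. m + single VX 1) ` {m :: var \<Rightarrow>\<^sub>0 nat. mdeg m = d - 1}"
  let ?B = "(\<lambda>j. expvec 0 j (d - j)) ` {..d}"
  have "?A \<inter> ?B = {}"
  proof -
    have "m + single VX 1 \<noteq> expvec 0 j (d - j)" for m j
    proof
      assume "m + single VX 1 = expvec 0 j (d - j)"
      from arg_cong[OF this, of "\<lambda>p. lookup p VX"] show False by (simp add: lookup_add)
    qed
    thus ?thesis by auto
  qed
  moreover have "card ?A = card {m :: var \<Rightarrow>\<^sub>0 nat. mdeg m = d - 1}"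
    by (intro card_image) (auto simp: inj_on_def)
  moreover have "card ?B = d + 1" by (subst card_image) (auto simp: inj_on_def)
  moreover have "finite ?A" "finite ?B" using finite_mdeg_var by auto
  ultimately have "card (?A \<union> ?B) = card {m :: var \<Rightarrow>\<^sub>0 nat. mdeg m = d - 1} + (d + 1)"
    by (simp add: card_Un_disjoint)
  moreover have "?A \<union> ?B \<subseteq> {m. mdeg m = d}" using d_pos by auto
  ultimately show ?thesis using card_mono[OF finite_mdeg_var[of d], of "?A \<union> ?B"] by linarith
qed

text \<open>Surjectivity would make the products of \<open>L\<close> with the monomials of degree d
  - 1, together with \<open>M\<close>, span all forms of degree \<open>d\<close>; at most
  \<open>d\<close> elements of \<open>M\<close> cannot bridge a gap of d + 1.\<close>

lemma not_surjective:
  assumes L: "L \<in> forms UNIV 1" and card: "card M \<le> d"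
  shows "\<not> (\<forall>G\<in>forms UNIV d. \<exists>F\<in>forms UNIV (d - 1). G - L * F \<in> I)"
proof
  assume surj: "\<forall>G\<in>forms UNIV d. \<exists>F\<in>forms UNIV (d - 1). G - L * F \<in> I"
  define t where "t = (\<lambda>m. L * mon m) ` {m. mdeg m = d - 1} \<union> mon ` M"
  have fin: "finite t" by (auto simp: t_def finite_mdeg_var)
  have "mon ` {m. mdeg m = d} \<subseteq> mp.span t"
  proof (intro image_subsetI)
    fix m :: "var \<Rightarrow>\<^sub>0 nat" assume "m \<in> {m. mdeg m = d}"
    hence m: "mon m \<in> forms UNIV d" by (auto intro: forms_mon)
    then obtain F where F: "F \<in> forms UNIV (d - 1)" "mon m - L * F \<in> I"
      using surj by blast
    have "L * F \<in> forms UNIV d" using forms_mult[OF L F(1)] d_pos by simp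
    hence "mon m - L * F \<in> forms UNIV d" using m by (intro forms_diff)
    hence k: "keys (mon m - L * F) \<subseteq> M"
      using mem_I_iff F(2) by blast
    have 1: "mon m - L * F \<in> mp.span t"
      by (subst mpoly_sum_mon, intro mp.span_sum mp.span_scale mp.span_base) (use k in \<open>auto simp: t_def\<close>)
    have "L * F = (\<Sum>n\<in>keys F. Const (lookup F n) * (L * mon n))"
      by (subst mpoly_sum_mon[of F]) (simp add: sum_distrib_left mult_ac)
    also have "\<dots> \<in> mp.span t"
      using F(1) by (intro mp.span_sum mp.span_scale mp.span_base) (auto simp: t_def forms_def)
    finally have "L * F \<in> mp.span t" .
    from mp.span_add[OF 1 this] show "mon m \<in> mp.span t" by simp
  qed
  from mp.independent_span_bound[OF fin mon_independent this]
  have "card {m :: var \<Rightarrow>\<^sub>0 nat. mdeg m = d} \<le> card t" by (simp add: card_image[OF inj_mon])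
  also have "card t \<le> card {m :: var \<Rightarrow>\<^sub>0 nat. mdeg m = d - 1} + card M"
    unfolding t_def by (intro order.trans[OF card_Un_le] add_mono card_image_le) (auto simp: finite_mdeg_var)
  finally show False using card_mdeg_ge card by simp
qed

lemma artinian_M: "artinian_ideal I"
  by (rule artinian_ideal_mon[where d = d]) (auto intro: ideal_gen_superset pure_M)

lemma togliatti_I:
  assumes "card M \<le> d"
  shows "togliatti d I"
proof -
  have "mon ` M \<subseteq> (forms UNIV d :: (var, 'k) mpoly set)" by (auto intro!: forms_mon M_mdeg)
  hence "\<exists>G. finite G \<and> card G \<le> d + 1 \<and> G \<subseteq> forms UNIV d \<and> I = ideal_gen G"
    using assms by (intro exI[of _ "mon ` M"]) (auto simp: card_image[OF inj_mon])
  moreover have "\<not> mult_max_rank I d L" if "L \<in> forms UNIV 1" for L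
    unfolding mult_max_rank_def
    using not_injective[OF that] not_surjective[OF that assms] by blast
  ultimately show ?thesis using artinian_M by (simp add: togliatti_def)
qed

subsection \<open>Minimality\<close>

lemma diag_power_invariant:
  assumes "keys G \<subseteq> M"
  shows "ev (\<lambda>i. wt i ^ j * v i) G = ev v G"
proof -
  have "mval wt m = 1" if "m \<in> keys G" for m
    using that assms by (auto simp: mval_weights e_pow_iff M_iff)
  hence "mval (\<lambda>i. wt i ^ j) m = 1" if "m \<in> keys G" for m
    using that by (induction j) (simp_all add: mval_mult, simp add: mval_def)
  hence "mval (\<lambda>i. wt i ^ j * v i) m = mval v m" if "m \<in> keys G" for m
    using that by (simp add: mval_mult)
  thus ?thesis by (simp add: ev_def poly_hom_alt)
qed

lemma u_inj:
  assumes "i < d" "j < d" "u i = u j"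
  shows "i = j"
proof -
  have "lookup (u i) (single VY 1) = e ^ i" for i
    by (simp add: u_def lookup_add Var_def lookup_single when_def inj_eq)
       (metis One_nat_def lookup_single_eq lookup_single_not_eq var.distinct(5) zero_neq_one)
  with assms(3) have "e ^ i = e ^ j" by metis
  thus ?thesis using e_pow_inj assms by blast
qed

text \<open>An invariant multiple of \<open>x + y + z\<close> vanishes on all lines of the orbit of \<open>x + y + z = 0\<close>,
  so it is a multiple of the norm.\<close>

lemma invariant_multiple:
  assumes G: "G \<in> forms UNIV d" "keys G \<subseteq> M" and L: "G = (Var VX + Var VY + Var VZ) * F"
  shows "G = Const (lookup G (expvec d 0 0)) * N"
proof (rule ccontr)
  define H where "H = G - Const (lookup G (expvec d 0 0)) * N"
  assume "G \<noteq> Const (lookup G (expvec d 0 0)) * N"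
  hence "H \<noteq> 0" by (simp add: H_def)
  \<comment> \<open>Besides keeping the point off H = 0, the differences make the values
    \<open>ev v (u j)\<close> pairwise distinct, which yields \<open>d\<close> different roots
    below.\<close>
  define \<D> where "\<D> = insert H ((\<lambda>(i, j). u i - u j) ` ({..<d} \<times> {..<d} - Id))"
  have "finite \<D>" by (auto simp: \<D>_def)
  moreover have "0 \<notin> \<D>" using \<open>H \<noteq> 0\<close> u_inj by (auto simp: \<D>_def)
  ultimately obtain v where v: "\<And>i. v i \<noteq> 0" "\<And>F. F \<in> \<D> \<Longrightarrow> ev v F \<noteq> 0"
    using generic_point by blast
  have u_v: "inj_on (\<lambda>j. ev v (u j)) {..<d}"
  proof (rule inj_onI, rule ccontr)
    fix i j assume "i \<in> {..<d}" "j \<in> {..<d}" "ev v (u i) = ev v (u j)" "i \<noteq> j"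
    thus False using v(2)[of "u i - u j"] by (force simp: \<D>_def)
  qed
  \<comment> \<open>The line through \<open>v\<close> on which only the x-coordinate varies;
    restricted to it, \<open>H\<close> becomes the univariate polynomial \<open>p\<close>.\<close>
  define w where "w = (\<lambda>T. case_var T (v VY) (v VZ))"
  have ev_u: "ev (w T) (u j) = ev v (u j)" for T j
    by (simp add: u_def w_def)
  have H_forms: "H \<in> forms UNIV d"
    unfolding H_def by (intro forms_diff forms_Const_times G forms_N)
  have H_top: "lookup H (expvec d 0 0) = 0"
    by (simp add: H_def lookup_minus N_coeff_VX)
  define p where "p = (\<Sum>m\<in>keys H. monom (lookup H m * v VY ^ lookup m VY * v VZ ^ lookup m VZ) (lookup m VX))"
  have poly_p: "poly p T = ev (w T) H" for T
    by (simp add: p_def poly_sum poly_monom ev_def poly_hom_alt mval_var w_def mult_ac)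
  \<comment> \<open>Subtracting the multiple of \<open>N\<close> has cancelled x^d.\<close>
  have "degree p \<le> d - 1"
    unfolding p_def
  proof (rule degree_sum_le)
    fix m assume m: "m \<in> keys H"
    hence "mdeg m = d" using H_forms by (auto simp: forms_def)
    moreover have "m \<noteq> expvec d 0 0" using m H_top by (auto simp: in_keys_iff)
    ultimately have "lookup m VX \<le> d - 1"
      using expvec_lookup[of m] by (cases "lookup m VX = d") (auto simp: mdeg_var)
    thus "degree (monom (lookup H m * v VY ^ lookup m VY * v VZ ^ lookup m VZ) (lookup m VX)) \<le> d - 1"
      using degree_monom_le order.trans by blast
  qed simp
  moreover have "poly p (- ev v (u j)) = 0" if j: "j < d" for j
  proof -
    let ?w = "w (- ev v (u j))"
    have "ev ?w N = 0"
      using j unfolding N_def ev_prod by (intro prod_zero) (auto simp: ev_u, auto simp: w_def)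
    moreover have "ev ?w G = 0"
    proof -
      \<comment> \<open>Invariance allows rotating the point by the j-th power of the matrix, which
        moves it onto x + y + z = 0.\<close>
      have "ev ?w G = ev (\<lambda>i. wt i ^ j * ?w i) G"
        using diag_power_invariant[OF G(2)] by simp
      also have "\<dots> = 0"
        unfolding L by (simp add: w_def u_def power_mult)
      finally show ?thesis .
    qed
    ultimately show ?thesis by (simp add: poly_p H_def)
  qed
  hence "(\<lambda>j. - ev v (u j)) ` {..<d} \<subseteq> {T. poly p T = 0}" by auto
  moreover have "card ((\<lambda>j. - ev v (u j)) ` {..<d}) = d"
    using u_v by (subst card_image) (auto simp: inj_on_def)
  moreover have "p \<noteq> 0"
  proof
    assume "p = 0"
    hence "ev (w (v VX)) H = 0" by (simp flip: poly_p)
    moreover have "w (v VX) = v" by (rule ext) (auto simp: w_def split: var.splits)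
    ultimately show False using v(2)[of H] by (simp add: \<D>_def)
  qed
  ultimately have "d \<le> d - 1"
    using card_mono[OF poly_roots_finite[of p]] card_poly_roots_bound[of p] by (metis order.trans)
  thus False using d_pos by simp
qed

lemma monomial_togliatti_I: "card M \<le> d \<Longrightarrow> monomial_togliatti d I"
  using togliatti_I by (auto simp: monomial_togliatti_def monomial_ideal_def)

text \<open>Being artinian forces the pure powers into \<open>M'\<close>, so a missing monomial is
  mixed and occurs in \<open>N\<close>. A multiple of x + y + z of degree \<open>d\<close> supported
  on \<open>M'\<close> is a scalar multiple of \<open>N\<close>, hence 0: multiplication by this
  form is injective in degree d - 1.\<close>

lemma not_togliatti_psubset:
  assumes M': "M' \<subset> M" and card: "card M \<le> d"
  shows "\<not> togliatti d (ideal_gen (mon ` M') :: (var, 'k) mpoly set)"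
proof
  let ?I' = "ideal_gen (mon ` M') :: (var, 'k) mpoly set"
  assume T: "togliatti d ?I'"
  hence "artinian_ideal ?I'" by (simp add: togliatti_def)
  hence pure: "single i d \<in> M'" for i
    by (rule artinian_ideal_pure_power) (use M' M_mdeg in auto)
  obtain m where m: "m \<in> M" "m \<notin> M'" using M' by blast
  have nz: "lookup N m \<noteq> 0"
  proof (rule N_coeff_nonzero[OF m(1)])
    show "lookup m VX \<noteq> 0" using M_boundary[OF m(1), of VX] m(2) pure by auto
    show "lookup m VX \<noteq> d"
    proof
      assume "lookup m VX = d"
      hence "lookup m VY = 0" using M_mdeg[OF m(1)] by (simp add: mdeg_var)
      thus False using M_boundary[OF m(1), of VY] m(2) pure by auto
    qed
  qed
  define L :: "(var, 'k) mpoly" where "L = Var VX + Var VY + Var VZ"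
  have L: "L \<in> forms UNIV 1" unfolding L_def by (intro forms_add forms_Var) auto
  have "F \<in> ?I'" if F: "F \<in> forms UNIV (d - 1)" and LF: "L * F \<in> ?I'" for F
  proof -
    have fm: "L * F \<in> forms UNIV d" using forms_mult[OF L F] d_pos by simp
    hence k: "keys (L * F) \<subseteq> M'"
      using forms_mem_ideal_gen_mon_iff[of M' d "L * F" UNIV] LF M' M_mdeg by blast
    define c where "c = lookup (L * F) (expvec d 0 0)"
    have "L * F = Const c * N"
      unfolding c_def by (rule invariant_multiple[OF fm]) (use k M' in \<open>auto simp: L_def\<close>)
    moreover from this have "c * lookup N m = 0" using k m(2) by (metis in_keys_iff lookup_Const_times subsetD)
    ultimately have "L * F = 0" using nz by simp
    moreover have "L \<noteq> 0"
    proof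
      assume "L = 0"
      hence "ev (\<lambda>_. 1) L = 0" by simp
      thus False by (simp add: L_def)
    qed
    ultimately have "F = 0" by (simp add: mpoly_mult_eq_0_iff)
    thus ?thesis by (simp add: is_ideal_0)
  qed
  hence "mult_max_rank ?I' d L" by (auto simp: mult_max_rank_def)
  thus False using T L by (auto simp: togliatti_def)
qed

lemma minimal_I:
  assumes "card M \<le> d"
  shows "minimal_monomial_togliatti d I"
proof -
  have "ideal_gen (mon ` M') \<noteq> I" if "M' \<subset> M" for M'
    by (rule ideal_gen_psubset_mon[OF finite_M M_mdeg]) (use that in \<open>auto simp: psubset_eq inj_image_eq_iff[OF inj_mon]\<close>)
  moreover have "\<not> monomial_togliatti d (ideal_gen (mon ` M') :: (var, 'k) mpoly set)" if "M' \<subset> M" for M'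
    using not_togliatti_psubset[OF that assms] by (simp add: monomial_togliatti_def)
  ultimately show ?thesis
    unfolding minimal_monomial_togliatti_def using monomial_togliatti_I[OF assms] by blast
qed

subsection \<open>The generators\<close>

lemma a_coprime: "coprime a d"
proof -
  have "\<not> d dvd a" using a2 a_le d_pos by (auto dest: dvd_imp_le)
  thus ?thesis using prime_imp_coprime[OF prime_d] by (simp add: coprime_commute)
qed

text \<open>Modulo \<open>d\<close> the defining equation says that \<open>n1 d a\<close> is -1/a;
  so \<open>nrem d a j\<close> is the z-exponent that completes y^j to an invariant
  monomial.\<close>

lemma n1_props: "0 < n1 d a" "n1 d a < d" "d dvd a * n1 d a + 1"
proof -
  let ?P = "\<lambda>n. 0 < n \<and> n < d \<and> (\<exists>k'>0. int d * k' - int a * int n = 1)"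
  have iff: "(\<exists>k'>0. int d * k' - int a * int n = 1) \<longleftrightarrow> d dvd a * n + 1" for n
  proof
    assume "\<exists>k'>0. int d * k' - int a * int n = 1"
    then obtain k' where "int d * k' - int a * int n = 1" by blast
    hence "int (a * n + 1) = int d * k'" by simp
    hence "int d dvd int (a * n + 1)" by simp
    thus "d dvd a * n + 1" by (simp only: int_dvd_int_iff)
  next
    assume "d dvd a * n + 1"
    then obtain q where q: "a * n + 1 = d * q" by (rule dvdE)
    hence "int d * int q - int a * int n = 1" by (simp flip: of_nat_mult)
    moreover have "int q > 0" using q by (cases q) auto
    ultimately show "\<exists>k'>0. int d * k' - int a * int n = 1" by blast
  qed
  obtain x where x: "[a * x = 1] (mod d)" using cong_solve_coprime_nat[OF a_coprime] by auto
  \<comment> \<open>With x = 1/a this is the representative of -1/a.\<close>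
  define n where "n = d - x mod d"
  have "x mod d \<noteq> 0"
  proof
    assume "x mod d = 0"
    hence "d dvd a * x" by auto
    hence "[0 = 1] (mod d)" using x by (metis cong_0_iff cong_sym cong_trans)
    thus False using d5 by (simp add: cong_def)
  qed
  hence n: "0 < n" "n < d" using d_pos by (auto simp: n_def)
  have "d dvd a * n + 1"
  proof -
    have "[a * (x mod d) = 1] (mod d)" using x by (simp add: cong_def mod_mult_right_eq)
    hence "[a * n + a * (x mod d) = a * n + 1] (mod d)" by (intro cong_add) auto
    moreover have "a * n + a * (x mod d) = a * d"
      using d_pos by (simp add: n_def flip: distrib_left)
    ultimately show ?thesis by (metis cong_dvd_iff dvd_triv_right)
  qed
  hence ex: "?P n" using n iff by blast
  moreover have "m = n" if m: "?P m" for m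
  proof -
    have dm: "d dvd a * m + 1" "m < d" and dn: "d dvd a * n + 1" using m ex iff by blast+
    have "[a * m + 1 = a * n + 1] (mod d)"
      using dm(1) dn by (meson cong_0_iff cong_sym cong_trans)
    hence "[a * m = a * n] (mod d)" by (simp only: cong_add_rcancel_nat)
    hence "[m = n] (mod d)" using a_coprime by (simp add: cong_mult_lcancel_nat coprime_commute)
    thus ?thesis using dm(2) n(2) by (simp add: cong_def)
  qed
  ultimately have "n1 d a = n" unfolding n1_def by (intro the_equality)
  thus "0 < n1 d a" "n1 d a < d" "d dvd a * n1 d a + 1" using ex iff by auto
qed

lemma nrem_dvd: "d dvd j + a * nrem d a j"
proof -
  have "[j + a * nrem d a j = j + a * (n1 d a * j)] (mod d)"
    unfolding nrem_def by (intro cong_add cong_mult) (auto simp: cong_def)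
  moreover have "j + a * (n1 d a * j) = j * (a * n1 d a + 1)" by (simp add: algebra_simps)
  moreover have "d dvd j * (a * n1 d a + 1)" using n1_props(3) by (rule dvd_mult)
  ultimately show ?thesis by (metis cong_dvd_iff)
qed

lemma nrem_unique:
  assumes "d dvd j + a * t" "t < d"
  shows "t = nrem d a j"
proof -
  have "[j + a * t = j + a * nrem d a j] (mod d)"
    using assms(1) nrem_dvd[of j] by (meson cong_0_iff cong_sym cong_trans)
  hence "[a * t = a * nrem d a j] (mod d)" by (simp add: cong_add_lcancel_nat)
  hence "[t = nrem d a j] (mod d)" using a_coprime by (simp add: cong_mult_lcancel_nat coprime_commute)
  thus ?thesis using assms(2) d_pos by (simp add: cong_def nrem_def)
qed

lemma nrem_less: "nrem d a j < d"
  using d_pos by (simp add: nrem_def)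

text \<open>The y-exponents for which the x-exponent \<open>d - j - nrem d a j\<close> is a genuine
  difference.\<close>

definition J :: "nat set" where
  "J = {j \<in> {1..d - 1}. j + nrem d a j \<le> d}"

lemma finite_J [simp]: "finite J" by (simp add: J_def)

lemma nrem_pos:
  assumes "j \<in> {1..d - 1}"
  shows "nrem d a j > 0"
proof (rule ccontr)
  assume "\<not> nrem d a j > 0"
  hence "d dvd j" using nrem_dvd[of j] by simp
  thus False using assms by (auto dest: dvd_imp_le)
qed

text \<open>In the case of equality x would be absent, and \<open>M_boundary\<close> would leave
  only a pure power.\<close>

lemma nrem_sum_ne:
  assumes "j \<in> {1..d - 1}"
  shows "j + nrem d a j \<noteq> d"
proof
  assume "j + nrem d a j = d"
  hence "expvec 0 j (nrem d a j) \<in> M" using nrem_dvd[of j] by (simp add: expvec_M_iff)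
  from M_boundary[OF this, of VX] obtain i where i: "expvec 0 j (nrem d a j) = single i d" by auto
  have "lookup (expvec 0 j (nrem d a j)) VY \<noteq> 0" "lookup (expvec 0 j (nrem d a j)) VZ \<noteq> 0"
    using assms nrem_pos[OF assms] by auto
  thus False unfolding i by (cases i) (auto simp: lookup_single)
qed

text \<open>The sum \<open>j + nrem d a j\<close> and its counterpart at d - j add up to 2d, and
  neither equals \<open>d\<close>; so exactly one of j and d - j is in \<open>J\<close>.\<close>

lemma card_J: "card J = k"
proof -
  let ?J' = "(\<lambda>j. d - j) ` J"
  have refl: "nrem d a (d - j) = d - nrem d a j" if j: "j \<in> {1..d - 1}" for j
  proof (rule nrem_unique[symmetric])
    have "a * (d - nrem d a j) + a * nrem d a j = a * d"
      using nrem_less[of j] by (simp flip: distrib_left)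
    moreover have "(d - j + a * (d - nrem d a j)) + (j + a * nrem d a j) =
        (d - j + j) + (a * (d - nrem d a j) + a * nrem d a j)" by (simp only: add_ac)
    moreover have "d - j + j = d" by (rule le_add_diff_inverse2) (use j in auto)
    ultimately have "(d - j + a * (d - nrem d a j)) + (j + a * nrem d a j) = d + a * d" by simp
    also have "d + a * d = d * (1 + a)" by simp
    finally have "(d - j + a * (d - nrem d a j)) + (j + a * nrem d a j) = d * (1 + a)" .
    thus "d dvd d - j + a * (d - nrem d a j)"
      using nrem_dvd[of j] by (metis dvd_add_left_iff dvd_triv_left)
    show "d - nrem d a j < d" using nrem_pos[OF j] d_pos by simp
  qed
  have "J \<union> ?J' = {1..d - 1}"
  proof (intro equalityI subsetI)
    fix j assume j: "j \<in> {1..d - 1}"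
    show "j \<in> J \<union> ?J'"
    proof (cases "j + nrem d a j \<le> d")
      case False
      have "d - j \<in> J" using refl[OF j] False j nrem_less[of j] by (auto simp: J_def)
      moreover have "j = d - (d - j)" using j by auto
      ultimately show ?thesis by blast
    qed (use j in \<open>auto simp: J_def\<close>)
  qed (auto simp: J_def)
  moreover have "J \<inter> ?J' = {}"
  proof (rule equals0I)
    fix j assume "j \<in> J \<inter> ?J'"
    then obtain j' where j: "j \<in> J" "j' \<in> J" "j = d - j'" by auto
    hence "j' \<in> {1..d - 1}" "j' + nrem d a j' \<le> d" "(d - j') + (d - nrem d a j') \<le> d"
      using refl[of j'] by (auto simp: J_def)
    thus False using nrem_sum_ne[of j'] nrem_less[of j'] by auto
  qed
  moreover have "card ?J' = card J" by (intro card_image) (auto simp: inj_on_def J_def)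
  ultimately have "card J + card J = card {1..d - 1}"
    by (metis card_Un_disjoint finite_J finite_imageI)
  thus ?thesis using d_eq by simp
qed

definition gen :: "nat \<Rightarrow> var \<Rightarrow>\<^sub>0 nat" where
  "gen j = expvec (d - j - nrem d a j) j (nrem d a j)"

definition pure :: "(var \<Rightarrow>\<^sub>0 nat) set" where
  "pure = {expvec d 0 0, expvec 0 d 0, expvec 0 0 d}"

lemma single_expvec: "single VX n = expvec n 0 0" "single VY n = expvec 0 n 0" "single VZ n = expvec 0 0 n"
  by (simp_all add: expvec_def)

lemma M_eq: "M = pure \<union> gen ` J"
proof (intro equalityI subsetI)
  fix m assume m: "m \<in> M"
  obtain i s t where ist: "m = expvec i s t" by (rule expvec_cases)
  have h: "i + s + t = d" "d dvd s + a * t" using m by (auto simp: ist expvec_M_iff)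
  show "m \<in> pure \<union> gen ` J"
  proof (cases "i = 0 \<or> s = 0 \<or> t = 0")
    case True
    then obtain v where "lookup m v = 0" using ist by (metis lookup_expvec)
    from M_boundary[OF m this] obtain j where "m = single j d" by auto
    thus ?thesis by (cases j) (auto simp: pure_def single_expvec)
  next
    case False
    hence t: "t = nrem d a s" using h by (intro nrem_unique) auto
    hence "s \<in> J" using h False by (auto simp: J_def)
    moreover have "m = gen s" using h t ist by (auto simp: gen_def)
    ultimately show ?thesis by blast
  qed
next
  fix m assume "m \<in> pure \<union> gen ` J"
  thus "m \<in> M"
    using nrem_dvd by (auto simp: pure_def gen_def J_def expvec_M_iff)
qed

lemma card_M: "card M = k + 3"
proof -
  have "pure \<inter> gen ` J = {}"
    using nrem_pos by (auto simp: pure_def gen_def J_def)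
  moreover have "card pure = 3" using d_pos by (simp add: pure_def)
  moreover have "card (gen ` J) = card J" by (intro card_image) (auto simp: inj_on_def gen_def)
  ultimately show ?thesis
    unfolding M_eq by (subst card_Un_disjoint) (auto simp: pure_def card_J)
qed

text \<open>As d is at least 5, k + 3 is at most 2k + 1. The definition of \<open>togliatti\<close>
  admits d + 1 generators, but the dimension count against surjectivity wants at most
  \<open>d\<close>.\<close>

lemma card_M_le: "card M \<le> d"
  using card_M d_eq d5 by simp

lemma generators:
  "\<exists>i :: nat \<Rightarrow> nat. strict_mono_on {1..k} i \<and>
     (\<forall>j\<in>{1..k}. 1 \<le> i j \<and> i j \<le> d - 1 \<and> i j + nrem d a (i j) \<le> d) \<and>
     I = ideal_gen ({mon (expvec d 0 0), mon (expvec 0 d 0), mon (expvec 0 0 d)} \<union>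
             (\<lambda>j. mon (expvec (d - i j - nrem d a (i j)) (i j) (nrem d a (i j)))) ` {1..k})"
proof -
  define xs where "xs = sorted_list_of_set J"
  define i where "i = (\<lambda>j. xs ! (j - 1))"
  have xs: "set xs = J" "length xs = k" "sorted_wrt (<) xs"
    by (simp_all add: xs_def card_J)
  have img: "i ` {1..k} = J"
  proof -
    have "{1..k} = Suc ` {..<k}" by (metis image_Suc_lessThan)
    hence "i ` {1..k} = (\<lambda>j. xs ! j) ` {..<k}" by (simp add: i_def image_image)
    thus ?thesis using xs by (auto simp: set_conv_nth)
  qed
  have "strict_mono_on {1..k} i"
    using xs(2,3) by (intro strict_mono_onI) (auto simp: i_def sorted_wrt_iff_nth_less)
  moreover have "\<forall>j\<in>{1..k}. 1 \<le> i j \<and> i j \<le> d - 1 \<and> i j + nrem d a (i j) \<le> d"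
    using img by (auto simp: J_def)
  moreover have "(mon ` M :: (var, 'k) mpoly set) =
      {mon (expvec d 0 0), mon (expvec 0 d 0), mon (expvec 0 0 d)} \<union>
             (\<lambda>j. mon (expvec (d - i j - nrem d a (i j)) (i j) (nrem d a (i j)))) ` {1..k}"
    unfolding M_eq img[symmetric] image_Un image_image by (simp add: pure_def gen_def)
  ultimately show ?thesis by (intro exI[of _ i]) simp
qed

end

subsection \<open>Permutations of the variables\<close>

text \<open>The pairwise condition of \<open>coincide_up_to_perm\<close>; as it is an equivalence
  relation, comparing a family with one fixed ideal suffices.\<close>

definition perm_equiv :: "('i, 'k::comm_ring_1) mpoly set \<Rightarrow> ('i, 'k) mpoly set \<Rightarrow> bool" where
  "perm_equiv I J \<longleftrightarrow> (\<exists>\<pi>. bij \<pi> \<and> subst (\<lambda>i. Var (\<pi> i)) ` I = J)"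

lemma subst_perm_compose:
  "subst (\<lambda>i. Var (\<pi>' i)) (subst (\<lambda>i. Var (\<pi> i)) F) = subst (\<lambda>i. Var ((\<pi>' \<circ> \<pi>) i)) F"
  by (simp add: subst_subst)

lemma perm_equiv_refl: "perm_equiv I I"
  unfolding perm_equiv_def by (intro exI[of _ "\<lambda>i. i"]) (auto simp: bij_def inj_on_def)

lemma perm_equiv_trans:
  assumes "perm_equiv I J" "perm_equiv J K"
  shows "perm_equiv I K"
proof -
  obtain \<pi> \<pi>' where p: "bij \<pi>" "subst (\<lambda>i. Var (\<pi> i)) ` I = J" "bij \<pi>'" "subst (\<lambda>i. Var (\<pi>' i)) ` J = K"
    using assms by (auto simp: perm_equiv_def)
  have "subst (\<lambda>i. Var ((\<pi>' \<circ> \<pi>) i)) ` I = K"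
    unfolding p(4)[symmetric] p(2)[symmetric] image_image subst_perm_compose ..
  thus ?thesis unfolding perm_equiv_def using bij_comp[OF p(1,3)] by blast
qed

lemma perm_equiv_sym:
  assumes "perm_equiv I J"
  shows "perm_equiv J I"
proof -
  obtain \<pi> where p: "bij \<pi>" "subst (\<lambda>i. Var (\<pi> i)) ` I = J"
    using assms by (auto simp: perm_equiv_def)
  have "inv_into UNIV \<pi> \<circ> \<pi> = id" using p(1) by (auto simp: bij_def)
  hence "subst (\<lambda>i. Var (inv_into UNIV \<pi> i)) ` J = I"
    unfolding p(2)[symmetric] image_image subst_perm_compose by simp
  thus ?thesis unfolding perm_equiv_def using bij_imp_bij_inv[OF p(1)] by blast
qed

lemma coincide_up_to_permI:
  assumes "\<And>J. J \<in> \<I> \<Longrightarrow> perm_equiv I J"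
  shows "coincide_up_to_perm \<I>"
proof -
  have "perm_equiv J K" if "J \<in> \<I>" "K \<in> \<I>" for J K
    using assms that perm_equiv_sym perm_equiv_trans by metis
  thus ?thesis by (auto simp: coincide_up_to_perm_def perm_equiv_def)
qed

text \<open>Surjectivity is what makes the image of an ideal closed under multiplication by
  arbitrary polynomials.\<close>

lemma subst_image_ideal_gen:
  assumes "surj (subst s)"
  shows "subst s ` ideal_gen G = ideal_gen (subst s ` G)"
proof
  have "is_ideal {F. subst s F \<in> ideal_gen (subst s ` G)}"
    by (rule is_idealI) (auto intro: is_ideal_0 is_ideal_add is_ideal_mult)
  hence "ideal_gen G \<subseteq> {F. subst s F \<in> ideal_gen (subst s ` G)}"
    by (intro ideal_gen_minimal) (auto intro: ideal_gen_superset)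
  thus "subst s ` ideal_gen G \<subseteq> ideal_gen (subst s ` G)" by auto
next
  have "is_ideal (subst s ` ideal_gen G)"
  proof (rule is_idealI)
    show "0 \<in> subst s ` ideal_gen G" by (rule image_eqI[of _ _ 0]) (auto intro: is_ideal_0)
  next
    fix F G' assume "F \<in> subst s ` ideal_gen G" "G' \<in> subst s ` ideal_gen G"
    then obtain F0 G0 where "F = subst s F0" "G' = subst s G0" "F0 \<in> ideal_gen G" "G0 \<in> ideal_gen G" by auto
    thus "F + G' \<in> subst s ` ideal_gen G"
      by (intro image_eqI[of _ _ "F0 + G0"]) (auto intro: is_ideal_add)
  next
    fix H F assume "F \<in> subst s ` ideal_gen G"
    then obtain F0 where F: "F = subst s F0" "F0 \<in> ideal_gen G" by auto
    obtain H0 where "H = subst s H0" using assms by (metis surjD)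
    thus "H * F \<in> subst s ` ideal_gen G"
      using F by (intro image_eqI[of _ _ "H0 * F0"]) (auto intro: is_ideal_mult)
  qed
  thus "ideal_gen (subst s ` G) \<subseteq> subst s ` ideal_gen G"
    by (intro ideal_gen_minimal) (auto intro: ideal_gen_superset)
qed

text \<open>Tailored to transpositions of two variables: an involution is its own inverse, on
  variables as well as on exponent vectors.\<close>

lemma perm_equiv_involution:
  fixes A B :: "(var \<Rightarrow>\<^sub>0 nat) set"
  assumes inv: "\<And>i. \<pi> (\<pi> i) = i"
    and AB: "\<And>m. m \<in> A \<Longrightarrow> f m \<in> B" "\<And>m. m \<in> B \<Longrightarrow> f m \<in> A" "\<And>m. f (f m) = m"
    and f: "\<And>m. subst (\<lambda>i. Var (\<pi> i)) (mon m) = (mon (f m) :: (var, 'k::comm_ring_1) mpoly)"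
  shows "perm_equiv (ideal_gen (mon ` A) :: (var, 'k) mpoly set) (ideal_gen (mon ` B))"
proof -
  have "surj (subst (\<lambda>i. Var (\<pi> i)) :: (var, 'k) mpoly \<Rightarrow> _)"
    by (rule surjI[of _ "subst (\<lambda>i. Var (\<pi> i))"]) (simp add: subst_perm_compose inv)
  hence "subst (\<lambda>i. Var (\<pi> i)) ` (ideal_gen (mon ` A) :: (var, 'k) mpoly set) = ideal_gen (mon ` f ` A)"
    by (subst subst_image_ideal_gen) (auto simp: image_image f)
  moreover have "f ` A = B" using AB by (auto intro: image_eqI[of _ f "f _"])
  moreover have "bij \<pi>" using inv by (rule involuntory_imp_bij)
  ultimately show ?thesis unfolding perm_equiv_def by blast
qed

text \<open>After the swap the weights are 1, 0, a. On monomials of degree \<open>d\<close> a common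
  shift of the weights does not matter modulo \<open>d\<close>; shifting by -1 and changing signs
  gives 0, 1, 1 - a.\<close>

lemma perm_equiv_swap_xy:
  assumes "a \<le> d" "0 < a"
  shows "perm_equiv (ideal_gen (mon ` inv_exps d a) :: (var, 'k::comm_ring_1) mpoly set)
    (ideal_gen (mon ` inv_exps d (d - a + 1)))"
proof (rule perm_equiv_involution)
  define f where "f = (\<lambda>m :: var \<Rightarrow>\<^sub>0 nat. expvec (lookup m VY) (lookup m VX) (lookup m VZ))"
  show "case_var VY VX VZ (case_var VY VX VZ i) = i" for i
    by (cases i) auto
  show "f (f m) = m" for m by (simp add: f_def expvec_lookup)
  show "subst (\<lambda>i. Var (case_var VY VX VZ i)) (mon m) = (mon (f m) :: (var, 'k) mpoly)" for m
    by (simp add: subst_mon mval_var f_def expvec_mon)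
  have *: "f m \<in> inv_exps d (d - a + 1)" if "m \<in> inv_exps d a" "a \<le> d" for m a
  proof -
    obtain i s t where m: "m = expvec i s t" by (rule expvec_cases)
    have h: "i + s + t = d" "d dvd s + a * t" using that by (auto simp: m inv_exps_def)
    have "(d - a) * t + a * t = d * t" using that(2) by (simp flip: distrib_right)
    \<comment> \<open>Shift and sign change in one equation of natural numbers: the old and the new
      weight add up to a multiple of \<open>d\<close>.\<close>
    hence "(i + (d - a + 1) * t) + (s + a * t) = d + d * t"
      using h(1) by (simp add: algebra_simps)
    hence "d dvd (i + (d - a + 1) * t) + (s + a * t)" by simp
    hence "d dvd i + (d - a + 1) * t" using h(2) by (metis dvd_add_left_iff)
    thus ?thesis using h(1) by (simp add: m f_def inv_exps_def)
  qed
  show "f m \<in> inv_exps d (d - a + 1)" if "m \<in> inv_exps d a" for m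
    using *[OF that assms(1)] .
  show "f m \<in> inv_exps d a" if "m \<in> inv_exps d (d - a + 1)" for m
    using *[OF that] assms by simp
qed

text \<open>After the swap the weights are 0, a, 1; multiplying by the inverse \<open>b\<close>
  normalizes them to 0, 1, b.\<close>

lemma perm_equiv_swap_yz:
  assumes "[a * b = 1] (mod d)"
  shows "perm_equiv (ideal_gen (mon ` inv_exps d a) :: (var, 'k::comm_ring_1) mpoly set)
    (ideal_gen (mon ` inv_exps d b))"
proof (rule perm_equiv_involution)
  define f where "f = (\<lambda>m :: var \<Rightarrow>\<^sub>0 nat. expvec (lookup m VX) (lookup m VZ) (lookup m VY))"
  show "case_var VX VZ VY (case_var VX VZ VY i) = i" for i
    by (cases i) auto
  show "f (f m) = m" for m by (simp add: f_def expvec_lookup)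
  show "subst (\<lambda>i. Var (case_var VX VZ VY i)) (mon m) = (mon (f m) :: (var, 'k) mpoly)" for m
    by (simp add: subst_mon mval_var f_def expvec_mon mult_ac)
  have *: "f m \<in> inv_exps d b" if "m \<in> inv_exps d a" "[a * b = 1] (mod d)" for m a b
  proof -
    obtain i s t where m: "m = expvec i s t" by (rule expvec_cases)
    have h: "i + s + t = d" "d dvd s + a * t" using that by (auto simp: m inv_exps_def)
    have "[(a * b) * t + b * s = 1 * t + b * s] (mod d)"
      using that(2) by (intro cong_add cong_mult) auto
    moreover have "(a * b) * t + b * s = b * (s + a * t)" by (simp add: algebra_simps)
    moreover have "d dvd b * (s + a * t)" using h(2) by (rule dvd_mult)
    ultimately have "d dvd t + b * s" by (metis cong_dvd_iff mult_1)
    thus ?thesis using h(1) by (simp add: m f_def inv_exps_def)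
  qed
  show "f m \<in> inv_exps d b" if "m \<in> inv_exps d a" for m
    using *[OF that assms] .
  show "f m \<in> inv_exps d a" if "m \<in> inv_exps d b" for m
    using *[OF that, of a] assms by (simp add: mult.commute)
qed

lemma inv_mod_props:
  assumes "coprime a d" "d > 1"
  shows "[a * inv_mod d a = 1] (mod d)" "inv_mod d a < d"
proof -
  let ?x = "modular_inverse (int d) (int a)"
  have x: "?x \<ge> 0" "?x < int d"
    using assms(2) by (auto intro: modular_inverse_int_nonneg modular_inverse_int_less)
  have "[int a * ?x = 1] (mod int d)"
    by (rule cong_modular_inverse1) (use assms in simp)
  hence "[int (a * inv_mod d a) = int 1] (mod int d)"
    using x by (simp add: inv_mod_def)
  thus "[a * inv_mod d a = 1] (mod d)" by (simp only: cong_int_iff)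
  show "inv_mod d a < d" using x by (simp add: inv_mod_def)
qed

context prime_GT
begin

lemma I_eq: "I_ideal e d b = ideal_gen (mon ` inv_exps d b)"
  by (rule I_ideal_eq[OF prim d_pos])

lemma equiv_reflect: "b \<le> d \<Longrightarrow> 0 < b \<Longrightarrow> perm_equiv (I_ideal e d b) (I_ideal e d (d - b + 1))"
  unfolding I_eq by (rule perm_equiv_swap_xy)

lemma equiv_inverse: "[b * c = 1] (mod d) \<Longrightarrow> perm_equiv (I_ideal e d b) (I_ideal e d c)"
  unfolding I_eq by (rule perm_equiv_swap_yz)

text \<open>d - 1 is the reflection of 2, and k + 1 is its inverse.\<close>

lemma coincide_special:
  "coincide_up_to_perm {I_ideal e d 2, I_ideal e d (d - 1), I_ideal e d (k + 1)}"
proof (rule coincide_up_to_permI)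
  have "d - 2 + 1 = d - 1" using d5 by simp
  hence 1: "perm_equiv (I_ideal e d 2) (I_ideal e d (d - 1))"
    using equiv_reflect[of 2] d5 by simp
  have "2 * (k + 1) = d + 1" using d_eq by simp
  hence "[2 * (k + 1) = 1] (mod d)" unfolding cong_def by (metis mod_add_self1)
  hence 2: "perm_equiv (I_ideal e d 2) (I_ideal e d (k + 1))" by (rule equiv_inverse)
  fix J assume "J \<in> {I_ideal e d 2, I_ideal e d (d - 1), I_ideal e d (k + 1)}"
  thus "perm_equiv (I_ideal e d 2) J" using 1 2 perm_equiv_refl by auto
qed

lemma coincide_reflect:
  "coincide_up_to_perm {I_ideal e d a, I_ideal e d (d - a + 1)}"
  using equiv_reflect[of a] a_le a2 perm_equiv_refl
  by (intro coincide_up_to_permI[of _ "I_ideal e d a"]) auto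

text \<open>Modulo \<open>d\<close> the six weights are a, 1/a, 1/(1 - a), 1 - a, 1 - 1/a and 1 -
  1/(1 - a): the values of a cross-ratio under the symmetric group on three letters, here the
  permutations of the variables.\<close>

lemma coincide_orbit:
  fixes b c :: nat
  defines "b \<equiv> inv_mod d a" and "c \<equiv> inv_mod d (d - a + 1)"
  shows "coincide_up_to_perm
    {I_ideal e d a, I_ideal e d b, I_ideal e d c,
     I_ideal e d (d - a + 1), I_ideal e d (d - b + 1), I_ideal e d (d - c + 1)}"
proof (rule coincide_up_to_permI)
  have "\<not> d dvd d - a + 1" using a2 a_le d_pos by (auto dest!: dvd_imp_le)
  hence cop: "coprime (d - a + 1) d"
    using prime_imp_coprime[OF prime_d] coprime_commute by blast
  have d1: "d > 1" using d5 by simp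
  have c: "[(d - a + 1) * c = 1] (mod d)" "c < d"
    unfolding c_def by (rule inv_mod_props[OF cop d1])+
  have b: "[a * b = 1] (mod d)" "b < d"
    unfolding b_def by (rule inv_mod_props[OF a_coprime d1])+
  have "0 < x" if "[y * x = 1] (mod d)" for x y
    using that d1 by (cases "x = 0") (auto simp: cong_def)
  hence pos: "0 < b" "0 < c" using b(1) c(1) by blast+
  have 1: "perm_equiv (I_ideal e d a) (I_ideal e d (d - a + 1))"
    using equiv_reflect[of a] a_le a2 by simp
  have 2: "perm_equiv (I_ideal e d a) (I_ideal e d b)" by (rule equiv_inverse[OF b(1)])
  have 3: "perm_equiv (I_ideal e d a) (I_ideal e d (d - b + 1))"
    using perm_equiv_trans[OF 2 equiv_reflect] b(2) pos by simp
  have 4: "perm_equiv (I_ideal e d a) (I_ideal e d c)"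
    by (rule perm_equiv_trans[OF 1 equiv_inverse[OF c(1)]])
  have 5: "perm_equiv (I_ideal e d a) (I_ideal e d (d - c + 1))"
    using perm_equiv_trans[OF 4 equiv_reflect] c(2) pos by simp
  fix J assume "J \<in> {I_ideal e d a, I_ideal e d b, I_ideal e d c,
     I_ideal e d (d - a + 1), I_ideal e d (d - b + 1), I_ideal e d (d - c + 1)}"
  thus "perm_equiv (I_ideal e d a) J" using 1 2 3 4 5 perm_equiv_refl by blast
qed

end

section \<open>Smoothness\<close>

subsection \<open>Directional derivatives\<close>

lemma ev_cong:
  assumes "\<And>m i. m \<in> keys F \<Longrightarrow> i \<in> keys m \<Longrightarrow> v i = w i"
  shows "ev v F = ev w F"
proof -
  have "mval v m = mval w m" if "m \<in> keys F" for m
    using assms that by (intro mval_cong) auto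
  thus ?thesis by (simp add: ev_def poly_hom_alt)
qed

text \<open>The restriction of \<open>F\<close> to a polynomially parametrized curve; formal
  derivatives in the parameter then produce tangent vectors.\<close>

definition curve :: "('i \<Rightarrow> 'k poly) \<Rightarrow> ('i, 'k::field_char_0) mpoly \<Rightarrow> 'k poly" where
  "curve \<pi> F = poly_hom (\<lambda>c. [:c:]) \<pi> F"

lemma curve_add [simp]: "curve \<pi> (F + G) = curve \<pi> F + curve \<pi> G"
  unfolding curve_def by (rule coeff_hom.poly_hom_add[OF coeff_hom_pCons])

lemma curve_mult [simp]: "curve \<pi> (F * G) = curve \<pi> F * curve \<pi> G"
  unfolding curve_def by (rule coeff_hom.poly_hom_mult[OF coeff_hom_pCons])

lemma curve_single: "curve \<pi> (single m c) = smult c (mval \<pi> m)"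
  unfolding curve_def by (simp add: coeff_hom.poly_hom_single[OF coeff_hom_pCons])

lemma curve_1 [simp]: "curve \<pi> 1 = 1"
  unfolding curve_def by (rule coeff_hom.poly_hom_1[OF coeff_hom_pCons])

lemma curve_0 [simp]: "curve \<pi> 0 = 0"
  unfolding curve_def by (rule coeff_hom.poly_hom_0[OF coeff_hom_pCons])

lemma curve_Var [simp]: "curve \<pi> (Var i) = \<pi> i"
  by (simp add: Var_def curve_single)

lemma curve_power [simp]: "curve \<pi> (F ^ n) = curve \<pi> F ^ n"
  by (induction n) auto

lemma curve_uminus [simp]: "curve \<pi> (- F) = - curve \<pi> F"
  using curve_add[of \<pi> F "- F"] by (simp add: add_eq_0_iff del: curve_add)

lemma curve_diff [simp]: "curve \<pi> (F - G) = curve \<pi> F - curve \<pi> G"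
  using curve_add[of \<pi> F "- G"] by simp

lemma poly_mval: "poly (mval \<pi> m) t = mval (\<lambda>i. poly (\<pi> i) t) m"
  by (simp add: mval_def poly_prod)

lemma poly_curve: "poly (curve \<pi> F) t = ev (\<lambda>i. poly (\<pi> i) t) F"
  by (induction F rule: mpoly_induct) (simp_all add: curve_single ev_single poly_mval)

text \<open>The product rule in the shape that matches \<open>partial\<close>: where
  \<open>m - single i 1\<close> is truncated, the factor \<open>lookup m i\<close> is 0.\<close>

lemma pderiv_mval:
  fixes \<pi> :: "'i \<Rightarrow> 'k::field_char_0 poly"
  assumes "finite T" "keys m \<subseteq> T"
  shows "pderiv (mval \<pi> m) = (\<Sum>i\<in>T. of_nat (lookup m i) * mval \<pi> (m - single i 1) * pderiv (\<pi> i))"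
proof -
  have "pderiv (mval \<pi> m) = (\<Sum>i\<in>T. (\<Prod>j\<in>T - {i}. \<pi> j ^ lookup m j) * pderiv (\<pi> i ^ lookup m i))"
    by (simp add: mval_superset[OF assms] pderiv_prod)
  also have "\<dots> = (\<Sum>i\<in>T. of_nat (lookup m i) * mval \<pi> (m - single i 1) * pderiv (\<pi> i))"
  proof (intro sum.cong refl)
    fix i assume i: "i \<in> T"
    show "(\<Prod>j\<in>T - {i}. \<pi> j ^ lookup m j) * pderiv (\<pi> i ^ lookup m i) =
        of_nat (lookup m i) * mval \<pi> (m - single i 1) * pderiv (\<pi> i)"
    proof (cases "lookup m i")
      case (Suc n)
      have "keys (m - single i 1) \<subseteq> T" using assms(2) by (auto simp: in_keys_iff lookup_minus)
      hence "mval \<pi> (m - single i 1) = (\<Prod>j\<in>T. \<pi> j ^ lookup (m - single i 1) j)"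
        using assms(1) by (intro mval_superset)
      also have "\<dots> = \<pi> i ^ lookup (m - single i 1) i * (\<Prod>j\<in>T - {i}. \<pi> j ^ lookup (m - single i 1) j)"
        by (rule prod.remove[OF assms(1) i])
      also have "(\<Prod>j\<in>T - {i}. \<pi> j ^ lookup (m - single i 1) j) = (\<Prod>j\<in>T - {i}. \<pi> j ^ lookup m j)"
        by (intro prod.cong refl) (auto simp: lookup_minus lookup_single)
      also have "lookup (m - single i 1) i = n" using Suc by (simp add: lookup_minus)
      finally have mv: "mval \<pi> (m - single i 1) = \<pi> i ^ n * (\<Prod>j\<in>T - {i}. \<pi> j ^ lookup m j)" .
      have "pderiv (\<pi> i ^ lookup m i) = of_nat (lookup m i) * (\<pi> i ^ n * pderiv (\<pi> i))"
        unfolding Suc pderiv_power_Suc by (simp add: of_nat_poly)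
      thus ?thesis unfolding mv by (simp only: mult_ac)
    qed simp
  qed
  finally show ?thesis .
qed

text \<open>The chain rule; it converts the gradient condition in \<open>cone_tangent_space\<close>
  into a statement about derivatives along curves.\<close>

lemma poly_pderiv_curve:
  fixes \<pi> :: "'i \<Rightarrow> 'k::field_char_0 poly"
  assumes T: "finite T" and F: "F \<in> forms T n"
  shows "poly (pderiv (curve \<pi> F)) t =
    (\<Sum>i\<in>T. ev (\<lambda>i. poly (\<pi> i) t) (partial i F) * poly (pderiv (\<pi> i)) t)"
proof -
  let ?v = "\<lambda>i. poly (\<pi> i) t"
  have 1: "curve \<pi> F = (\<Sum>m\<in>keys F. smult (lookup F m) (mval \<pi> m))"
    by (simp add: curve_def poly_hom_alt)
  have 2: "ev ?v (partial i F) = (\<Sum>m\<in>keys F. of_nat (lookup m i) * lookup F m * mval ?v (m - single i 1))" for i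
    by (simp add: partial_def ev_sum ev_single)
  have "poly (pderiv (curve \<pi> F)) t = (\<Sum>m\<in>keys F. lookup F m * poly (pderiv (mval \<pi> m)) t)"
  proof -
    have "pderiv (\<Sum>m\<in>A. f m) = (\<Sum>m\<in>A. pderiv (f m))" for A and f :: "('i \<Rightarrow>\<^sub>0 nat) \<Rightarrow> 'k poly"
      by (induction A rule: infinite_finite_induct) (auto simp: pderiv_add)
    thus ?thesis unfolding 1 by (simp add: pderiv_smult poly_sum)
  qed
  also have "\<dots> = (\<Sum>m\<in>keys F. \<Sum>i\<in>T. of_nat (lookup m i) * lookup F m * mval ?v (m - single i 1) * poly (pderiv (\<pi> i)) t)"
  proof (intro sum.cong refl)
    fix m assume "m \<in> keys F"
    hence "keys m \<subseteq> T" using F by (auto simp: forms_def)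
    thus "lookup F m * poly (pderiv (mval \<pi> m)) t =
        (\<Sum>i\<in>T. of_nat (lookup m i) * lookup F m * mval ?v (m - single i 1) * poly (pderiv (\<pi> i)) t)"
      by (simp add: pderiv_mval[OF T] poly_sum poly_mval sum_distrib_left of_nat_poly mult_ac)
  qed
  also have "\<dots> = (\<Sum>i\<in>T. ev ?v (partial i F) * poly (pderiv (\<pi> i)) t)"
    unfolding 2 sum_distrib_right by (rule sum.swap)
  finally show ?thesis .
qed

lemma poly_eq_0_if_nonzero_roots:
  fixes p :: "'k::field_char_0 poly"
  assumes "\<And>t. t \<noteq> 0 \<Longrightarrow> poly p t = 0"
  shows "p = 0"
proof (rule ccontr)
  assume "p \<noteq> 0"
  hence "finite (insert 0 {t. poly p t = 0})" by (simp add: poly_roots_finite)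
  moreover have "insert 0 {t. poly p t = 0} = UNIV" using assms by auto
  ultimately show False using infinite_UNIV_char_0[where 'a = 'k] by simp
qed

subsection \<open>Points and closures\<close>

lemma pt_self: "v \<in> pt v"
  unfolding pt_def by (intro CollectI exI[of _ 1]) auto

lemma mem_pt_iff: "w \<in> pt v \<longleftrightarrow> (\<exists>c. c \<noteq> 0 \<and> w = (\<lambda>i. c * v i))"
  by (auto simp: pt_def)

lemma pt_scale: "c \<noteq> 0 \<Longrightarrow> pt (\<lambda>i. c * v i) = pt v"
proof (intro equalityI subsetI)
  fix w assume c: "c \<noteq> 0" and "w \<in> pt (\<lambda>i. c * v i)"
  then obtain b where "b \<noteq> 0" "w = (\<lambda>i. b * (c * v i))" by (auto simp: mem_pt_iff)
  thus "w \<in> pt v" using c unfolding mem_pt_iff by (intro exI[of _ "b * c"]) (auto simp: mult.assoc)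
next
  fix w assume c: "c \<noteq> 0" and "w \<in> pt v"
  then obtain b where "b \<noteq> 0" "w = (\<lambda>i. b * v i)" by (auto simp: mem_pt_iff)
  thus "w \<in> pt (\<lambda>i. c * v i)" using c unfolding mem_pt_iff by (intro exI[of _ "b / c"]) auto
qed

lemma pt_mem_eq: "w \<in> pt v \<Longrightarrow> pt w = pt v"
  using pt_scale by (auto simp: mem_pt_iff)

lemma some_pt:
  obtains c where "c \<noteq> 0" "(SOME w. w \<in> pt v) = (\<lambda>i. c * v i)"
  using someI[of "\<lambda>w. w \<in> pt v" v] pt_self[of v] by (auto simp: mem_pt_iff)

lemma pspaceE:
  assumes "p \<in> pspace T" "v \<in> p"
  shows "p = pt v" "v \<noteq> (\<lambda>_. 0)" "\<And>i. i \<notin> T \<Longrightarrow> v i = 0"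
proof -
  obtain u where u: "p = pt u" "u \<noteq> (\<lambda>_. 0)" "\<And>i. i \<notin> T \<Longrightarrow> u i = 0"
    using assms(1) by (auto simp: pspace_def)
  then obtain c where c: "c \<noteq> 0" "v = (\<lambda>i. c * u i)" using assms(2) by (auto simp: mem_pt_iff)
  show "p = pt v" using u(1) assms(2) pt_mem_eq by blast
  show "v \<noteq> (\<lambda>_. 0)" using u(2) c by (auto simp: fun_eq_iff)
  show "v i = 0" if "i \<notin> T" for i using u(3)[OF that] c by simp
qed

lemma pspaceI: "v \<noteq> (\<lambda>_. 0) \<Longrightarrow> (\<And>i. i \<notin> T \<Longrightarrow> v i = 0) \<Longrightarrow> pt v \<in> pspace T"
  by (auto simp: pspace_def)

text \<open>A coordinate vector of the image point. \<open>proj_map\<close> works with a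
  representative picked by \<open>SOME\<close>; by homogeneity another one only rescales this
  vector.\<close>

definition coords :: "('i, 'k::field) mpoly set \<Rightarrow> ('i \<Rightarrow> 'k) \<Rightarrow> ('i, 'k) mpoly \<Rightarrow> 'k" where
  "coords B w = (\<lambda>F. if F \<in> B then ev w F else 0)"

lemma coords_scale:
  assumes "B \<subseteq> forms UNIV d"
  shows "coords B (\<lambda>i. c * w i) = (\<lambda>F. c ^ d * coords B w F)"
proof
  fix F
  show "coords B (\<lambda>i. c * w i) F = c ^ d * coords B w F"
    using assms ev_forms_scale[of F UNIV d c w] by (auto simp: coords_def)
qed

lemma proj_map_pt:
  assumes "B \<subseteq> forms UNIV d"
  shows "proj_map B (pt w) = pt (coords B w)"
proof -
  obtain c where c: "c \<noteq> 0" "(SOME v. v \<in> pt w) = (\<lambda>i. c * w i)" by (rule some_pt)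
  have "proj_map B (pt w) = pt (coords B (\<lambda>i. c * w i))"
    by (simp only: proj_map_def c(2) coords_def)
  also have "\<dots> = pt (coords B w)"
    unfolding coords_scale[OF assms] using c(1) by (intro pt_scale) simp
  finally show ?thesis .
qed

lemma proj_map_dom_iff:
  assumes "B \<subseteq> forms UNIV d" "w \<noteq> (\<lambda>_. 0)"
  shows "pt w \<in> proj_map_dom B \<longleftrightarrow> coords B w \<noteq> (\<lambda>_. 0)"
proof -
  have "(\<exists>v\<in>pt w. \<exists>F\<in>B. ev v F \<noteq> 0) \<longleftrightarrow> (\<exists>F\<in>B. ev w F \<noteq> 0)"
  proof
    assume "\<exists>v\<in>pt w. \<exists>F\<in>B. ev v F \<noteq> 0"
    then obtain c F where F: "F \<in> B" "ev (\<lambda>i. c * w i) F \<noteq> 0" by (auto simp: mem_pt_iff)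
    moreover have "F \<in> forms UNIV d" using F(1) assms(1) by blast
    ultimately have "ev w F \<noteq> 0" using ev_forms_scale[of F UNIV d c w] by auto
    thus "\<exists>F\<in>B. ev w F \<noteq> 0" using F(1) by blast
  qed (use pt_self in blast)
  thus ?thesis
    using assms(2) by (auto simp: proj_map_dom_def coords_def fun_eq_iff intro!: pspaceI)
qed

text \<open>The values at \<open>x\<close>, \<open>y\<close>, \<open>z\<close> form a triangular
  matrix with diagonal 1, c, c, which makes \<open>D1\<close>, \<open>D2\<close>, \<open>D3\<close>
  independent.\<close>

lemma fun_dim_3:
  fixes W :: "('i \<Rightarrow> 'k::field) set"
  assumes D: "D1 \<in> W" "D2 \<in> W" "D3 \<in> W"
    and c: "c \<noteq> 0"
    and D1: "D1 x = 1" "D2 x = 0" "D3 x = 0"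
    and D2: "D2 y = c" "D3 y = 0"
    and D3: "D2 z = 0" "D3 z = c"
    and W: "\<And>w. w \<in> W \<Longrightarrow> \<exists>\<alpha> \<beta> \<gamma>. w = (\<lambda>i. \<alpha> * D1 i + \<beta> * D2 i + \<gamma> * D3 i)"
  shows "vector_space.dim (\<lambda>c w i. c * w i) W = 3"
proof -
  interpret fs: vector_space "\<lambda>(c::'k) (w::'i \<Rightarrow> 'k) i. c * w i"
    by unfold_locales (auto simp: algebra_simps fun_eq_iff)
  have ne: "D1 \<noteq> D2" "D1 \<noteq> D3" "D2 \<noteq> D3"
    using D1 D2 D3 c by auto
  have "fs.independent {D1, D2, D3}"
    unfolding fs.dependent_finite[OF finite.insertI[OF finite.insertI[OF finite.insertI[OF finite.emptyI]]]]
  proof (rule notI, elim exE conjE bexE)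
    fix u v assume v: "v \<in> {D1, D2, D3}" "u v \<noteq> 0" and "(\<Sum>v\<in>{D1, D2, D3}. (\<lambda>i. u v * v i)) = 0"
    hence 0: "u D1 * D1 i + u D2 * D2 i + u D3 * D3 i = 0" for i
      using ne by (simp add: fun_eq_iff add.assoc)
    have "u D1 = 0" using 0[of x] D1 by simp
    moreover from this have "u D2 = 0" using 0[of y] D2 c by simp
    moreover from calculation have "u D3 = 0" using 0[of z] D3 c by simp
    ultimately show False using v by auto
  qed
  moreover have "W \<subseteq> fs.span {D1, D2, D3}"
  proof
    fix w assume "w \<in> W"
    then obtain \<alpha> \<beta> \<gamma> where "w = (\<lambda>i. \<alpha> * D1 i + \<beta> * D2 i + \<gamma> * D3 i)" using W by blast
    hence w: "w = (\<lambda>i. \<alpha> * D1 i) + (\<lambda>i. \<beta> * D2 i) + (\<lambda>i. \<gamma> * D3 i)" by (auto simp: fun_eq_iff)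
    show "w \<in> fs.span {D1, D2, D3}"
      unfolding w by (intro fs.span_add fs.span_scale fs.span_base) auto
  qed
  moreover have "fs.span {D1, D2, D3} \<subseteq> fs.span W" using D by (intro fs.span_mono) auto
  moreover from calculation have "fs.span W \<subseteq> fs.span {D1, D2, D3}"
    by (intro fs.span_minimal fs.subspace_span)
  ultimately have "fs.dim W = card {D1, D2, D3}"
    by (intro fs.dim_eq_card equalityI)
  thus ?thesis using ne by simp
qed

subsection \<open>The surface of a hexagon\<close>

text \<open>What matters about the monomials outside the ideal: the corners of the triangle of
  degree \<open>d\<close> are missing and the rest of its boundary is present. Which interior points
  belong to \<open>Q\<close> is left open.\<close>

locale hexagon =
  fixes d :: nat and Q :: "(var \<Rightarrow>\<^sub>0 nat) set" and S :: "(var, 'k::field_char_0) mpoly set"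
  assumes d3: "d \<ge> 3" and S_eq: "S = mon ` Q"
    and Q_mdeg: "\<And>m. m \<in> Q \<Longrightarrow> mdeg m = d"
    and Q_less: "\<And>m i. m \<in> Q \<Longrightarrow> lookup m i < d"
    and Q_edge: "\<And>m i. mdeg m = d \<Longrightarrow> lookup m i = 0 \<Longrightarrow> (\<And>j. lookup m j < d) \<Longrightarrow> m \<in> Q"
begin

definition X :: "((var, 'k) mpoly, 'k) point set" where
  "X = zariski_closure S (proj_map S ` proj_map_dom S)"

lemma S_forms: "S \<subseteq> forms UNIV d"
  unfolding S_eq using Q_mdeg by (auto intro!: forms_mon)

lemma finite_Q: "finite Q"
  by (rule finite_subset[OF _ finite_mdeg_var[of d]]) (auto simp: Q_mdeg)

lemma finite_S [simp]: "finite S"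
  by (simp add: S_eq finite_Q)

lemma mon_S_iff [simp]: "mon m \<in> S \<longleftrightarrow> m \<in> Q"
  by (auto simp: S_eq)

lemma coords_mon: "m \<in> Q \<Longrightarrow> coords S w (mon m) = mval w m"
  by (simp add: coords_def ev_mon)

lemma coords_mem_X:
  assumes "coords S w \<noteq> (\<lambda>_. 0)"
  shows "pt (coords S w) \<in> X"
proof -
  have w: "w \<noteq> (\<lambda>_. 0)"
  proof
    assume "w = (\<lambda>_. 0)"
    hence "mval w m = 0" if "m \<in> Q" for m
      using Q_mdeg[OF that] d3 by (auto simp: mval_var mdeg_var zero_power)
    hence "coords S w = (\<lambda>_. 0)" by (intro ext) (auto simp: coords_def S_eq ev_mon)
    thus False using assms by simp
  qed
  hence "pt (coords S w) \<in> proj_map S ` proj_map_dom S"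
    using assms by (intro image_eqI[of _ _ "pt w"]) (auto simp: proj_map_pt[OF S_forms] proj_map_dom_iff[OF S_forms])
  moreover have "pt (coords S w) \<in> pspace S"
    using assms by (intro pspaceI) (auto simp: coords_def)
  ultimately show ?thesis
    unfolding X_def zariski_closure_def vanishing_def by blast
qed

lemma vanishing_X_coords:
  assumes "F \<in> vanishing S X" "coords S w \<noteq> (\<lambda>_. 0)"
  shows "ev (\<lambda>i. c * coords S w i) F = 0"
proof -
  have "ev (coords S w) F = 0"
    using assms coords_mem_X[OF assms(2)] pt_self by (fastforce simp: vanishing_def)
  moreover obtain n where "F \<in> forms S n" using assms(1) by (auto simp: vanishing_def)
  ultimately show ?thesis using ev_forms_scale by fastforce
qed

text \<open>This is how points of the closure that are not in the image are reached: equations need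
  only be tested on the parametrization.\<close>

lemma vanishing_XI:
  assumes "F \<in> forms S n" "\<And>w. ev (coords S w) F = 0" "p \<in> X" "v \<in> p"
  shows "ev v F = 0"
proof -
  have "F \<in> vanishing S (proj_map S ` proj_map_dom S)"
    unfolding vanishing_def
  proof (intro CollectI conjI ballI)
    fix q v assume "q \<in> proj_map S ` proj_map_dom S" "v \<in> q"
    then obtain w where "v \<in> pt (coords S w)"
      by (auto simp: proj_map_dom_def pspace_def proj_map_pt[OF S_forms])
    then obtain c where "v = (\<lambda>i. c * coords S w i)" by (auto simp: mem_pt_iff)
    thus "ev v F = 0" using assms(1,2) by (simp add: ev_forms_scale)
  qed (use assms(1) in blast)
  thus ?thesis using assms(3,4) by (auto simp: X_def zariski_closure_def)
qed

lemma X_pspace: "X \<subseteq> pspace S"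
  by (auto simp: X_def zariski_closure_def)

text \<open>The toric equation of a relation n p1 + c p4 = a p2 + b p3 between exponent vectors. The
  covering by charts and the bound for the tangent spaces use only equations of this form.\<close>

definition binomial :: "_ \<Rightarrow> _ \<Rightarrow> _ \<Rightarrow> _ \<Rightarrow> _ \<Rightarrow> _ \<Rightarrow> _ \<Rightarrow> _ \<Rightarrow> ((var, 'k) mpoly, 'k) mpoly" where
  "binomial p1 n p4 c p2 a p3 b =
     Var (mon p1) ^ n * Var (mon p4) ^ c - Var (mon p2) ^ a * Var (mon p3) ^ b"

lemma binomial_forms:
  assumes "p1 \<in> Q" "p2 \<in> Q" "p3 \<in> Q" "p4 \<in> Q" "n + c = a + b"
  shows "binomial p1 n p4 c p2 a p3 b \<in> (forms S (n + c) :: ((var, 'k) mpoly, 'k) mpoly set)"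
proof -
  have "Var (mon p) ^ n \<in> (forms S n :: ((var, 'k) mpoly, 'k) mpoly set)" if "p \<in> Q" for p n
    using forms_power[OF forms_Var[of "mon p" S], of n] that by simp
  from forms_mult[OF this[OF assms(1)] this[OF assms(4)], of n c]
    forms_mult[OF this[OF assms(2)] this[OF assms(3)], of a b]
  show ?thesis unfolding binomial_def using assms(5) by (intro forms_diff) auto
qed

lemma binomial_coords:
  assumes "p1 \<in> Q" "p2 \<in> Q" "p3 \<in> Q" "p4 \<in> Q"
    and "\<And>i. n * lookup p1 i + c * lookup p4 i = a * lookup p2 i + b * lookup p3 i"
  shows "ev (coords S w) (binomial p1 n p4 c p2 a p3 b) = 0"
proof -
  have *: "mval w p ^ n * mval w q ^ c = (\<Prod>i\<in>UNIV. w i ^ (n * lookup p i + c * lookup q i))" for p q n c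
    by (simp add: mval_superset[of UNIV] prod_power_distrib power_add prod.distrib
        flip: power_mult) (simp add: mult.commute)
  show ?thesis using assms by (simp add: binomial_def coords_mon * )
qed

lemma X_binomial:
  assumes "p1 \<in> Q" "p2 \<in> Q" "p3 \<in> Q" "p4 \<in> Q" "n + c = a + b"
    and "\<And>i. n * lookup p1 i + c * lookup p4 i = a * lookup p2 i + b * lookup p3 i"
    and "p \<in> X" "v \<in> p"
  shows "v (mon p1) ^ n * v (mon p4) ^ c = v (mon p2) ^ a * v (mon p3) ^ b"
  using vanishing_XI[OF binomial_forms[OF assms(1-5)] binomial_coords[OF assms(1-4,6)] assms(7,8)]
  by (simp add: binomial_def)

end

section \<open>Affine charts at the vertices of the hexagon\<close>

locale hexagon_chart = hexagon d Q S
  for d :: nat and Q :: "(var \<Rightarrow>\<^sub>0 nat) set" and S :: "(var, 'k::field_char_0) mpoly set" +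
  fixes \<alpha> \<beta> \<gamma> :: var
  assumes distinct: "\<alpha> \<noteq> \<beta>" "\<alpha> \<noteq> \<gamma>" "\<beta> \<noteq> \<gamma>"
begin

lemma vars: "i = \<alpha> \<or> i = \<beta> \<or> i = \<gamma>"
  using distinct by (cases i; cases \<alpha>; cases \<beta>; cases \<gamma>) auto

lemma mdeg_eq: "mdeg m = lookup m \<alpha> + lookup m \<beta> + lookup m \<gamma>"
proof -
  have "keys m \<subseteq> {\<alpha>, \<beta>, \<gamma>}" using vars by blast
  thus ?thesis using distinct by (simp add: mdeg_superset[of "{\<alpha>, \<beta>, \<gamma>}"])
qed

lemma mval_eq: "mval w m = w \<alpha> ^ lookup m \<alpha> * w \<beta> ^ lookup m \<beta> * w \<gamma> ^ lookup m \<gamma>"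
proof -
  have "keys m \<subseteq> {\<alpha>, \<beta>, \<gamma>}" using vars by blast
  thus ?thesis using distinct by (simp add: mval_superset[of "{\<alpha>, \<beta>, \<gamma>}"] mult.assoc)
qed

lemma all_vars: "P \<alpha> \<Longrightarrow> P \<beta> \<Longrightarrow> P \<gamma> \<Longrightarrow> P i"
  using vars[of i] by auto

text \<open>The chart belongs to the vertex \<open>v0\<close>; from there \<open>v1\<close> is the
  next lattice point on the side of the triangle and \<open>v2\<close> the one across the cut
  corner. The six orders of the variables give the six vertices.\<close>

definition v0 where "v0 = single \<alpha> (d - 1) + single \<beta> 1"
definition v1 where "v1 = single \<alpha> (d - 2) + single \<beta> 2"
definition v2 where "v2 = single \<alpha> (d - 1) + single \<gamma> 1"

lemma lookup_v [simp]:
  "lookup v0 \<alpha> = d - 1" "lookup v0 \<beta> = 1" "lookup v0 \<gamma> = 0"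
  "lookup v1 \<alpha> = d - 2" "lookup v1 \<beta> = 2" "lookup v1 \<gamma> = 0"
  "lookup v2 \<alpha> = d - 1" "lookup v2 \<beta> = 0" "lookup v2 \<gamma> = 1"
  using distinct by (simp_all add: v0_def v1_def v2_def lookup_add lookup_single)

lemma edge_in_Q:
  assumes "i + j = d" "0 < i" "0 < j"
  shows "single \<alpha> i + single \<beta> j \<in> Q"
proof (rule Q_edge[of _ \<gamma>])
  show "lookup (single \<alpha> i + single \<beta> j) x < d" for x
    by (rule all_vars[of _ x]) (use assms distinct in \<open>auto simp: lookup_add lookup_single\<close>)
qed (use assms distinct in \<open>auto simp: lookup_add lookup_single\<close>)

lemma edge_in_Q':
  assumes "i + j = d" "0 < i" "0 < j"
  shows "single \<alpha> i + single \<gamma> j \<in> Q"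
proof (rule Q_edge[of _ \<beta>])
  show "lookup (single \<alpha> i + single \<gamma> j) x < d" for x
    by (rule all_vars[of _ x]) (use assms distinct in \<open>auto simp: lookup_add lookup_single\<close>)
qed (use assms distinct in \<open>auto simp: lookup_add lookup_single\<close>)

lemma v_Q [simp]: "v0 \<in> Q" "v1 \<in> Q" "v2 \<in> Q"
  unfolding v0_def v1_def v2_def using d3 by (auto intro!: edge_in_Q edge_in_Q')

text \<open>Coordinates of m - v0 in the lattice basis v1 - v0, v2 - v0. On \<open>Q\<close> all
  exponents are below \<open>d\<close>, so the truncated difference is exact and both coordinates
  are nonnegative: this is the freeness of the semigroup.\<close>

definition e1 :: "(var \<Rightarrow>\<^sub>0 nat) \<Rightarrow> nat" where "e1 m = d - 1 - lookup m \<alpha>"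
definition e2 :: "(var \<Rightarrow>\<^sub>0 nat) \<Rightarrow> nat" where "e2 m = lookup m \<gamma>"

lemma e_v [simp]: "e1 v0 = 0" "e2 v0 = 0" "e1 v1 = 1" "e2 v1 = 0" "e1 v2 = 0" "e2 v2 = 1"
  using d3 by (simp_all add: e1_def e2_def)

lemma e_eq_0: "m \<in> Q \<Longrightarrow> e1 m + e2 m = 0 \<Longrightarrow> m = v0"
proof (rule poly_mapping_eqI)
  fix i assume m: "m \<in> Q" "e1 m + e2 m = 0"
  hence "lookup m \<alpha> = d - 1" "lookup m \<gamma> = 0"
    using Q_less[OF m(1), of \<alpha>] by (auto simp: e1_def e2_def)
  moreover from this have "lookup m \<beta> = 1" using Q_mdeg[OF m(1)] d3 by (simp add: mdeg_eq)
  ultimately show "lookup m i = lookup v0 i" using vars[of i] by auto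
qed

text \<open>The equation m - v0 = e1 (v1 - v0) + e2 (v2 - v0), made homogeneous by collecting the
  copies of \<open>v0\<close> on one side.\<close>

lemma chart_relation:
  assumes m: "m \<in> Q" and n: "e1 m + e2 m = Suc n"
  shows "1 * lookup m i + n * lookup v0 i = e1 m * lookup v1 i + e2 m * lookup v2 i"
proof -
  define D where "D = d - 1"
  have D: "d = Suc D" "d - 1 = D" "d - 2 = D - 1" "D \<ge> 2" using d3 by (auto simp: D_def)
  have less: "lookup m \<alpha> < d" using Q_less[OF m] .
  have \<alpha>: "lookup m \<alpha> + e1 m = D" using less by (simp add: e1_def D_def)
  have deg: "lookup m \<alpha> + lookup m \<beta> + e2 m = Suc D"
    using Q_mdeg[OF m] d3 by (simp add: mdeg_eq e2_def D_def)
  show ?thesis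
  proof (rule all_vars[of _ i])
    have "lookup m \<alpha> + n * D + e1 m = Suc n * D" using \<alpha> by simp
    also have "\<dots> = e1 m * D + e2 m * D" by (simp add: n[symmetric] distrib_right)
    also have "e1 m * D = e1 m * (D - 1) + e1 m" using D(4) by (cases D) auto
    finally show "1 * lookup m \<alpha> + n * lookup v0 \<alpha> = e1 m * lookup v1 \<alpha> + e2 m * lookup v2 \<alpha>"
      by (simp add: D(2)[simplified] D(3))
    show "1 * lookup m \<beta> + n * lookup v0 \<beta> = e1 m * lookup v1 \<beta> + e2 m * lookup v2 \<beta>"
      using \<alpha> deg n by simp
    show "1 * lookup m \<gamma> + n * lookup v0 \<gamma> = e1 m * lookup v1 \<gamma> + e2 m * lookup v2 \<gamma>"
      by (simp add: e2_def)
  qed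
qed

definition expn :: "(var, 'k) mpoly \<Rightarrow> var \<Rightarrow>\<^sub>0 nat" where
  "expn F = the_elem (keys F)"

lemma expn_mon [simp]: "expn (mon m) = m"
  by (simp add: expn_def)

text \<open>\<open>s\<close> and \<open>t\<close> are the quotients of the coordinates at
  \<open>v1\<close> and \<open>v2\<close> by the one at \<open>v0\<close>, and \<open>c\<close> is
  the scale on the cone. The points with s = 0 or t = 0 are those that the torus does not
  reach.\<close>

definition chart :: "'k \<Rightarrow> 'k \<Rightarrow> 'k \<Rightarrow> (var, 'k) mpoly \<Rightarrow> 'k" where
  "chart c s t = (\<lambda>F. if F \<in> S then c * s ^ e1 (expn F) * t ^ e2 (expn F) else 0)"

lemma chart_mon: "m \<in> Q \<Longrightarrow> chart c s t (mon m) = c * s ^ e1 m * t ^ e2 m"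
  by (simp add: chart_def)

lemma chart_v [simp]: "chart c s t (mon v0) = c" "chart c s t (mon v1) = c * s" "chart c s t (mon v2) = c * t"
  by (simp_all add: chart_mon)

text \<open>The plane point with coordinates 1, s, s t has the value \<open>s\<close> at
  \<open>v0\<close>, which explains the factor c / s.\<close>

lemma chart_coords:
  assumes "s \<noteq> 0" "t \<noteq> 0"
  shows "chart c s t = (\<lambda>F. (c / s) * coords S (\<lambda>i. if i = \<alpha> then 1 else if i = \<beta> then s else s * t) F)"
proof
  fix F
  show "chart c s t F = (c / s) * coords S (\<lambda>i. if i = \<alpha> then 1 else if i = \<beta> then s else s * t) F"
  proof (cases "F \<in> S")
    case True
    then obtain m where m: "F = mon m" "m \<in> Q" by (auto simp: S_eq)
    have "lookup m \<beta> + lookup m \<gamma> = Suc (e1 m)"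
      using Q_mdeg[OF m(2)] Q_less[OF m(2), of \<alpha>] by (simp add: mdeg_eq e1_def)
    hence "s ^ lookup m \<beta> * s ^ lookup m \<gamma> = s * s ^ e1 m" by (simp flip: power_add)
    hence "s ^ lookup m \<beta> * (s * t) ^ lookup m \<gamma> = s * (s ^ e1 m * t ^ e2 m)"
      by (simp add: power_mult_distrib e2_def mult_ac)
    thus ?thesis using m assms distinct by (simp add: chart_mon coords_mon mval_eq)
  qed (simp add: chart_def coords_def)
qed

lemma chart_coords_nz:
  assumes "s \<noteq> 0" "t \<noteq> 0"
  shows "coords S (\<lambda>i. if i = \<alpha> then 1 else if i = \<beta> then s else s * t) \<noteq> (\<lambda>_. 0)"
proof
  assume "coords S (\<lambda>i. if i = \<alpha> then 1 else if i = \<beta> then s else s * t) = (\<lambda>_. 0)"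
  hence "chart 1 s t (mon v0) = 0" unfolding chart_coords[OF assms] by simp
  thus False by simp
qed

lemma chart_mem_X:
  assumes "s \<noteq> 0" "t \<noteq> 0" "c \<noteq> 0"
  shows "pt (chart c s t) \<in> X"
  unfolding chart_coords[OF assms(1,2)]
  using coords_mem_X[OF chart_coords_nz[OF assms(1,2)]] assms by (subst pt_scale) auto

text \<open>A univariate polynomial that vanishes for all nonzero arguments is zero. Applied to
  \<open>s\<close> and then to \<open>t\<close>, this extends the equations over the axes.\<close>

lemma vanishing_chart:
  assumes F: "F \<in> vanishing S X"
  shows "ev (chart c s t) F = 0"
proof -
  have 1: "ev (chart c s t) F = 0" if "s \<noteq> 0" "t \<noteq> 0" for s t
    unfolding chart_coords[OF that] by (rule vanishing_X_coords[OF F chart_coords_nz[OF that]])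
  have 2: "ev (chart c s t) F = 0" if t: "t \<noteq> 0" for s t
  proof -
    define \<pi> where "\<pi> = (\<lambda>F. if F \<in> S then smult (c * t ^ e2 (expn F)) (monom 1 (e1 (expn F))) else 0)"
    have "(\<lambda>i. poly (\<pi> i) s) = chart c s t" for s
      by (auto simp: \<pi>_def chart_def poly_monom)
    hence p: "poly (curve \<pi> F) s = ev (chart c s t) F" for s by (simp add: poly_curve)
    hence "curve \<pi> F = 0" using 1[OF _ t] by (intro poly_eq_0_if_nonzero_roots) simp
    thus ?thesis using p[of s] by simp
  qed
  define \<pi> where "\<pi> = (\<lambda>F. if F \<in> S then smult (c * s ^ e1 (expn F)) (monom 1 (e2 (expn F))) else 0)"
  have "(\<lambda>i. poly (\<pi> i) t) = chart c s t" for t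
    by (auto simp: \<pi>_def chart_def poly_monom)
  hence p: "poly (curve \<pi> F) t = ev (chart c s t) F" for t by (simp add: poly_curve)
  hence "curve \<pi> F = 0" using 2 by (intro poly_eq_0_if_nonzero_roots) simp
  thus ?thesis using p[of t] by simp
qed

lemma tangent_curve:
  assumes "\<And>\<tau>. \<exists>c s t. (\<lambda>i. poly (\<pi> i) \<tau>) = chart c s t"
    and "\<And>F. F \<notin> S \<Longrightarrow> \<pi> F = 0"
  shows "(\<lambda>i. poly (pderiv (\<pi> i)) \<tau>) \<in> cone_tangent_space S X (\<lambda>i. poly (\<pi> i) \<tau>)"
  unfolding cone_tangent_space_def
proof (intro CollectI conjI allI impI ballI)
  fix F assume F: "F \<in> vanishing S X"
  then obtain n where n: "F \<in> forms S n" by (auto simp: vanishing_def)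
  have "poly (curve \<pi> F) \<tau> = 0" for \<tau>
    unfolding poly_curve using assms(1)[of \<tau>] vanishing_chart[OF F] by auto
  hence "curve \<pi> F = 0" by (intro poly_eq_0_if_nonzero_roots)
  thus "(\<Sum>i\<in>S. ev (\<lambda>i. poly (\<pi> i) \<tau>) (partial i F) * poly (pderiv (\<pi> i)) \<tau>) = 0"
    by (simp flip: poly_pderiv_curve[OF finite_S n])
qed (simp add: assms(2))

text \<open>The derivatives of \<open>chart\<close> with respect to its three parameters. Where an
  exponent is truncated, the numerical factor in front is 0.\<close>

definition Dc where "Dc s t = (\<lambda>F. if F \<in> S then s ^ e1 (expn F) * t ^ e2 (expn F) else 0)"
definition Ds where "Ds c s t = (\<lambda>F. if F \<in> S then c * t ^ e2 (expn F) * (of_nat (e1 (expn F)) * s ^ (e1 (expn F) - 1)) else 0)"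
definition Dt where "Dt c s t = (\<lambda>F. if F \<in> S then c * s ^ e1 (expn F) * (of_nat (e2 (expn F)) * t ^ (e2 (expn F) - 1)) else 0)"

lemma tangent_D:
  "Dc s t \<in> cone_tangent_space S X (chart c s t)"
  "Ds c s t \<in> cone_tangent_space S X (chart c s t)"
  "Dt c s t \<in> cone_tangent_space S X (chart c s t)"
proof -
  define \<pi> where "\<pi> = (\<lambda>F. if F \<in> S then smult (s ^ e1 (expn F) * t ^ e2 (expn F)) (monom 1 1) else 0)"
  have \<pi>: "(\<lambda>i. poly (\<pi> i) c) = chart c s t" for c
    by (auto simp: \<pi>_def chart_def poly_monom)
  have "(\<lambda>i. poly (pderiv (\<pi> i)) c) = Dc s t"
    by (auto simp: \<pi>_def Dc_def pderiv_smult pderiv_monom poly_monom)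
  thus "Dc s t \<in> cone_tangent_space S X (chart c s t)"
    using tangent_curve[of \<pi> c] unfolding \<pi> by (auto simp: \<pi>_def)
next
  define \<pi> where "\<pi> = (\<lambda>F. if F \<in> S then smult (c * t ^ e2 (expn F)) (monom 1 (e1 (expn F))) else 0)"
  have \<pi>: "(\<lambda>i. poly (\<pi> i) s) = chart c s t" for s
    by (auto simp: \<pi>_def chart_def poly_monom)
  have "(\<lambda>i. poly (pderiv (\<pi> i)) s) = Ds c s t"
    by (auto simp: \<pi>_def Ds_def pderiv_smult pderiv_monom poly_monom)
  thus "Ds c s t \<in> cone_tangent_space S X (chart c s t)"
    using tangent_curve[of \<pi> s] unfolding \<pi> by (auto simp: \<pi>_def)
next
  define \<pi> where "\<pi> = (\<lambda>F. if F \<in> S then smult (c * s ^ e1 (expn F)) (monom 1 (e2 (expn F))) else 0)"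
  have \<pi>: "(\<lambda>i. poly (\<pi> i) t) = chart c s t" for t
    by (auto simp: \<pi>_def chart_def poly_monom)
  have "(\<lambda>i. poly (pderiv (\<pi> i)) t) = Dt c s t"
    by (auto simp: \<pi>_def Dt_def pderiv_smult pderiv_monom poly_monom)
  thus "Dt c s t \<in> cone_tangent_space S X (chart c s t)"
    using tangent_curve[of \<pi> t] unfolding \<pi> by (auto simp: \<pi>_def)
qed

lemma D_v:
  "Dc s t (mon v0) = 1" "Ds c s t (mon v0) = 0" "Dt c s t (mon v0) = 0"
  "Ds c s t (mon v1) = c" "Dt c s t (mon v1) = 0" "Ds c s t (mon v2) = 0" "Dt c s t (mon v2) = c"
  by (simp_all add: Dc_def Ds_def Dt_def)

lemma binomial_vanishing:
  assumes "p1 \<in> Q" "p2 \<in> Q" "p3 \<in> Q" "p4 \<in> Q" "n + c = a + b"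
    and "\<And>i. n * lookup p1 i + c * lookup p4 i = a * lookup p2 i + b * lookup p3 i"
  shows "binomial p1 n p4 c p2 a p3 b \<in> vanishing S X"
  unfolding vanishing_def
  using binomial_forms[OF assms(1-5)] vanishing_XI[OF binomial_forms[OF assms(1-5)] binomial_coords[OF assms(1-4,6)]]
  by blast

text \<open>The upper bound for the tangent space: linearizing the relation of \<open>m\<close> with
  \<open>v0\<close>, \<open>v1\<close>, \<open>v2\<close> determines every component of a tangent
  vector from three of them.\<close>

lemma tangent_zero:
  assumes w: "w \<in> cone_tangent_space S X v" and v: "v (mon v0) \<noteq> 0"
    and z: "w (mon v0) = 0" "w (mon v1) = 0" "w (mon v2) = 0"
  shows "w = (\<lambda>_. 0)"
proof
  fix F
  show "w F = 0"
  proof (cases "F \<in> S")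
    case True
    then obtain m where m: "F = mon m" "m \<in> Q" by (auto simp: S_eq)
    show ?thesis
    proof (cases "m = v0")
      case False
      then obtain n where n: "e1 m + e2 m = Suc n" using e_eq_0[OF m(2)] by (cases "e1 m + e2 m") auto
      define B where "B = binomial m 1 v0 n v1 (e1 m) v2 (e2 m)"
      have B: "B \<in> vanishing S X"
        unfolding B_def using m n by (intro binomial_vanishing chart_relation) auto
      then obtain N where N: "B \<in> forms S N" by (auto simp: vanishing_def)
      \<comment> \<open>The line through \<open>v\<close> in the direction \<open>w\<close>; its
        derivative at 0 linearizes the relation.\<close>
      define \<pi> where "\<pi> = (\<lambda>i. [:v i, w i:])"
      have "0 = (\<Sum>i\<in>S. ev v (partial i B) * w i)"
        using w B by (auto simp: cone_tangent_space_def)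
      also have "\<dots> = poly (pderiv (curve \<pi> B)) 0"
        by (subst poly_pderiv_curve[OF finite_S N]) (simp add: \<pi>_def pderiv_pCons)
      also have "curve \<pi> B = [:v F, w F:] * [:v (mon v0):] ^ n - [:v (mon v1):] ^ e1 m * [:v (mon v2):] ^ e2 m"
        by (simp add: B_def binomial_def \<pi>_def z m)
      also have "\<dots> = smult (v (mon v0) ^ n) [:v F, w F:] - [:v (mon v1) ^ e1 m * v (mon v2) ^ e2 m:]"
      proof -
        have "[:x:] ^ n = [:x ^ n:]" for x :: 'k and n by (induction n) (auto simp: one_pCons)
        thus ?thesis by simp
      qed
      also have "poly (pderiv \<dots>) 0 = v (mon v0) ^ n * w F"
        by (simp add: pderiv_diff pderiv_smult pderiv_pCons)
      finally show ?thesis using v by simp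
    qed (use z m in simp)
  qed (use w in \<open>simp add: cone_tangent_space_def\<close>)
qed

lemma tangent_diff:
  assumes "w \<in> cone_tangent_space S X v" "w1 \<in> cone_tangent_space S X v"
    "w2 \<in> cone_tangent_space S X v" "w3 \<in> cone_tangent_space S X v"
  shows "(\<lambda>i. w i - (x * w1 i + y * w2 i + z * w3 i)) \<in> cone_tangent_space S X v"
  unfolding cone_tangent_space_def
proof (intro CollectI conjI allI impI ballI)
  fix F assume "F \<in> vanishing S X"
  hence "(\<Sum>i\<in>S. ev v (partial i F) * u i) = 0" if "u \<in> {w, w1, w2, w3}" for u
    using that assms by (auto simp: cone_tangent_space_def)
  note * = this
  have "(\<Sum>i\<in>S. ev v (partial i F) * (w i - (x * w1 i + y * w2 i + z * w3 i))) =
      (\<Sum>i\<in>S. ev v (partial i F) * w i) - (x * (\<Sum>i\<in>S. ev v (partial i F) * w1 i)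
        + y * (\<Sum>i\<in>S. ev v (partial i F) * w2 i) + z * (\<Sum>i\<in>S. ev v (partial i F) * w3 i))"
    by (simp add: sum_distrib_left sum_subtractf[symmetric] sum.distrib[symmetric] algebra_simps)
  thus "(\<Sum>i\<in>S. ev v (partial i F) * (w i - (x * w1 i + y * w2 i + z * w3 i))) = 0"
    by (simp add: *)
qed (use assms in \<open>simp add: cone_tangent_space_def\<close>)

lemma tangent_dim_chart:
  assumes c: "c \<noteq> 0"
  shows "vector_space.dim (\<lambda>c w i. c * w i) (cone_tangent_space S X (chart c s t)) = 3"
proof (rule fun_dim_3[OF tangent_D c D_v(1-5) D_v(6,7)])
  fix w assume w: "w \<in> cone_tangent_space S X (chart c s t)"
  \<comment> \<open>Solves the triangular system, so that the difference vanishes at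
    \<open>v0\<close>, \<open>v1\<close> and \<open>v2\<close>.\<close>
  define x where "x = w (mon v0)"
  define y where "y = (w (mon v1) - x * Dc s t (mon v1)) / c"
  define z where "z = (w (mon v2) - x * Dc s t (mon v2)) / c"
  have "(\<lambda>i. w i - (x * Dc s t i + y * Ds c s t i + z * Dt c s t i)) = (\<lambda>_. 0)"
    by (rule tangent_zero[OF tangent_diff[OF w tangent_D]])
       (use c in \<open>simp_all add: D_v x_def y_def z_def\<close>)
  hence "w = (\<lambda>i. x * Dc s t i + y * Ds c s t i + z * Dt c s t i)"
    by (simp add: fun_eq_iff)
  thus "\<exists>x y z. w = (\<lambda>i. x * Dc s t i + y * Ds c s t i + z * Dt c s t i)" by blast
qed

text \<open>The relations can be solved for every coordinate once the one at \<open>v0\<close> is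
  invertible.\<close>

lemma X_chart:
  assumes p: "p \<in> X" "v \<in> p" and nz: "v (mon v0) \<noteq> 0"
  shows "v = chart (v (mon v0)) (v (mon v1) / v (mon v0)) (v (mon v2) / v (mon v0))"
proof
  let ?c = "v (mon v0)"
  fix F
  show "v F = chart ?c (v (mon v1) / ?c) (v (mon v2) / ?c) F"
  proof (cases "F \<in> S")
    case True
    then obtain m where m: "F = mon m" "m \<in> Q" by (auto simp: S_eq)
    show ?thesis
    proof (cases "m = v0")
      case False
      then obtain n where n: "e1 m + e2 m = Suc n" using e_eq_0[OF m(2)] by (cases "e1 m + e2 m") auto
      have "v (mon m) ^ 1 * ?c ^ n = v (mon v1) ^ e1 m * v (mon v2) ^ e2 m"
        using m n p by (intro X_binomial[OF _ _ _ _ _ _ p] chart_relation) auto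
      hence eq: "v (mon m) = v (mon v1) ^ e1 m * v (mon v2) ^ e2 m / ?c ^ n"
        using nz by (simp add: field_simps)
      have "?c ^ e1 m * ?c ^ e2 m = ?c * ?c ^ n" using n by (simp flip: power_add)
      hence "?c * (v (mon v1) / ?c) ^ e1 m * (v (mon v2) / ?c) ^ e2 m =
          ?c * (v (mon v1) ^ e1 m * v (mon v2) ^ e2 m) / (?c * ?c ^ n)"
        by (simp add: power_divide)
      thus ?thesis using m nz by (simp add: chart_mon eq)
    qed (simp add: m)
  next
    case False
    thus ?thesis using pspaceE(3)[of p S v] p X_pspace by (auto simp: chart_def)
  qed
qed

lemma tangent_dim:
  assumes "p \<in> X" "v \<in> p" "v (mon v0) \<noteq> 0"
  shows "vector_space.dim (\<lambda>c w i. c * w i) (cone_tangent_space S X v) = 3"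
  using X_chart[OF assms] tangent_dim_chart[OF assms(3)] by metis

text \<open>Together with the corresponding relation on the edges, this shows that the charts at the six
  vertices cover the surface.\<close>

lemma interior_to_edge:
  assumes p: "p \<in> X" "v \<in> p" and m: "m \<in> Q" "0 < lookup m \<alpha>" "v (mon m) \<noteq> 0"
  shows "\<exists>i j. i + j = d \<and> 0 < i \<and> 0 < j \<and>
    (v (mon (single \<alpha> i + single \<beta> j)) \<noteq> 0 \<or> v (mon (single \<alpha> i + single \<gamma> j)) \<noteq> 0)"
proof -
  define i where "i = lookup m \<alpha>"
  define j where "j = d - i"
  have i: "i + j = d" "0 < i" "0 < j" using m(2) Q_less[OF m(1), of \<alpha>] by (auto simp: i_def j_def)
  have bg: "lookup m \<beta> + lookup m \<gamma> = j" using Q_mdeg[OF m(1)] by (simp add: mdeg_eq j_def i_def)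
  \<comment> \<open>\<open>m\<close> is a weighted mean of the two ends of its row of constant
    exponent at \<open>\<alpha>\<close>, and these ends lie on sides of the triangle.\<close>
  have "v (mon m) ^ j * v (mon m) ^ 0 = v (mon (single \<alpha> i + single \<beta> j)) ^ lookup m \<beta> *
      v (mon (single \<alpha> i + single \<gamma> j)) ^ lookup m \<gamma>"
  proof (rule X_binomial[OF _ _ _ _ _ _ p])
    fix x
    show "j * lookup m x + 0 * lookup m x = lookup m \<beta> * lookup (single \<alpha> i + single \<beta> j) x +
        lookup m \<gamma> * lookup (single \<alpha> i + single \<gamma> j) x"
    proof (rule all_vars[of _ x])
      have "j * i = lookup m \<beta> * i + lookup m \<gamma> * i" unfolding bg[symmetric] by (rule distrib_right)
      thus "j * lookup m \<alpha> + 0 * lookup m \<alpha> = lookup m \<beta> * lookup (single \<alpha> i + single \<beta> j) \<alpha> +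
        lookup m \<gamma> * lookup (single \<alpha> i + single \<gamma> j) \<alpha>"
        using distinct by (simp add: lookup_add lookup_single i_def)
    qed (use distinct in \<open>auto simp: lookup_add lookup_single\<close>)
  qed (use m i bg edge_in_Q edge_in_Q' in auto)
  hence "v (mon (single \<alpha> i + single \<beta> j)) ^ lookup m \<beta> * v (mon (single \<alpha> i + single \<gamma> j)) ^ lookup m \<gamma> \<noteq> 0"
    using m(3) by (metis mult_eq_0_iff power_not_zero)
  moreover have "lookup m \<beta> > 0 \<or> lookup m \<gamma> > 0" using bg i by auto
  ultimately have "v (mon (single \<alpha> i + single \<beta> j)) \<noteq> 0 \<or> v (mon (single \<alpha> i + single \<gamma> j)) \<noteq> 0"
    by (auto simp: power_0_left)
  thus ?thesis using i by blast
qed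

text \<open>On a side, (d - 2) m = (i - 1) a + (j - 1) b for its two vertices a and b; one of the
  weights is positive because d is at least 3.\<close>

lemma edge_to_vertex:
  assumes p: "p \<in> X" "v \<in> p" and i: "i + j = d" "0 < i" "0 < j"
    and nz: "v (mon (single \<alpha> i + single \<beta> j)) \<noteq> 0"
  shows "v (mon (single \<alpha> (d - 1) + single \<beta> 1)) \<noteq> 0 \<or> v (mon (single \<beta> (d - 1) + single \<alpha> 1)) \<noteq> 0"
proof -
  let ?m = "single \<alpha> i + single \<beta> j"
  let ?a = "single \<alpha> (d - 1) + single \<beta> 1" and ?b = "single \<alpha> 1 + single \<beta> (d - 1)"
  obtain i' j' where ij: "i = Suc i'" "j = Suc j'" using i by (cases i; cases j) auto
  have d: "d = Suc (Suc (i' + j'))" using i ij by auto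
  have "v (mon ?m) ^ (i' + j') * v (mon ?m) ^ 0 = v (mon ?a) ^ i' * v (mon ?b) ^ j'"
  proof (rule X_binomial[OF _ _ _ _ _ _ p])
    fix x
    show "(i' + j') * lookup ?m x + 0 * lookup ?m x = i' * lookup ?a x + j' * lookup ?b x"
      by (rule all_vars[of _ x])
         (use distinct in \<open>auto simp: lookup_add lookup_single d ij algebra_simps\<close>)
  qed (use i d3 in \<open>auto intro!: edge_in_Q\<close>)
  hence "v (mon ?a) ^ i' * v (mon ?b) ^ j' \<noteq> 0"
    using nz by (metis mult_eq_0_iff power_not_zero)
  moreover have "i' > 0 \<or> j' > 0" using i ij d3 by auto
  ultimately have "v (mon ?a) \<noteq> 0 \<or> v (mon ?b) \<noteq> 0" by (auto simp: power_0_left)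
  thus ?thesis by (simp add: add.commute)
qed

end

context hexagon
begin

lemma chartI:
  assumes "\<alpha> \<noteq> \<beta>" "\<alpha> \<noteq> \<gamma>" "\<beta> \<noteq> \<gamma>"
  shows "hexagon_chart d Q S \<alpha> \<beta> \<gamma>"
  by unfold_locales (use assms in auto)

lemma vertex_exists:
  assumes p: "p \<in> X" "v \<in> p"
  shows "\<exists>\<alpha> \<beta> \<gamma>. \<alpha> \<noteq> \<beta> \<and> \<alpha> \<noteq> \<gamma> \<and> \<beta> \<noteq> \<gamma> \<and> v (mon (single \<alpha> (d - 1) + single \<beta> 1)) \<noteq> 0"
proof -
  have v: "v \<noteq> (\<lambda>_. 0)" "\<And>F. F \<notin> S \<Longrightarrow> v F = 0"
    using pspaceE[of p S v] p X_pspace by auto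
  obtain F where F: "v F \<noteq> 0" using v(1) by auto
  hence "F \<in> S" using v(2) by blast
  then obtain m where m: "m \<in> Q" "v (mon m) \<noteq> 0" using F by (auto simp: S_eq)
  have "mdeg m \<noteq> 0" using Q_mdeg[OF m(1)] d3 by simp
  then obtain \<alpha> where \<alpha>: "lookup m \<alpha> > 0" by (auto simp: mdeg_var)
  obtain \<beta> \<gamma> where d: "\<alpha> \<noteq> \<beta>" "\<alpha> \<noteq> \<gamma>" "\<beta> \<noteq> \<gamma>"
    by (cases \<alpha>) (use var.distinct in \<open>metis\<close>)+
  have *: ?thesis if "i + j = d" "0 < i" "0 < j" "v (mon (single \<alpha> i + single \<beta> j)) \<noteq> 0"
    "\<alpha> \<noteq> \<beta>" "\<alpha> \<noteq> \<gamma>" "\<beta> \<noteq> \<gamma>" for i j \<beta> \<gamma>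
    using hexagon_chart.edge_to_vertex[OF chartI[OF that(5-7)] p that(1-4)] that(5-7) by metis
  obtain i j where ij: "i + j = d" "0 < i" "0 < j"
    "v (mon (single \<alpha> i + single \<beta> j)) \<noteq> 0 \<or> v (mon (single \<alpha> i + single \<gamma> j)) \<noteq> 0"
    using hexagon_chart.interior_to_edge[OF chartI[OF d] p m(1) \<alpha> m(2)] by blast
  from ij(4) show ?thesis
  proof
    assume "v (mon (single \<alpha> i + single \<beta> j)) \<noteq> 0"
    from *[OF ij(1-3) this d] show ?thesis .
  next
    assume "v (mon (single \<alpha> i + single \<gamma> j)) \<noteq> 0"
    from *[OF ij(1-3) this d(2,1) d(3)[symmetric]] show ?thesis .
  qed
qed

section \<open>Dimension of the surface\<close>

lemma alg_independent_2: "alg_independent_functions S X 2"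
proof -
  interpret hexagon_chart d Q S VX VY VZ by (rule chartI) auto
  define F :: "nat \<Rightarrow> ((var, 'k) mpoly, 'k) mpoly" where "F = (\<lambda>i. if i = 0 then Var (mon v1) else Var (mon v2))"
  define G :: "nat \<Rightarrow> ((var, 'k) mpoly, 'k) mpoly" where "G = (\<lambda>_. Var (mon v0))"
  have "F i \<in> forms S 1" "G i \<in> forms S 1" for i
    by (simp_all add: F_def G_def forms_Var[simplified])
  moreover have "G i \<notin> vanishing S X" for i
    using vanishing_chart[of "G i" 1 1 1] by (auto simp: G_def)
  moreover have "P = 0" if P: "\<forall>m\<in>keys P. keys m \<subseteq> {..<2}"
    and 0: "\<forall>p\<in>X. \<forall>v\<in>p. (\<forall>i<2. ev v (G i) \<noteq> 0) \<longrightarrow> ev (\<lambda>i. ev v (F i) / ev v (G i)) P = 0"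
    for P :: "(nat, 'k) mpoly"
  proof (rule ccontr)
    assume "P \<noteq> 0"
    then obtain x where x: "\<And>i. x i \<noteq> 0" "ev x P \<noteq> 0"
      using generic_point[of "{P}"] by auto
    \<comment> \<open>The chart parameters are the values of the two functions, so every pair of
      nonzero values is attained on \<open>X\<close>.\<close>
    let ?v = "chart 1 (x 0) (x 1)"
    have mem: "pt ?v \<in> X" by (rule chart_mem_X) (use x in auto)
    have "\<forall>i<2. ev ?v (G i) \<noteq> 0" by (simp add: G_def)
    hence "ev (\<lambda>i. ev ?v (F i) / ev ?v (G i)) P = 0"
      using bspec[OF bspec[OF 0 mem] pt_self] by blast
    moreover have "ev (\<lambda>i. ev ?v (F i) / ev ?v (G i)) P = ev x P"
    proof (rule ev_cong)
      fix m i assume "m \<in> keys P" "i \<in> keys m"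
      hence "i < 2" using P by auto
      thus "ev ?v (F i) / ev ?v (G i) = x i" by (cases i) (auto simp: F_def G_def less_Suc_eq)
    qed
    ultimately show False using x(2) by simp
  qed
  ultimately show ?thesis
    unfolding alg_independent_functions_def
    by (intro exI[of _ F] exI[of _ G] exI[of _ "\<lambda>_. 1"]) blast
qed

lemma card_mdeg_le: "card {m :: var \<Rightarrow>\<^sub>0 nat. mdeg m = n} \<le> (n + 1) ^ 2"
proof -
  have "{m :: var \<Rightarrow>\<^sub>0 nat. mdeg m = n} \<subseteq> (\<lambda>(i, j). expvec i j (n - i - j)) ` ({..n} \<times> {..n})"
  proof
    fix m :: "var \<Rightarrow>\<^sub>0 nat" assume "m \<in> {m. mdeg m = n}"
    thus "m \<in> (\<lambda>(i, j). expvec i j (n - i - j)) ` ({..n} \<times> {..n})"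
      by (intro image_eqI[of _ _ "(lookup m VX, lookup m VY)"])
         (auto simp: mdeg_var intro!: var_poly_mapping_eqI)
  qed
  from surj_card_le[OF _ this] show ?thesis by (simp add: power2_eq_square)
qed

text \<open>Three quotients of forms pulled back to the plane satisfy a polynomial relation, because
  there are \<open>(n + 1)\<^sup>3\<close> monomials with exponents at most \<open>n\<close> in three unknowns, while the forms
  obtained from them by clearing denominators lie in a space of dimension \<open>O(n\<^sup>2)\<close>.\<close>

lemma not_alg_independent_3:
  assumes n: "n \<ge> 3"
  shows "\<not> alg_independent_functions S X n"
proof
  assume "alg_independent_functions S X n"
  then obtain F G r where
    FG: "\<And>i. i < n \<Longrightarrow> F i \<in> forms S (r i) \<and> G i \<in> forms S (r i)"
    and indep: "\<And>P :: (nat, 'k) mpoly. (\<forall>m\<in>keys P. keys m \<subseteq> {..<n}) \<Longrightarrow>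
        (\<forall>p\<in>X. \<forall>v\<in>p. (\<forall>i<n. ev v (G i) \<noteq> 0) \<longrightarrow>
           ev (\<lambda>i. ev v (F i) / ev v (G i)) P = 0) \<Longrightarrow> P = 0"
    unfolding alg_independent_functions_def by blast
  \<comment> \<open>Only the first three functions matter. \<open>E\<close> is the degree of the
    product of their denominators after pulling back to the plane, and N = (E + 1)^2 makes (N E +
    1)^2 smaller than (N + 1)^3.\<close>
  define R where "R = r 0 + r 1 + r 2"
  define E where "E = R * d"
  define N where "N = (E + 1) ^ 2"
  define A where "A = {..N} \<times> {..N} \<times> {..N}"
  \<comment> \<open>The monomial with exponents a, b, c in the three quotients, times the N-th power
    of the product of the denominators.\<close>
  define H where "H = (\<lambda>(a, b, c).
    (F 0 ^ a * G 0 ^ (N - a)) * (F 1 ^ b * G 1 ^ (N - b)) * (F 2 ^ c * G 2 ^ (N - c)))"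
  define t :: "(var, 'k) mpoly set" where "t = mon ` {m. mdeg m = N * E}"
  have H_forms: "H x \<in> forms S (N * R)" if xA: "x \<in> A" for x
  proof -
    obtain a b c where x: "x = (a, b, c)" "a \<le> N" "b \<le> N" "c \<le> N" using xA by (auto simp: A_def)
    have *: "F i ^ a * G i ^ (N - a) \<in> forms S (r i * N)" if "i < 3" "a \<le> N" for i a
    proof -
      have "F i ^ a * G i ^ (N - a) \<in> forms S (r i * a + r i * (N - a))"
        using that(1) FG[of i] assms by (intro forms_mult forms_power) auto
      thus ?thesis using that(2) by (simp flip: distrib_left)
    qed
    have "H x \<in> forms S (r 0 * N + r 1 * N + r 2 * N)"
      unfolding H_def x(1) prod.case using x by (intro forms_mult *) auto
    thus ?thesis by (simp add: R_def algebra_simps)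
  qed
  have "finite A" by (simp add: A_def)
  moreover have "finite t" by (simp add: t_def finite_mdeg_var)
  moreover have "card t < card A"
  proof -
    have "card t \<le> (N * E + 1) ^ 2"
      using card_mdeg_le[of "N * E"] by (simp add: t_def card_image[OF inj_mon])
    also have "\<dots> \<le> ((N + 1) * (E + 1)) ^ 2" by (intro power_mono) (auto simp: algebra_simps)
    also have "\<dots> = (N + 1) ^ 2 * N" unfolding power_mult_distrib by (simp only: N_def)
    also have "\<dots> < (N + 1) ^ 2 * (N + 1)" by simp
    also have "\<dots> = card A" by (simp add: A_def power2_eq_square)
    finally show ?thesis .
  qed
  \<comment> \<open>The coordinates are indexed by the monomials themselves, so substituting each
    index for its coordinate is the pull-back to the plane.\<close>
  moreover have "(\<lambda>x. subst (\<lambda>F. F) (H x)) ` A \<subseteq> mp.span t"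
  proof (intro image_subsetI)
    fix x assume "x \<in> A"
    hence "subst (\<lambda>F. F) (H x) \<in> forms UNIV (N * R * d)"
      using S_forms by (intro forms_subst[OF H_forms]) auto
    from forms_span_mon[OF this] show "subst (\<lambda>F. F) (H x) \<in> mp.span t"
      by (simp add: t_def E_def mult.assoc)
  qed
  ultimately obtain c where c: "\<exists>a\<in>A. c a \<noteq> 0" "(\<Sum>a\<in>A. Const (c a) * subst (\<lambda>F. F) (H a)) = 0"
    by (rule linear_relation_exists)
  define K where "K = (\<Sum>a\<in>A. Const (c a) * H a)"
  have K_forms: "K \<in> forms S (N * R)"
    unfolding K_def by (intro forms_sum forms_Const_times H_forms)
  have "ev (coords S w) K = 0" for w
  proof -
    have "ev (coords S w) K = ev (\<lambda>F. ev w F) K"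
      by (rule ev_forms_cong[OF K_forms]) (simp add: coords_def)
    also have "\<dots> = ev w (subst (\<lambda>F. F) K)" by (simp add: ev_subst)
    also have "subst (\<lambda>F. F) K = 0" using c(2) by (simp add: K_def subst_sum)
    finally show ?thesis by simp
  qed
  note K_X = vanishing_XI[OF K_forms this]
  define \<epsilon> :: "nat \<times> nat \<times> nat \<Rightarrow> nat \<Rightarrow>\<^sub>0 nat" where
    "\<epsilon> = (\<lambda>(a, b, c). single 0 a + single 1 b + single 2 c)"
  have lookup_\<epsilon>: "lookup (\<epsilon> (a, b, c)) 0 = a" "lookup (\<epsilon> (a, b, c)) 1 = b" "lookup (\<epsilon> (a, b, c)) 2 = c" for a b c
    by (simp_all add: \<epsilon>_def lookup_add lookup_single)
  have \<epsilon>_inj: "\<epsilon> x = \<epsilon> y \<longleftrightarrow> x = y" for x y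
    by (cases x; cases y) (metis lookup_\<epsilon>)
  define P :: "(nat, 'k) mpoly" where "P = (\<Sum>a\<in>A. single (\<epsilon> a) (c a))"
  have "lookup P (\<epsilon> a) = c a" if "a \<in> A" for a
    using that \<open>finite A\<close> by (simp add: P_def lookup_sum lookup_single when_def \<epsilon>_inj)
  hence "P \<noteq> 0" using c(1) by auto
  moreover have "P = 0"
  proof (rule indep)
    have "keys P \<subseteq> \<epsilon> ` A"
      unfolding P_def by (rule order.trans[OF keys_sum]) auto
    moreover have "keys (\<epsilon> a) \<subseteq> {..<3}" for a
      by (cases a) (auto simp: \<epsilon>_def keys_add_nat split: if_splits)
    ultimately show "\<forall>m\<in>keys P. keys m \<subseteq> {..<n}" using assms by fastforce
    show "\<forall>p\<in>X. \<forall>v\<in>p. (\<forall>i<n. ev v (G i) \<noteq> 0) \<longrightarrow> ev (\<lambda>i. ev v (F i) / ev v (G i)) P = 0"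
    proof (intro ballI impI)
      fix p v assume pv: "p \<in> X" "v \<in> p" and nz: "\<forall>i<n. ev v (G i) \<noteq> 0"
      define x where "x = (\<lambda>i. ev v (F i) / ev v (G i))"
      have x: "x i ^ a * ev v (G i) ^ N = ev v (F i) ^ a * ev v (G i) ^ (N - a)" if "i < 3" "a \<le> N" for i a
      proof -
        have "ev v (G i) ^ N = ev v (G i) ^ a * ev v (G i) ^ (N - a)"
          using that(2) by (simp flip: power_add)
        moreover have "ev v (G i) \<noteq> 0" using nz that(1) assms by auto
        ultimately show ?thesis by (simp add: x_def power_divide)
      qed
      have eq: "mval x (\<epsilon> a) * (ev v (G 0) ^ N * ev v (G 1) ^ N * ev v (G 2) ^ N) = ev v (H a)" if "a \<in> A" for a
      proof (cases a)
        case (fields a1 a2 a3)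
        hence "a1 \<le> N" "a2 \<le> N" "a3 \<le> N" using that by (auto simp: A_def)
        hence "(x 0 ^ a1 * ev v (G 0) ^ N) * (x 1 ^ a2 * ev v (G 1) ^ N) * (x 2 ^ a3 * ev v (G 2) ^ N) = ev v (H a)"
          by (simp add: x H_def fields)
        thus ?thesis by (simp add: \<epsilon>_def fields mval_add mult_ac)
      qed
      have "ev x P * (ev v (G 0) ^ N * ev v (G 1) ^ N * ev v (G 2) ^ N) = (\<Sum>a\<in>A. c a * ev v (H a))"
        unfolding P_def ev_sum ev_single sum_distrib_right 
        by (intro sum.cong refl) (subst mult.assoc, simp only: eq)
      also have "\<dots> = ev v K" by (simp add: K_def ev_sum)
      also have "\<dots> = 0" by (rule K_X[OF pv])
      finally have "ev x P = 0" using nz assms by simp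
      thus "ev (\<lambda>i. ev v (F i) / ev v (G i)) P = 0" by (simp add: x_def)
    qed
  qed
  ultimately show False by simp
qed

lemma proj_dim_X: "proj_dim S X = 2"
  unfolding proj_dim_def
proof (rule Greatest_equality)
  fix n assume "alg_independent_functions S X n"
  thus "n \<le> 2" using not_alg_independent_3[of n] by linarith
qed (rule alg_independent_2)

lemma smooth_X: "smooth_variety S X"
  unfolding smooth_variety_def
proof (intro ballI)
  fix p v assume p: "p \<in> X" "v \<in> p"
  then obtain \<alpha> \<beta> \<gamma> where *: "\<alpha> \<noteq> \<beta>" "\<alpha> \<noteq> \<gamma>" "\<beta> \<noteq> \<gamma>"
      "v (mon (single \<alpha> (d - 1) + single \<beta> 1)) \<noteq> 0"
    using vertex_exists by blast
  interpret hexagon_chart d Q S \<alpha> \<beta> \<gamma> by (rule chartI[OF *(1-3)])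
  show "vector_space.dim (\<lambda>c w i. c * w i) (cone_tangent_space S X v) = proj_dim S X + 1"
    using tangent_dim[OF p] *(4) by (simp add: v0_def proj_dim_X)
qed

end

context prime_GT
begin

text \<open>The pure powers are invariant, so the corners are missing from the inverse system; by
  \<open>M_boundary\<close> no other boundary monomial is invariant.\<close>

lemma smooth_I: "smooth_system d I"
proof -
  define Q where "Q = {m :: var \<Rightarrow>\<^sub>0 nat. mdeg m = d \<and> m \<notin> M}"
  define S :: "(var, 'k) mpoly set" where "S = mon ` Q"
  interpret hexagon d Q S
  proof unfold_locales
    show "d \<ge> 3" using d5 by simp
    show "lookup m i < d" if "m \<in> Q" for m i
    proof (rule ccontr)
      assume "\<not> lookup m i < d"
      moreover have "m = single i (lookup m i) + (m - single i (lookup m i))"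
        by (rule poly_mapping_eqI) (auto simp: lookup_add lookup_minus lookup_single when_def)
      hence "mdeg m = lookup m i + mdeg (m - single i (lookup m i))"
        by (metis mdeg_add mdeg_single)
      ultimately have "lookup m i = d" "m - single i (lookup m i) = 0"
        using that by (auto simp: Q_def simp flip: mdeg_eq_0_iff)
      hence "m = single i d"
        using \<open>m = single i (lookup m i) + (m - single i (lookup m i))\<close> by simp
      thus False using that pure_M by (auto simp: Q_def)
    qed
    show "m \<in> Q" if "mdeg m = d" "lookup m i = 0" "\<And>j. lookup m j < d" for m i
    proof (rule ccontr)
      assume "m \<notin> Q"
      hence "m \<in> M" using that(1) by (simp add: Q_def)
      from M_boundary[OF this that(2)] obtain j where "m = single j d" by blast
      thus False using that(3)[of j] by simp
    qed
  qed (auto simp: Q_def S_def)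
  have "{mon m :: (var, 'k) mpoly | m. mdeg m = d \<and> mon m \<notin> I} = S"
    using mon_mem_ideal_gen_mon_iff[of M d] M_mdeg by (auto simp: S_def Q_def)
  thus ?thesis unfolding smooth_system_def using smooth_X by (simp add: X_def)
qed

end

section \<open>The Galois covering\<close>

subsection \<open>Finiteness\<close>

text \<open>The representative is chosen by \<open>SOME\<close>, which homogeneity makes harmless;
  the restriction is there because \<open>coord_ring\<close> consists of extensional
  functions.\<close>

definition quot_fun :: "('i, 'k::field) point set \<Rightarrow> ('i, 'k) mpoly \<Rightarrow> ('i, 'k) mpoly \<Rightarrow> nat \<Rightarrow> ('i, 'k) point \<Rightarrow> 'k" where
  "quot_fun X H A m = (\<lambda>p\<in>basic_open X H. ev (SOME v. v \<in> p) A / ev (SOME v. v \<in> p) H ^ m)"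

lemma quot_fun_eq:
  assumes X: "X \<subseteq> pspace T" and A: "A \<in> forms T' (m * n)" and H: "H \<in> forms T' n"
    and p: "p \<in> basic_open X H" "v \<in> p"
  shows "quot_fun X H A m p = ev v A / ev v H ^ m"
proof -
  have pv: "p = pt v" using pspaceE(1)[of p T v] p X by (auto simp: basic_open_def)
  obtain c where c: "c \<noteq> 0" "(SOME w. w \<in> pt v) = (\<lambda>i. c * v i)" by (rule some_pt)
  have "quot_fun X H A m p = ev (\<lambda>i. c * v i) A / ev (\<lambda>i. c * v i) H ^ m"
    using p(1) c(2) by (simp add: quot_fun_def pv)
  also have "\<dots> = (c ^ (m * n) * ev v A) / (c ^ n * ev v H) ^ m"
    by (simp only: ev_forms_scale[OF A] ev_forms_scale[OF H])
  also have "\<dots> = ev v A / ev v H ^ m"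
    using c(1) by (simp add: power_mult_distrib mult.commute[of m] power_mult)
  finally show ?thesis .
qed

lemma quot_fun_coord_ring:
  assumes "X \<subseteq> pspace T" "A \<in> forms T (m * n)" "H \<in> forms T n"
  shows "quot_fun X H A m \<in> coord_ring T X n H"
  unfolding coord_ring_def
  using assms quot_fun_eq[OF assms] by (auto simp: quot_fun_def)

context prime_GT
begin

definition B :: "(var, 'k) mpoly set" where "B = mon ` M"

lemma B_forms: "B \<subseteq> forms UNIV d"
  by (auto simp: B_def intro!: forms_mon M_mdeg)

lemma finite_B [simp]: "finite B" by (simp add: B_def)

lemma pure_B [simp]: "mon (single i d) \<in> B"
  by (simp add: B_def pure_M)

lemma coords_pure [simp]: "coords B v (mon (single i d)) = v i ^ d"
  by (simp add: coords_def ev_mon)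

lemma coords_nz:
  assumes "v \<noteq> (\<lambda>_. 0)"
  shows "coords B v \<noteq> (\<lambda>_. 0)"
proof
  assume 0: "coords B v = (\<lambda>_. 0)"
  have "v i = 0" for i
    using fun_cong[OF 0, of "mon (single i d)"] d_pos by simp
  thus False using assms by auto
qed

lemma map_pt: "proj_map B (pt v) = pt (coords B v)"
  by (rule proj_map_pt[OF B_forms])

lemma plane_cases:
  assumes "p \<in> pspace UNIV"
  obtains v :: "var \<Rightarrow> 'k" where "p = pt v" "v \<noteq> (\<lambda>_. 0)"
  using assms by (auto simp: pspace_def)

lemma map_pspace:
  assumes "p \<in> pspace UNIV"
  shows "proj_map B p \<in> pspace B"
proof -
  obtain v where "p = pt v" "v \<noteq> (\<lambda>_. 0)" using assms by (rule plane_cases)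
  thus ?thesis using coords_nz by (auto simp: map_pt coords_def intro!: pspaceI)
qed

lemma regular_map_B: "regular_map UNIV B (proj_map B)"
  unfolding regular_map_def
proof (intro ballI conjI map_pspace)
  fix p :: "(var, 'k) point" assume "p \<in> pspace UNIV"
  then obtain v where v: "p = pt v" "v \<noteq> (\<lambda>_. 0)" by (rule plane_cases)
  have "\<exists>j\<in>B. ev v j \<noteq> 0" using coords_nz[OF v(2)] by (auto simp: coords_def fun_eq_iff split: if_splits)
  moreover have "proj_map B q = pt (\<lambda>j. if j \<in> B then ev w j else 0)"
    if "q \<in> pspace UNIV" "w \<in> q" for q w
    using pspaceE(1)[OF that] map_pt[of w] by (simp add: coords_def)
  ultimately show "\<exists>n A. (\<forall>j\<in>B. A j \<in> forms UNIV n) \<and> (\<exists>v\<in>p. \<exists>j\<in>B. ev v (A j) \<noteq> 0) \<and>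
     (\<forall>q\<in>pspace UNIV. \<forall>w\<in>q. (\<exists>j\<in>B. ev w (A j) \<noteq> 0) \<longrightarrow>
        proj_map B q = pt (\<lambda>j. if j \<in> B then ev w (A j) else 0))"
    using B_forms pt_self[of v] v(1) by (intro exI[of _ d] exI[of _ "\<lambda>j. j"]) blast
qed

text \<open>Division of the exponents by \<open>d\<close> with remainder: the quotient part is a
  monomial in the d-th powers of the variables, which are coordinates of the map, and only finitely
  many remainders occur.\<close>

definition quo :: "(var \<Rightarrow>\<^sub>0 nat) \<Rightarrow> var \<Rightarrow>\<^sub>0 nat" where
  "quo m = expvec (lookup m VX div d) (lookup m VY div d) (lookup m VZ div d)"

definition rmd :: "(var \<Rightarrow>\<^sub>0 nat) \<Rightarrow> var \<Rightarrow>\<^sub>0 nat" where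
  "rmd m = expvec (lookup m VX mod d) (lookup m VY mod d) (lookup m VZ mod d)"

lemma mdeg_quo_rmd: "mdeg m = d * mdeg (quo m) + mdeg (rmd m)"
  by (simp add: quo_def rmd_def mdeg_var distrib_left)

lemma mval_quo_rmd:
  fixes v :: "var \<Rightarrow> 'k"
  shows "mval v m = mval (\<lambda>i. v i ^ d) (quo m) * mval v (rmd m)"
proof -
  have "x ^ n = (x ^ d) ^ (n div d) * x ^ (n mod d)" for x :: 'k and n
    by (simp flip: power_mult power_add)
  from this[of "v VX" "lookup m VX"] this[of "v VY" "lookup m VY"] this[of "v VZ" "lookup m VZ"]
  show ?thesis by (simp add: quo_def rmd_def mval_var mult_ac)
qed

lemma finite_range_rmd: "finite (range rmd)"
proof -
  have "range rmd \<subseteq> (\<lambda>(i, j, l). expvec i j l) ` ({..<d} \<times> {..<d} \<times> {..<d})"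
  proof (intro image_subsetI)
    fix m
    show "rmd m \<in> (\<lambda>(i, j, l). expvec i j l) ` ({..<d} \<times> {..<d} \<times> {..<d})"
      using d_pos
      by (intro image_eqI[of _ _ "(lookup m VX mod d, lookup m VY mod d, lookup m VZ mod d)"])
         (auto simp: rmd_def)
  qed
  thus ?thesis by (rule finite_subset) auto
qed

text \<open>The open sets are given by x_i^d on the target and x_i on the source, which have the
  same nonvanishing locus. The remainder monomials, divided by the fitting powers of x_i, generate
  the coordinate ring as a module.\<close>

lemma finite_map_B: "finite_map UNIV B (proj_map B ` pspace UNIV) (proj_map B)"
  unfolding finite_map_def
proof
  let ?X = "proj_map B ` pspace UNIV :: ((var, 'k) mpoly, 'k) point set"
  have X: "?X \<subseteq> pspace B" using map_pspace by auto
  fix y assume "y \<in> ?X"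
  then obtain p0 where p0: "p0 \<in> pspace UNIV" "y = proj_map B p0" by (rule imageE)
  from p0(1) obtain v where "p0 = pt v" "v \<noteq> (\<lambda>_. 0)" by (rule plane_cases)
  hence v: "y = pt (coords B v)" "v \<noteq> (\<lambda>_. 0)" using p0(2) map_pt by auto
  then obtain i where i: "v i \<noteq> 0" by auto
  define H :: "((var, 'k) mpoly, 'k) mpoly" where "H = Var (mon (single i d))"
  define H' :: "(var, 'k) mpoly" where "H' = Var i"
  have H: "H \<in> forms B 1" and H': "H' \<in> forms UNIV 1"
    by (auto simp only: H_def H'_def intro!: forms_Var pure_B UNIV_I)
  have open_iff: "pt (coords B w) \<in> basic_open ?X H \<longleftrightarrow> w i \<noteq> 0" if "w \<noteq> (\<lambda>_. 0)" for w
  proof -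
    have "pt (coords B w) \<in> ?X"
      by (rule image_eqI[of _ _ "pt w"]) (use that in \<open>auto simp: map_pt intro!: pspaceI\<close>)
    moreover have "(\<forall>u\<in>pt (coords B w). ev u H \<noteq> 0) \<longleftrightarrow> w i \<noteq> 0"
    proof
      assume "\<forall>u\<in>pt (coords B w). ev u H \<noteq> 0"
      from bspec[OF this pt_self] show "w i \<noteq> 0" using d_pos by (auto simp: H_def)
    qed (auto simp: mem_pt_iff H_def)
    ultimately show ?thesis by (simp add: basic_open_def)
  qed
  have open'_iff: "pt w \<in> basic_open (pspace UNIV) H' \<longleftrightarrow> w i \<noteq> 0" if "w \<noteq> (\<lambda>_. 0)" for w :: "var \<Rightarrow> 'k"
  proof -
    have "(\<forall>u\<in>pt w. ev u H' \<noteq> 0) \<longleftrightarrow> w i \<noteq> 0"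
    proof
      assume "\<forall>u\<in>pt w. ev u H' \<noteq> 0"
      from bspec[OF this pt_self] show "w i \<noteq> 0" by (simp add: H'_def)
    qed (auto simp: mem_pt_iff H'_def)
    thus ?thesis using that by (auto simp: basic_open_def intro!: pspaceI)
  qed
  have preimage: "{p \<in> pspace UNIV. proj_map B p \<in> basic_open ?X H} = basic_open (pspace UNIV) H'"
  proof (intro equalityI subsetI)
    fix p assume "p \<in> {p \<in> pspace UNIV. proj_map B p \<in> basic_open ?X H}"
    moreover from this obtain w where "p = pt w" "w \<noteq> (\<lambda>_. 0)" using plane_cases by auto
    ultimately show "p \<in> basic_open (pspace UNIV) H'" by (simp add: map_pt open_iff open'_iff)
  next
    fix p assume p: "p \<in> basic_open (pspace UNIV) H'"
    hence "p \<in> pspace UNIV" by (simp add: basic_open_def)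
    moreover from this obtain w where "p = pt w" "w \<noteq> (\<lambda>_. 0)" by (rule plane_cases)
    ultimately show "p \<in> {p \<in> pspace UNIV. proj_map B p \<in> basic_open ?X H}"
      using p by (simp add: map_pt open_iff open'_iff)
  qed
  define b where "b = (\<lambda>r. quot_fun (pspace UNIV) H' (mon r) (mdeg r))"
  have b_ring: "b r \<in> coord_ring UNIV (pspace UNIV) 1 H'" for r
    unfolding b_def by (rule quot_fun_coord_ring[OF order.refl _ H']) (auto intro: forms_mon)
  have "\<exists>c. (\<forall>b'\<in>b ` range rmd. c b' \<in> coord_ring B ?X 1 H) \<and>
      (\<forall>p\<in>basic_open (pspace UNIV) H'. g p = (\<Sum>b'\<in>b ` range rmd. c b' (proj_map B p) * b' p))"
    if g: "g \<in> coord_ring UNIV (pspace UNIV) 1 H'" for g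
  proof -
    obtain n A where A: "A \<in> forms UNIV n"
      "\<And>p v. p \<in> basic_open (pspace UNIV) H' \<Longrightarrow> v \<in> p \<Longrightarrow> g p = ev v A / ev v H' ^ n"
      using g by (auto simp: coord_ring_def)
    \<comment> \<open>The quotient part of a term of \<open>A\<close>, written in the target
      coordinates and raised to degree \<open>n\<close> by powers of \<open>H\<close>.\<close>
    define tm where "tm = (\<lambda>m. Const (lookup A m) *
      (mval (\<lambda>j. Var (mon (single j d))) (quo m) * H ^ (n - mdeg (quo m))))"
    define C where "C = (\<lambda>r. \<Sum>m | m \<in> keys A \<and> rmd m = r. tm m)"
    \<comment> \<open>Coefficients are attached to functions, and different remainders may give the
      same function, for instance when they differ by a factor x_i; hence their contributions are
      added.\<close>
    define D where "D = (\<lambda>b'. \<Sum>r | r \<in> range rmd \<and> b r = b'. C r)"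
    have degA: "mdeg m = n" if "m \<in> keys A" for m using that A(1) by (auto simp: forms_def)
    have deg_quo: "mdeg (quo m) \<le> n" if "m \<in> keys A" for m
    proof -
      have "1 * mdeg (quo m) \<le> d * mdeg (quo m)" using d_pos by (intro mult_le_mono1) simp
      thus ?thesis using mdeg_quo_rmd[of m] degA[OF that] by linarith
    qed
    have "tm m \<in> forms B (n * 1)" if "m \<in> keys A" for m
    proof -
      have "mval (\<lambda>j. Var (mon (single j d))) (quo m) * H ^ (n - mdeg (quo m)) \<in>
          forms B (mdeg (quo m) * 1 + 1 * (n - mdeg (quo m)))"
        by (intro forms_mult forms_mval forms_power H forms_Var pure_B)
      thus ?thesis using deg_quo[OF that] by (simp add: tm_def forms_Const_times)
    qed
    hence D_forms: "D b' \<in> forms B (n * 1)" for b'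
      unfolding D_def C_def by (intro forms_sum) auto
    define c where "c = (\<lambda>b'. quot_fun ?X H (D b') n)"
    have "c b' \<in> coord_ring B ?X 1 H" for b'
      unfolding c_def by (rule quot_fun_coord_ring[OF X D_forms H])
    moreover have "g p = (\<Sum>b'\<in>b ` range rmd. c b' (proj_map B p) * b' p)"
      if p: "p \<in> basic_open (pspace UNIV) H'" for p
    proof -
      have pU: "p \<in> pspace UNIV" using p by (simp add: basic_open_def)
      then obtain w where w: "p = pt w" "w \<noteq> (\<lambda>_. 0)" by (rule plane_cases)
      have wi: "w i \<noteq> 0" using p open'_iff w by simp
      let ?u = "coords B w"
      have fp: "proj_map B p \<in> basic_open ?X H" using preimage p by auto
      have c_p: "c b' (proj_map B p) = ev ?u (D b') / ev ?u H ^ n" for b'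
        unfolding c_def by (rule quot_fun_eq[OF X D_forms H fp]) (simp add: w map_pt pt_self)
      have b_p: "b r p = mval w r / w i ^ mdeg r" for r
        unfolding b_def
        using quot_fun_eq[OF order.refl _ H' p, of "mon r" "mdeg r" w] w(1) pt_self[of w]
        by (simp add: forms_mon ev_mon H'_def)
      have uH: "ev ?u H = w i ^ d" by (simp add: H_def)
      have tm_p: "ev ?u (tm m) / ev ?u H ^ n * b (rmd m) p = lookup A m * mval w m / w i ^ n"
        if m: "m \<in> keys A" for m
      proof -
        have "ev ?u (tm m) = lookup A m * (mval (\<lambda>j. w j ^ d) (quo m) * (w i ^ d) ^ (n - mdeg (quo m)))"
          by (simp add: tm_def ev_mval uH)
        moreover have "(w i ^ d) ^ n = (w i ^ d) ^ (n - mdeg (quo m)) * (w i ^ d) ^ mdeg (quo m)"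
          using deg_quo[OF m] by (simp flip: power_add)
        moreover have "w i ^ n = (w i ^ d) ^ mdeg (quo m) * w i ^ mdeg (rmd m)"
          using mdeg_quo_rmd[of m] degA[OF m] by (simp flip: power_mult power_add)
        ultimately show ?thesis
          using wi by (simp add: b_p uH mval_quo_rmd[of w m])
      qed
      have "(\<Sum>b'\<in>b ` range rmd. c b' (proj_map B p) * b' p) =
          (\<Sum>b'\<in>b ` range rmd. \<Sum>r | r \<in> range rmd \<and> b r = b'. ev ?u (C r) / ev ?u H ^ n * b r p)"
        unfolding c_p D_def ev_sum sum_divide_distrib sum_distrib_right by (intro sum.cong refl) auto
      also have "\<dots> = (\<Sum>r\<in>range rmd. ev ?u (C r) / ev ?u H ^ n * b r p)"
        by (rule sum.image_gen[OF finite_range_rmd, symmetric])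
      also have "\<dots> = (\<Sum>r\<in>range rmd. \<Sum>m | m \<in> keys A \<and> rmd m = r. ev ?u (tm m) / ev ?u H ^ n * b (rmd m) p)"
        unfolding C_def ev_sum sum_divide_distrib sum_distrib_right by (intro sum.cong refl) auto
      also have "\<dots> = (\<Sum>m\<in>keys A. ev ?u (tm m) / ev ?u H ^ n * b (rmd m) p)"
        by (rule sum.group[OF finite_keys finite_range_rmd]) auto
      also have "\<dots> = (\<Sum>m\<in>keys A. lookup A m * mval w m / w i ^ n)"
        by (intro sum.cong refl tm_p)
      also have "\<dots> = ev w A / w i ^ n"
        by (simp add: ev_def poly_hom_alt sum_divide_distrib)
      also have "\<dots> = g p" using A(2)[OF p, of w] pt_self[of w] w(1) by (simp add: H'_def)
      finally show ?thesis by (rule sym)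
    qed
    ultimately show ?thesis by blast
  qed
  hence "\<exists>B'. finite B' \<and> B' \<subseteq> coord_ring UNIV (pspace UNIV) 1 H' \<and>
        (\<forall>g\<in>coord_ring UNIV (pspace UNIV) 1 H'. \<exists>c.
           (\<forall>b\<in>B'. c b \<in> coord_ring B ?X 1 H) \<and>
           (\<forall>p\<in>basic_open (pspace UNIV) H'. g p = (\<Sum>b\<in>B'. c b (proj_map B p) * b p)))"
    using b_ring finite_range_rmd by (intro exI[of _ "b ` range rmd"]) blast
  moreover have "y \<in> basic_open ?X H" using v i open_iff by simp
  ultimately show "\<exists>e H e' H'.
     e > 0 \<and> H \<in> forms B e \<and> e' > 0 \<and> H' \<in> forms UNIV e' \<and>
     y \<in> basic_open ?X H \<and>
     {p\<in>pspace UNIV. proj_map B p \<in> basic_open ?X H} = basic_open (pspace UNIV) H' \<and>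
     (\<exists>B'. finite B' \<and> B' \<subseteq> coord_ring UNIV (pspace UNIV) e' H' \<and>
        (\<forall>r\<in>coord_ring UNIV (pspace UNIV) e' H'. \<exists>c.
           (\<forall>b\<in>B'. c b \<in> coord_ring B ?X e H) \<and>
           (\<forall>p\<in>basic_open (pspace UNIV) H'. r p = (\<Sum>b\<in>B'. c b (proj_map B p) * b p))))"
    using H H' preimage by (intro exI[of _ "1::nat"] exI[of _ H] exI[of _ H'] conjI) simp_all
qed

subsection \<open>The fibres\<close>

lemma powi_eq_1_iff: "e powi z = 1 \<longleftrightarrow> int d dvd z"
proof -
  have "e powi z = e powi (int d * (z div int d)) * e powi (z mod int d)"
    using e_nz by (simp flip: power_int_add)
  also have "e powi (int d * (z div int d)) = 1" by (simp add: power_int_mult e_d)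
  finally have "e powi z = e ^ nat (z mod int d)"
    using d_pos by (simp add: power_int_nonneg_exp)
  hence "e powi z = 1 \<longleftrightarrow> d dvd nat (z mod int d)" by (simp add: e_pow_iff)
  also have "\<dots> \<longleftrightarrow> int d dvd int (nat (z mod int d))" by (simp only: int_dvd_int_iff)
  also have "int (nat (z mod int d)) = z mod int d" using d_pos by simp
  finally show ?thesis by (simp add: dvd_mod_iff)
qed

lemma powi_cong: "int d dvd x - y \<Longrightarrow> e powi x = e powi y"
proof -
  assume "int d dvd x - y"
  hence "e powi (x - y) = 1" by (simp add: powi_eq_1_iff)
  thus ?thesis using e_nz power_int_add[of e "x - y" y] by simp
qed

text \<open>The powers of \<open>e\<close> are already \<open>d\<close> different roots of a
  polynomial of degree \<open>d\<close>.\<close>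

lemma root_of_unity:
  assumes "x ^ d = 1"
  shows "\<exists>k<d. x = e ^ k"
proof -
  define p :: "'k poly" where "p = monom 1 d - 1"
  have p: "poly p t = t ^ d - 1" for t by (simp add: p_def poly_monom)
  have "coeff p d = 1" using d_pos by (simp add: p_def coeff_1)
  hence p0: "p \<noteq> 0" by auto
  have "degree p \<le> d" unfolding p_def by (intro degree_diff_le degree_monom_le) simp
  hence "card {t. poly p t = 0} \<le> d" using card_poly_roots_bound[OF p0] by simp
  moreover have sub: "(\<lambda>k. e ^ k) ` {..<d} \<subseteq> {t. poly p t = 0}"
    using e_d by (auto simp: p power_mult[symmetric] mult.commute[of _ d]) (metis power_mult power_one)
  moreover have "card ((\<lambda>k. e ^ k) ` {..<d}) = d"
    by (subst card_image) (auto intro: inj_onI e_pow_inj)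
  ultimately have "(\<lambda>k. e ^ k) ` {..<d} = {t. poly p t = 0}"
    using poly_roots_finite[OF p0] by (intro card_seteq) auto
  moreover have "x \<in> {t. poly p t = 0}" using assms by (simp add: p)
  ultimately show ?thesis by auto
qed

lemma inverse_mod:
  assumes "0 < c" "c < d"
  obtains b :: int where "int d dvd int c * b - 1"
proof -
  have "\<not> d dvd c" using assms by (auto dest: dvd_imp_le)
  hence "coprime (int c) (int d)" using prime_imp_coprime[OF prime_d] coprime_commute by auto
  then obtain b where "[int c * b = 1] (mod int d)" using cong_solve_coprime_int by blast
  thus ?thesis using that by (simp add: cong_iff_dvd_diff)
qed

text \<open>By the pure powers, corresponding coordinates differ by a factor e^(K i). What has to be
  solved is K i = h + W i j modulo \<open>d\<close> for the nonvanishing coordinates: up to two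
  congruences are solvable since 0, 1, a are distinct modulo \<open>d\<close>, and for three of them
  a mixed invariant monomial supplies the missing relation.\<close>

lemma fibre:
  assumes eq: "\<And>m. m \<in> M \<Longrightarrow> mval w m = mval v m"
  shows "\<exists>j<d. \<exists>\<zeta>. \<zeta> \<noteq> 0 \<and> w = (\<lambda>i. \<zeta> * (wt i ^ j * v i))"
proof -
  define W :: "var \<Rightarrow> int" where "W = case_var 0 1 (int a)"
  have "\<exists>k. w i = e powi k * v i" for i
  proof (cases "v i = 0")
    case True
    thus ?thesis using eq[OF pure_M, of i] d_pos by (simp add: zero_power)
  next
    case False
    hence "(w i / v i) ^ d = 1" using eq[OF pure_M, of i] by (simp add: power_divide)
    then obtain k where "w i / v i = e ^ k" using root_of_unity by blast
    thus ?thesis using False by (intro exI[of _ "int k"]) (simp add: field_simps)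
  qed
  then obtain K where K: "\<And>i. w i = e powi (K i) * v i" by metis
  have W: "W VX = 0" "W VY = 1" "W VZ = int a" by (simp_all add: W_def)
  have all: "\<forall>i. P i" if "P VX" "P VY" "P VZ" for P
    using that by (metis var.exhaust)
  have "\<exists>h j. \<forall>i. v i \<noteq> 0 \<longrightarrow> int d dvd K i - (h + W i * j)"
  proof (cases "v VX = 0")
    case True
    have "0 < a - 1" "a - 1 < d" using a2 a_le d_pos by auto
    then obtain b where b: "int d dvd int (a - 1) * b - 1" by (rule inverse_mod)
    \<comment> \<open>\<open>b\<close> inverts a - 1, the difference of the weights of z and
      y.\<close>
    define j where "j = b * (K VZ - K VY)"
    have "int d dvd (int (a - 1) * b - 1) * (K VY - K VZ)" using b by (rule dvd_mult2)
    also have "(int (a - 1) * b - 1) * (K VY - K VZ) = K VZ - ((K VY - j) + int a * j)"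
      using a2 by (simp add: j_def of_nat_diff algebra_simps)
    finally have "int d dvd K VZ - ((K VY - j) + int a * j)" .
    thus ?thesis using True by (intro exI[of _ "K VY - j"] exI[of _ j] all) (auto simp: W)
  next
    case X: False
    show ?thesis
    proof (cases "v VY = 0")
      case True
      have "0 < a" "a < d" using a2 a_le d_pos by auto
      then obtain b where b: "int d dvd int a * b - 1" by (rule inverse_mod)
      define j where "j = b * (K VZ - K VX)"
      have "int d dvd (int a * b - 1) * (K VX - K VZ)" using b by (rule dvd_mult2)
      also have "(int a * b - 1) * (K VX - K VZ) = K VZ - (K VX + int a * j)"
        by (simp add: j_def algebra_simps)
      finally have "int d dvd K VZ - (K VX + int a * j)" .
      thus ?thesis using True by (intro exI[of _ "K VX"] exI[of _ j] all) (auto simp: W)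
    next
      case Y: False
      show ?thesis
      proof (cases "v VZ = 0")
        case True
        thus ?thesis by (intro exI[of _ "K VX"] exI[of _ "K VY - K VX"] all) (auto simp: W)
      next
        case Z: False
        \<comment> \<open>Any element of \<open>J\<close> gives a mixed invariant monomial, with
          z-exponent prime to \<open>d\<close>.\<close>
        have "J \<noteq> {}" using card_J d_eq d5 by auto
        then obtain j0 where j0: "j0 \<in> J" by blast
        define t where "t = nrem d a j0"
        define x where "x = d - j0 - t"
        define j where "j = K VY - K VX"
        have m: "expvec x j0 t \<in> M" using j0 M_eq by (auto simp: gen_def x_def t_def)
        hence h: "x + j0 + t = d" "d dvd j0 + a * t" by (simp_all add: expvec_M_iff)
        have "e powi (K VX * int x + K VY * int j0 + K VZ * int t) * mval v (expvec x j0 t) = mval w (expvec x j0 t)"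
          using e_nz by (simp add: mval_expvec K power_mult_distrib power_int_add power_int_power' mult_ac)
        also have "\<dots> = mval v (expvec x j0 t)" by (rule eq[OF m])
        finally have "e powi (K VX * int x + K VY * int j0 + K VZ * int t) = 1"
          using X Y Z by (simp add: mval_expvec)
        hence 1: "int d dvd K VX * int x + K VY * int j0 + K VZ * int t" by (simp add: powi_eq_1_iff)
        have 2: "int d dvd int (j0 + a * t) * j" using h(2) by (intro dvd_mult2) (simp only: int_dvd_int_iff)
        have 3: "int d dvd int (x + j0 + t) * K VX" unfolding h(1) by simp
        \<comment> \<open>Subtracting \<open>K VX\<close> times the degree and \<open>j\<close>
          times the weight leaves only the contribution of z.\<close>
        have "int d dvd (K VX * int x + K VY * int j0 + K VZ * int t) - int (x + j0 + t) * K VX - int (j0 + a * t) * j"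
          by (intro dvd_diff 1 2 3)
        also have "\<dots> = int t * (K VZ - (K VX + int a * j))"
          by (simp add: j_def algebra_simps)
        finally have "int d dvd int t * (K VZ - (K VX + int a * j))" .
        moreover have "\<not> int d dvd int t"
          using nrem_pos[of j0] nrem_less[of j0] j0 by (auto simp: t_def J_def dest!: dvd_imp_le)
        ultimately have "int d dvd K VZ - (K VX + int a * j)"
          using prime_d by (simp add: prime_dvd_mult_iff)
        thus ?thesis by (intro exI[of _ "K VX"] exI[of _ j] all) (auto simp: W j_def)
      qed
    qed
  qed
  then obtain h j where hj: "\<And>i. v i \<noteq> 0 \<Longrightarrow> int d dvd K i - (h + W i * j)" by blast
  define j' where "j' = nat (j mod int d)"
  have j': "j' < d" "int d dvd j - int j'"
    using d_pos by (auto simp: j'_def nat_less_iff minus_mod_eq_mult_div)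
  have wt: "wt i ^ j' = e powi (W i * int j')" for i
    by (cases i) (simp_all add: W power_mult power_int_mult)
  have "w i = e powi h * (wt i ^ j' * v i)" for i
  proof (cases "v i = 0")
    case False
    have "int d dvd (K i - (h + W i * j)) + W i * (j - int j')"
      using hj[OF False] j'(2) by (intro dvd_add dvd_mult)
    hence "int d dvd K i - (h + W i * int j')" by (simp add: algebra_simps)
    hence "e powi (K i) = e powi (h + W i * int j')" by (rule powi_cong)
    thus ?thesis using K[of i] e_nz by (simp add: power_int_add wt)
  qed (simp add: K)
  moreover have "e powi h \<noteq> 0" using e_nz by simp
  ultimately show ?thesis using j'(1) by blast
qed

subsection \<open>Deck transformations\<close>

text \<open>Restricted to the plane because \<open>Bij\<close> contains extensional functions
  only.\<close>

definition rot :: "nat \<Rightarrow> (var, 'k) point \<Rightarrow> (var, 'k) point" where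
  "rot j = (\<lambda>p\<in>pspace UNIV. (\<lambda>v i. wt i ^ j * v i) ` p)"

lemma pspace_pt: "v \<noteq> (\<lambda>_. 0) \<Longrightarrow> pt v \<in> pspace UNIV" for v :: "var \<Rightarrow> 'k"
  by (rule pspaceI) auto

lemma rot_pt:
  assumes "v \<noteq> (\<lambda>_. 0)"
  shows "rot j (pt v) = pt (\<lambda>i. wt i ^ j * v i)"
proof -
  have "(\<lambda>v i. wt i ^ j * v i) ` pt v = pt (\<lambda>i. wt i ^ j * v i)"
    by (auto simp: pt_def image_def mult.left_commute)
  thus ?thesis using pspace_pt[OF assms] by (simp add: rot_def)
qed

lemma rot_nz: "v \<noteq> (\<lambda>_. 0) \<Longrightarrow> (\<lambda>i. wt i ^ j * v i) \<noteq> (\<lambda>_. 0)"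
  using wt_nz by (auto simp: fun_eq_iff)

lemma rot_pspace: "p \<in> pspace UNIV \<Longrightarrow> rot j p \<in> pspace UNIV"
  by (elim plane_cases) (simp add: rot_pt pspace_pt rot_nz)

lemma rot_rot: "p \<in> pspace UNIV \<Longrightarrow> rot i (rot j p) = rot (i + j) p"
  by (elim plane_cases) (simp add: rot_pt rot_nz power_add mult.assoc)

lemma rot_mod: "p \<in> pspace UNIV \<Longrightarrow> rot (j mod d) p = rot j p"
proof (elim plane_cases)
  fix v :: "var \<Rightarrow> 'k" assume v: "p = pt v" "v \<noteq> (\<lambda>_. 0)"
  have "wt i ^ j = (wt i ^ d) ^ (j div d) * wt i ^ (j mod d)" for i
    by (simp flip: power_mult power_add)
  hence "wt i ^ (j mod d) = wt i ^ j" for i by (simp add: wt_d)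
  thus ?thesis using v by (simp add: rot_pt)
qed

lemma rot_mod_ext: "rot (j mod d) = rot j"
proof
  fix p show "rot (j mod d) p = rot j p"
    using rot_mod[of p j] by (cases "p \<in> pspace UNIV") (auto simp: rot_def)
qed

lemma rot_0: "p \<in> pspace UNIV \<Longrightarrow> rot 0 p = p"
  by (elim plane_cases) (simp add: rot_pt)

lemma rot_inverse:
  assumes "p \<in> pspace UNIV" "j \<le> d"
  shows "rot (d - j) (rot j p) = p" "rot j (rot (d - j) p) = p"
  using assms rot_mod[of p d] by (simp_all add: rot_rot rot_0)

lemma rot_bij: "j \<le> d \<Longrightarrow> bij_betw (rot j) (pspace UNIV) (pspace UNIV)"
  by (rule bij_betw_byWitness[of _ "rot (d - j)"]) (auto simp: rot_inverse rot_pspace)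

lemma regular_rot:
  assumes "\<And>p. p \<in> pspace UNIV \<Longrightarrow> g p = rot j p"
  shows "regular_map UNIV UNIV g"
  unfolding regular_map_def
proof (intro ballI conjI)
  fix p :: "(var, 'k) point" assume p: "p \<in> pspace UNIV"
  thus "g p \<in> pspace UNIV" using assms rot_pspace by simp
  define A :: "var \<Rightarrow> (var, 'k) mpoly" where "A = (\<lambda>i. Const (wt i ^ j) * Var i)"
  have A: "A i \<in> forms UNIV 1" for i
    unfolding A_def by (intro forms_Const_times forms_Var UNIV_I)
  obtain v where v: "p = pt v" "v \<noteq> (\<lambda>_. 0)" using p by (rule plane_cases)
  have evA: "ev w (A i) = wt i ^ j * w i" for w i by (simp add: A_def)
  have "\<exists>i. ev v (A i) \<noteq> 0" using rot_nz[OF v(2)] by (auto simp: evA fun_eq_iff)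
  moreover have "g q = pt (\<lambda>i. if i \<in> UNIV then ev w (A i) else 0)"
    if q: "q \<in> pspace UNIV" "w \<in> q" for q w
    using assms[OF q(1)] pspaceE(1,2)[OF q] by (simp add: evA rot_pt)
  ultimately show "\<exists>n A. (\<forall>j\<in>UNIV. A j \<in> forms UNIV n) \<and> (\<exists>v\<in>p. \<exists>j\<in>UNIV. ev v (A j) \<noteq> 0) \<and>
     (\<forall>q\<in>pspace UNIV. \<forall>w\<in>q. (\<exists>j\<in>UNIV. ev w (A j) \<noteq> 0) \<longrightarrow>
        g q = pt (\<lambda>j. if j \<in> UNIV then ev w (A j) else 0))"
    using A pt_self[of v] v(1) by (intro exI[of _ 1] exI[of _ A]) blast
qed

lemma map_rot:
  assumes "p \<in> pspace UNIV"
  shows "proj_map B (rot j p) = proj_map B p"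
proof -
  obtain v where v: "p = pt v" "v \<noteq> (\<lambda>_. 0)" using assms by (rule plane_cases)
  have "coords B (\<lambda>i. wt i ^ j * v i) = coords B v"
  proof
    fix F
    show "coords B (\<lambda>i. wt i ^ j * v i) F = coords B v F"
    proof (cases "F \<in> B")
      case True
      hence "keys F \<subseteq> M" by (auto simp: B_def)
      thus ?thesis using diag_power_invariant[of F j v] by (simp add: coords_def)
    qed (simp add: coords_def)
  qed
  thus ?thesis using v by (simp add: rot_pt map_pt)
qed

lemma rot_deck: "rot j \<in> deck_trans UNIV (proj_map B)"
proof -
  \<comment> \<open>Reduced so that \<open>rot (d - i)\<close> is available as the inverse.\<close>
  define i where "i = j mod d"
  have i: "i \<le> d" using d_pos by (simp add: i_def less_imp_le)
  have inv: "inv_into (pspace UNIV) (rot i) p = rot (d - i) p" if "p \<in> pspace UNIV" for p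
    using inv_into_f_f[OF bij_betw_imp_inj_on[OF rot_bij[OF i]] rot_pspace[OF that, of "d - i"]]
      rot_inverse(2)[OF that i] by simp
  have "rot i \<in> Bij (pspace UNIV)" using rot_bij[OF i] by (auto simp: Bij_def rot_def)
  moreover have "regular_map UNIV UNIV (rot i)" by (rule regular_rot) simp
  moreover have "regular_map UNIV UNIV (inv_into (pspace UNIV) (rot i))"
    by (rule regular_rot[of _ "d - i"]) (rule inv)
  ultimately have "rot i \<in> deck_trans UNIV (proj_map B)"
    by (simp add: deck_trans_def map_rot)
  thus ?thesis by (simp add: i_def rot_mod_ext)
qed

lemma map_eq_imp_rot:
  assumes p: "p \<in> pspace UNIV" and p': "p' \<in> pspace UNIV" and eq: "proj_map B p = proj_map B p'"
  shows "\<exists>j<d. p' = rot j p"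
proof -
  obtain v where v: "p = pt v" "v \<noteq> (\<lambda>_. 0)" using p by (rule plane_cases)
  obtain w where w: "p' = pt w" "w \<noteq> (\<lambda>_. 0)" using p' by (rule plane_cases)
  have "coords B w \<in> pt (coords B v)" using eq pt_self[of "coords B w"] by (simp add: v w map_pt)
  then obtain c where c: "c \<noteq> 0" "coords B w = (\<lambda>F. c * coords B v F)" by (auto simp: mem_pt_iff)
  \<comment> \<open>Scaling by a d-th root of the factor makes the invariants equal, as
    \<open>fibre\<close> requires.\<close>
  obtain l where l: "l ^ d = c" using nth_root_exists[OF d_pos] by blast
  have l0: "l \<noteq> 0" using l c(1) d_pos by auto
  have "mval (\<lambda>i. 1 / l * w i) m = mval v m" if m: "m \<in> M" for m
  proof -
    have "mval w m = c * mval v m"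
      using fun_cong[OF c(2), of "mon m"] m by (simp add: coords_def B_def ev_mon image_iff)
    thus ?thesis using l l0 c(1) M_mdeg[OF m] by (simp only: mval_scale) (simp add: power_divide)
  qed
  from fibre[OF this] obtain j \<zeta> where j: "j < d" "\<zeta> \<noteq> 0" "(\<lambda>i. 1 / l * w i) = (\<lambda>i. \<zeta> * (wt i ^ j * v i))"
    by blast
  have "p' = pt (\<lambda>i. 1 / l * w i)" using l0 by (subst pt_scale) (auto simp: w)
  also have "\<dots> = pt (\<lambda>i. wt i ^ j * v i)" unfolding j(3) by (rule pt_scale[OF j(2)])
  also have "\<dots> = rot j p" using v by (simp add: rot_pt)
  finally show ?thesis using j(1) by blast
qed

lemma galois_covering_B: "galois_covering UNIV B (proj_map B)"
  unfolding galois_covering_def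
  using regular_map_B finite_map_B map_eq_imp_rot rot_deck by metis

section \<open>Rigidity of deck transformations\<close>

lemma pt_eq_if_proportional:
  fixes x y :: "var \<Rightarrow> 'k"
  assumes "\<And>i l. x i * y l = x l * y i" "x \<noteq> (\<lambda>_. 0)" "y \<noteq> (\<lambda>_. 0)"
  shows "pt x = pt y"
proof -
  obtain l where l: "y l \<noteq> 0" using assms(3) by auto
  have x: "x = (\<lambda>i. (x l / y l) * y i)"
    using assms(1)[of _ l] l by (auto simp: field_simps)
  moreover have "x l / y l \<noteq> 0" using assms(2) x by auto
  ultimately show ?thesis by (metis pt_scale)
qed

text \<open>x has weight 0 and y has weight 1: the x-coordinate fixes the scalar, the y-coordinate
  the power of \<open>e\<close>.\<close>

lemma rot_inj:
  assumes "rot i (pt v) = rot j (pt v)" "\<And>x. v x \<noteq> 0" "i < d" "j < d"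
  shows "i = j"
proof -
  have nz: "v \<noteq> (\<lambda>_. 0)" using assms(2) by (auto simp: fun_eq_iff)
  have "(\<lambda>x. wt x ^ i * v x) \<in> pt (\<lambda>x. wt x ^ j * v x)"
    using assms(1) pt_self[of "\<lambda>x. wt x ^ i * v x"] by (simp add: rot_pt[OF nz])
  then obtain c where c: "(\<lambda>x. wt x ^ i * v x) = (\<lambda>x. c * (wt x ^ j * v x))"
    by (auto simp: mem_pt_iff)
  have "c = 1" using fun_cong[OF c, of VX] assms(2) by simp
  hence "e ^ i = e ^ j" using fun_cong[OF c, of VY] assms(2) by simp
  thus ?thesis using e_pow_inj assms(3,4) by blast
qed

text \<open>On the domain of one local representation, the plane is the union of the \<open>d\<close> closed sets on
  which the deck transformation agrees with a given rotation, so by irreducibility one of these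
  sets is everything.\<close>

lemma deck_local:
  assumes g: "\<And>p. p \<in> pspace UNIV \<Longrightarrow> \<exists>j<d. g p = rot j p"
    and A: "\<And>q w. q \<in> pspace UNIV \<Longrightarrow> w \<in> q \<Longrightarrow> \<exists>i. ev w (A i) \<noteq> 0 \<Longrightarrow> g q = pt (\<lambda>i. ev w (A i))"
    and A0: "A i0 \<noteq> 0"
  shows "\<exists>j<d. \<forall>q\<in>pspace UNIV. \<forall>w\<in>q. (\<exists>i. ev w (A i) \<noteq> 0) \<longrightarrow> g q = rot j q"
proof -
  \<comment> \<open>The minors of the matrix formed by the representation \<open>A\<close> and the
    j-th rotation; they vanish wherever both define the same point.\<close>
  define D where "D = (\<lambda>j i l. A i * (Const (wt l ^ j) * Var l) - A l * (Const (wt i ^ j) * Var i))"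
  have evD: "ev w (D j i l) = ev w (A i) * (wt l ^ j * w l) - ev w (A l) * (wt i ^ j * w i)" for w j i l
    by (simp add: D_def)
  have "\<exists>j<d. \<forall>i l. D j i l = 0"
  proof (rule ccontr)
    assume "\<not> (\<exists>j<d. \<forall>i l. D j i l = 0)"
    then obtain i l where il: "\<And>j. j < d \<Longrightarrow> D j (i j) (l j) \<noteq> 0" by metis
    \<comment> \<open>A point off all these hypersurfaces is in none of the closed sets of
      agreement, although \<open>g\<close> agrees with some rotation there.\<close>
    have "finite (insert (A i0) ((\<lambda>j. D j (i j) (l j)) ` {..<d}))" by simp
    moreover have "0 \<notin> insert (A i0) ((\<lambda>j. D j (i j) (l j)) ` {..<d})" using il A0 by auto
    ultimately obtain v where v: "\<And>i. v i \<noteq> 0"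
        "\<And>F. F \<in> insert (A i0) ((\<lambda>j. D j (i j) (l j)) ` {..<d}) \<Longrightarrow> ev v F \<noteq> 0"
      using generic_point by blast
    have nz: "v \<noteq> (\<lambda>_. 0)" using v(1) by (auto simp: fun_eq_iff)
    have p: "pt v \<in> pspace UNIV" by (rule pspace_pt[OF nz])
    obtain j where j: "j < d" "g (pt v) = rot j (pt v)" using g[OF p] by blast
    have "g (pt v) = pt (\<lambda>i. ev v (A i))" using A[OF p pt_self] v(2) by blast
    hence "pt (\<lambda>i. ev v (A i)) = pt (\<lambda>i. wt i ^ j * v i)" using j(2) rot_pt[OF nz] by simp
    hence "(\<lambda>i. ev v (A i)) \<in> pt (\<lambda>i. wt i ^ j * v i)" using pt_self by metis
    then obtain c where c: "(\<lambda>i. ev v (A i)) = (\<lambda>i. c * (wt i ^ j * v i))" by (auto simp: mem_pt_iff)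
    have "ev v (A i) = c * (wt i ^ j * v i)" for i using fun_cong[OF c, of i] .
    hence "ev v (D j (i j) (l j)) = 0" unfolding evD by simp
    thus False using v(2) j(1) by blast
  qed
  then obtain j where j: "j < d" "\<And>i l. D j i l = 0" by blast
  have "g q = rot j q" if q: "q \<in> pspace UNIV" "w \<in> q" "\<exists>i. ev w (A i) \<noteq> 0" for q w
  proof -
    have w: "q = pt w" "w \<noteq> (\<lambda>_. 0)" using pspaceE[OF q(1,2)] by auto
    have "ev w (A i) * (wt l ^ j * w l) = ev w (A l) * (wt i ^ j * w i)" for i l
      using evD[of w j i l] j(2) by simp
    hence "pt (\<lambda>i. ev w (A i)) = pt (\<lambda>i. wt i ^ j * w i)"
      using q(3) rot_nz[OF w(2)] by (intro pt_eq_if_proportional) (auto simp: fun_eq_iff)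
    thus ?thesis using A[OF q] w by (simp add: rot_pt)
  qed
  thus ?thesis using j(1) by blast
qed

text \<open>Each local representation comes with its own rotation number. Two representations are
  both defined at a suitable point with nonzero coordinates, where \<open>rot_inj\<close> makes the
  numbers equal.\<close>

lemma deck_trans_eq: "deck_trans UNIV (proj_map B) = rot ` {..<d}"
proof (intro equalityI subsetI)
  fix g assume g: "g \<in> deck_trans UNIV (proj_map B)"
  have reg: "regular_map UNIV UNIV g" and ext: "g \<in> extensional (pspace UNIV)"
    and map: "\<And>p. p \<in> pspace UNIV \<Longrightarrow> proj_map B (g p) = proj_map B p"
    using g by (auto simp: deck_trans_def Bij_def)
  have gp: "g p \<in> pspace UNIV" if "p \<in> pspace UNIV" for p using reg that by (simp add: regular_map_def)
  have ex: "\<exists>j<d. g p = rot j p" if "p \<in> pspace UNIV" for p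
    using map_eq_imp_rot[OF that gp[OF that]] map[OF that] by simp
  define R where "R = (\<lambda>A j i0 p. A i0 \<noteq> (0 :: (var, 'k) mpoly) \<and> j < d \<and> g p = rot j p \<and>
      (\<forall>q\<in>pspace UNIV. \<forall>w\<in>q. (\<exists>i. ev w (A i) \<noteq> 0) \<longrightarrow> g q = rot j q))"
  have loc: "\<exists>A j i0. R A j i0 p"
    if p: "p \<in> pspace UNIV" for p
  proof -
    from reg p obtain A :: "var \<Rightarrow> (var, 'k) mpoly" where A: "\<exists>v\<in>p. \<exists>j. ev v (A j) \<noteq> 0"
      "\<And>q w. q \<in> pspace UNIV \<Longrightarrow> w \<in> q \<Longrightarrow> \<exists>i. ev w (A i) \<noteq> 0 \<Longrightarrow> g q = pt (\<lambda>i. ev w (A i))"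
      unfolding regular_map_def by (simp (no_asm_use)) metis
    from A(1) obtain v i0 where i0: "v \<in> p" "ev v (A i0) \<noteq> 0" by blast
    hence "A i0 \<noteq> 0" by auto
    moreover from deck_local[OF ex A(2) this] obtain j where
      "j < d" "\<forall>q\<in>pspace UNIV. \<forall>w\<in>q. (\<exists>i. ev w (A i) \<noteq> 0) \<longrightarrow> g q = rot j q" by blast
    ultimately show ?thesis using p i0 unfolding R_def by blast
  qed
  have "pt (\<lambda>_. 1) \<in> (pspace UNIV :: (var, 'k) point set)" by (rule pspace_pt) (auto simp: fun_eq_iff)
  from loc[OF this] obtain A j i0 where "R A j i0 (pt (\<lambda>_. 1))" by blast
  hence A: "A i0 \<noteq> 0" "j < d" "g (pt (\<lambda>_. 1)) = rot j (pt (\<lambda>_. 1))"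
    "\<forall>q\<in>pspace UNIV. \<forall>w\<in>q. (\<exists>i. ev w (A i) \<noteq> 0) \<longrightarrow> g q = rot j q" unfolding R_def by blast+
  have "g p = rot j p" if p: "p \<in> pspace UNIV" for p
  proof -
    from loc[OF p] obtain A' j' i0' where "R A' j' i0' p" by blast
    hence A': "A' i0' \<noteq> 0" "j' < d" "g p = rot j' p"
      "\<forall>q\<in>pspace UNIV. \<forall>w\<in>q. (\<exists>i. ev w (A' i) \<noteq> 0) \<longrightarrow> g q = rot j' q" unfolding R_def by blast+
    obtain v where v: "\<And>i. v i \<noteq> 0" "ev v (A i0) \<noteq> 0" "ev v (A' i0') \<noteq> 0"
      using generic_point[of "{A i0, A' i0'}"] A(1) A'(1) by (metis finite.emptyI finite_insert insert_iff singletonD)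
    have "pt v \<in> pspace UNIV" using v(1) by (intro pspace_pt) (auto simp: fun_eq_iff)
    hence "rot j (pt v) = rot j' (pt v)" using A(4) A'(4) v(2,3) pt_self by metis
    hence "j = j'" using rot_inj v(1) A(2) A'(2) by blast
    thus ?thesis using A'(3) by simp
  qed
  hence "g = rot j" using ext by (intro extensionalityI[of g "pspace UNIV"]) (auto simp: rot_def)
  thus "g \<in> rot ` {..<d}" using A(2) by blast
qed (use rot_deck in auto)

text \<open>An integer in 0, ..., d - 1 is sent to its rotation; addition modulo \<open>d\<close> is
  respected because \<open>rot\<close> has period \<open>d\<close>.\<close>

lemma deck_group_iso: "deck_group UNIV (proj_map B :: (var, 'k) point \<Rightarrow> _) \<cong> integer_mod_group d"
proof (rule group.iso_sym[OF group_integer_mod_group])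
  define h where "h = (\<lambda>z :: int. rot (nat z))"
  let ?G = "deck_group UNIV (proj_map B :: (var, 'k) point \<Rightarrow> _)"
  have carrier: "carrier ?G = rot ` {..<d}"
    by (simp add: deck_group_def deck_trans_eq)
  have Bij: "rot j \<in> Bij (pspace UNIV)" for j using rot_deck[of j] by (simp add: deck_trans_def)
  have mult: "rot i \<otimes>\<^bsub>?G\<^esub> rot j = rot (i + j)" for i j
  proof -
    have "rot i \<otimes>\<^bsub>?G\<^esub> rot j = compose (pspace UNIV) (rot i) (rot j)"
      by (simp add: deck_group_def BijGroup_def Bij)
    also have "\<dots> = rot (i + j)"
    proof
      fix p show "compose (pspace UNIV) (rot i) (rot j) p = rot (i + j) p"
        using rot_rot[of p i j] by (cases "p \<in> pspace UNIV") (auto simp: compose_def rot_def)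
    qed
    finally show ?thesis .
  qed
  have "h \<in> hom (integer_mod_group d) ?G"
  proof (rule homI)
    fix x assume "x \<in> carrier (integer_mod_group d)"
    thus "h x \<in> carrier ?G" using d_pos by (auto simp: h_def carrier carrier_integer_mod_group)
  next
    fix x y assume "x \<in> carrier (integer_mod_group d)" "y \<in> carrier (integer_mod_group d)"
    hence "nat ((x + y) mod int d) = (nat x + nat y) mod d"
      using d_pos by (simp add: carrier_integer_mod_group nat_mod_distrib nat_add_distrib)
    thus "h (x \<otimes>\<^bsub>integer_mod_group d\<^esub> y) = h x \<otimes>\<^bsub>?G\<^esub> h y"
      by (simp add: h_def mult rot_mod_ext)
  qed
  moreover have "bij_betw h (carrier (integer_mod_group d)) (carrier ?G)"
  proof (rule bij_betw_imageI)
    show "inj_on h (carrier (integer_mod_group d))"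
    proof (rule inj_onI)
      fix x y assume xy: "x \<in> carrier (integer_mod_group d)" "y \<in> carrier (integer_mod_group d)" "h x = h y"
      hence "nat x = nat y"
        using d_pos by (intro rot_inj[of "nat x" "\<lambda>_. 1" "nat y"]) (auto simp: h_def carrier_integer_mod_group)
      thus "x = y" using xy d_pos by (auto simp: carrier_integer_mod_group)
    qed
    show "h ` carrier (integer_mod_group d) = carrier ?G"
    proof
      show "carrier ?G \<subseteq> h ` carrier (integer_mod_group d)"
        unfolding carrier using d_pos
        by (auto simp: h_def carrier_integer_mod_group intro!: image_eqI[of _ _ "int _"])
    qed (use d_pos in \<open>auto simp: h_def carrier carrier_integer_mod_group\<close>)
  qed
  ultimately show "integer_mod_group d \<cong> ?G" by (intro is_isoI isoI)
qed

text \<open>The weights \<open>wt\<close> serve as the representation: its invariant forms of degree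
  \<open>d\<close> are the linear combinations of the monomials in \<open>M\<close>, so both sets
  generate the same ideal.\<close>

lemma GT_system_I: "GT_system d I"
proof -
  have "I = ideal_gen {F \<in> forms UNIV d. diag_act wt F = F}"
  proof (rule ideal_gen_eqI)
    have "mon m \<in> {F \<in> forms UNIV d. diag_act wt F = F}" if "m \<in> M" for m
    proof -
      have "mon m \<in> (forms UNIV d :: (var, 'k) mpoly set)" using M_mdeg[OF that] by (auto intro: forms_mon)
      thus ?thesis using keys_subset_M_iff[of "mon m"] that by simp
    qed
    thus "mon ` M \<subseteq> ideal_gen {F \<in> forms UNIV d. diag_act wt F = F}"
      using ideal_gen_superset by blast
    show "{F \<in> forms UNIV d. diag_act wt F = F} \<subseteq> I"
      using mem_I_iff keys_subset_M_iff by blast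
  qed
  moreover have "\<forall>B'. B' \<subset> B \<longrightarrow> ideal_gen B' \<noteq> I"
    using ideal_gen_psubset_mon[OF finite_M M_mdeg] by (auto simp: B_def)
  moreover have "ideal_gen B = I" by (simp add: B_def)
  ultimately show ?thesis
    unfolding GT_system_def
    using togliatti_I[OF card_M_le] wt_d finite_B B_forms galois_covering_B deck_group_iso by blast
qed

end

theorem proposition5p15:
  fixes d k a :: nat and e :: "'k :: {alg_closed_field, field_char_0}"
  assumes "prime d" and "d \<ge> 5" and "d = 2 * k + 1"
    and "2 \<le> a" and "a \<le> d - 1"
    and "primitive_root_of_unity d e"
  shows
    "(min_num_gens (I_ideal e d a) = k + 3 \<and>
      (\<exists>i :: nat \<Rightarrow> nat. strict_mono_on {1..k} i \<and>
         (\<forall>j\<in>{1..k}. 1 \<le> i j \<and> i j \<le> d - 1 \<and> i j + nrem d a (i j) \<le> d) \<and>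
         I_ideal e d a =
           ideal_gen ({mon (expvec d 0 0), mon (expvec 0 d 0), mon (expvec 0 0 d)} \<union>
             (\<lambda>j. mon (expvec (d - i j - nrem d a (i j)) (i j) (nrem d a (i j)))) ` {1..k}))) \<and>
     coincide_up_to_perm {I_ideal e d 2, I_ideal e d (d - 1), I_ideal e d (k + 1)} \<and>
     (a \<noteq> 2 \<and> a \<noteq> d - 1 \<and> a \<noteq> (d + 1) div 2 \<and> \<not> [inv_mod d a = d - a + 1] (mod d) \<longrightarrow>
       (let b = inv_mod d a; c = inv_mod d (d - a + 1)
        in coincide_up_to_perm
             {I_ideal e d a, I_ideal e d b, I_ideal e d c,
              I_ideal e d (d - a + 1), I_ideal e d (d - b + 1), I_ideal e d (d - c + 1)})) \<and>
     ([inv_mod d a = d - a + 1] (mod d) \<longrightarrow>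
       coincide_up_to_perm {I_ideal e d a, I_ideal e d (d - a + 1)}) \<and>
     (minimal_monomial_togliatti d (I_ideal e d a) \<and>
      smooth_system d (I_ideal e d a) \<and>
      GT_system d (I_ideal e d a))"
proof -
  interpret prime_GT d k a e
    using assms by unfold_locales
  have I: "I_ideal e d a = I" by (simp add: I_eq M_def)
  show ?thesis
    unfolding Let_def
  proof (intro conjI impI)
    show "min_num_gens (I_ideal e d a) = k + 3"
      unfolding I by (simp add: min_num_gens_mon[OF finite_M M_mdeg] card_M)
    show "\<exists>i :: nat \<Rightarrow> nat. strict_mono_on {1..k} i \<and>
         (\<forall>j\<in>{1..k}. 1 \<le> i j \<and> i j \<le> d - 1 \<and> i j + nrem d a (i j) \<le> d) \<and>
         I_ideal e d a =
           ideal_gen ({mon (expvec d 0 0), mon (expvec 0 d 0), mon (expvec 0 0 d)} \<union>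
             (\<lambda>j. mon (expvec (d - i j - nrem d a (i j)) (i j) (nrem d a (i j)))) ` {1..k})"
      unfolding I by (rule generators)
    show "coincide_up_to_perm {I_ideal e d 2, I_ideal e d (d - 1), I_ideal e d (k + 1)}"
      by (rule coincide_special)
  qed (rule coincide_orbit coincide_reflect minimal_I[OF card_M_le, folded I]
      smooth_I[folded I] GT_system_I[folded I])+
qed

end
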